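(* Let $H$ be a strictly $2$-balanced graph with $h$ vertices and $k$ edges, and fix $0<c<\left(\frac{e}{k-1}\right)^{\frac{1}{k-1}}$. Let $x^\ast=\left(\frac{W((k-1)c^{k-1})}{k-1}\right)^{\frac{1}{k-1}}$. If $p\sim c\,\Delta_H^{-\frac{1}{k-1}}$ (equivalently $p\sim c\left(\frac{|\mathrm{Aut}(H)|}{2k}\right)^{\frac{1}{k-1}}n^{-1/m_2(H)}$), then $$\lim_{n\to\infty}\Delta_H^{\frac{1}{k-1}}\binom{n}{2}^{-1}\log\mathbb{P}_p(\mathbf X_H=0)=x^\ast+\left(1-\frac1k\right)(x^\ast)^k-c.$$ Moreover, if $0<b<(k-1)^{-\frac{1}{k-1}}$ is fixed and $m\sim b\,\Delta_H^{-\frac{1}{k-1}}\binom n2$, then $$\lim_{n\to\infty}\Delta_H^{\frac{1}{k-1}}\binom{n}{2}^{-1}\log\mathbb{P}_m(\mathbf X_H=0)=-\frac{b^k}{k},$$ i.e. $\log\mathbb{P}_m(\mathbf X_H=0)\sim-\mathbb{E}_m\mathbf X_H$.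
   Context: For a graph $H$, $m_2(H)=\max_{F\subseteq H,|V(F)|\ge3}\frac{|E(F)|-1}{|V(F)|-2}$; $H$ (with $|E(H)|\ge3$) is strictly $2$-balanced if this maximum is attained uniquely at $F=H$. $\mathbf X_H$ denotes the number of copies of $H$ in the random graph; $\mathbb{P}_p,\mathbb{E}_p$ refer to $G(n,p)$ and $\mathbb{P}_m,\mathbb{E}_m$ to $G(n,m)$ (uniform graph on $[n]$ with $m$ edges). $\mathrm{Aut}(H)$ is the automorphism group of $H$, $(n)_j=n(n-1)\cdots(n-j+1)$, and $\Delta_H=\frac{2k\,(n-2)_{h-2}}{|\mathrm{Aut}(H)|}$ (the number of copies of $H$ in $K_n$ containing a given edge). $W$ is the Lambert $W$ function (inverse of $y\mapsto ye^y$ on $[0,\infty)$). $f\sim g$ means $f/g\to1$ as $n\to\infty$. *)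

theory Defs
  imports "HOL-Analysis.Analysis" "HOL-Library.Landau_Symbols"
begin

definition simple_graph :: "'a set \<Rightarrow> 'a set set \<Rightarrow> bool" where
  "simple_graph V E \<longleftrightarrow> finite V \<and> (\<forall>e\<in>E. e \<subseteq> V \<and> card e = 2)"

definition subgraph :: "'a set \<Rightarrow> 'a set set \<Rightarrow> 'a set \<Rightarrow> 'a set set \<Rightarrow> bool" where
  "subgraph FV FE V E \<longleftrightarrow> FV \<subseteq> V \<and> FE \<subseteq> E \<and> (\<forall>e\<in>FE. e \<subseteq> FV)"

definition d2 :: "'a set \<Rightarrow> 'a set set \<Rightarrow> real" where
  "d2 FV FE = (real (card FE) - 1) / (real (card FV) - 2)"

definition m2 :: "'a set \<Rightarrow> 'a set set \<Rightarrow> real" where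
  "m2 V E = Max {d2 FV FE | FV FE. subgraph FV FE V E \<and> card FV \<ge> 3}"

definition strictly_2_balanced :: "'a set \<Rightarrow> 'a set set \<Rightarrow> bool" where
  "strictly_2_balanced V E \<longleftrightarrow> card E \<ge> 3 \<and> d2 V E = m2 V E \<and>
     (\<forall>FV FE. subgraph FV FE V E \<and> card FV \<ge> 3 \<and> d2 FV FE = m2 V E \<longrightarrow> FV = V \<and> FE = E)"

definition Aut :: "'a set \<Rightarrow> 'a set set \<Rightarrow> ('a \<Rightarrow> 'a) set" where
  "Aut V E = {\<phi>. bij_betw \<phi> V V \<and> (\<forall>x. x \<notin> V \<longrightarrow> \<phi> x = x) \<and>
                 (\<forall>e. e \<subseteq> V \<longrightarrow> (\<phi> ` e \<in> E \<longleftrightarrow> e \<in> E))}"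

definition ffact_real :: "real \<Rightarrow> nat \<Rightarrow> real" where
  "ffact_real x j = (\<Prod>i<j. x - real i)"

text \<open>Delta_H = 2k (n-2)_{h-2} / |Aut(H)|, the number of copies of H in K_n containing a given edge.\<close>
definition Delta_H :: "'a set \<Rightarrow> 'a set set \<Rightarrow> nat \<Rightarrow> real" where
  "Delta_H V E n = 2 * real (card E) * ffact_real (real n - 2) (card V - 2) / real (card (Aut V E))"

definition all_edges :: "nat \<Rightarrow> nat set set" where
  "all_edges n = {{a, b} | a b. a < n \<and> b < n \<and> a \<noteq> b}"

definition copies :: "'a set \<Rightarrow> 'a set set \<Rightarrow> nat \<Rightarrow> nat set set \<Rightarrow> (nat set \<times> nat set set) set" where
  "copies V E n G = {(\<phi> ` V, (\<lambda>e. \<phi> ` e) ` E) | \<phi>. inj_on \<phi> V \<and> \<phi> ` V \<subseteq> {..<n} \<and> (\<lambda>e. \<phi> ` e) ` E \<subseteq> G}"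

definition X_H :: "'a set \<Rightarrow> 'a set set \<Rightarrow> nat \<Rightarrow> nat set set \<Rightarrow> nat" where
  "X_H V E n G = card (copies V E n G)"

definition prob_Gnp :: "nat \<Rightarrow> real \<Rightarrow> (nat set set \<Rightarrow> bool) \<Rightarrow> real" where
  "prob_Gnp n p P = (\<Sum>G\<in>{G. G \<subseteq> all_edges n \<and> P G}.
      p ^ card G * (1 - p) ^ (card (all_edges n) - card G))"

definition prob_Gnm :: "nat \<Rightarrow> nat \<Rightarrow> (nat set set \<Rightarrow> bool) \<Rightarrow> real" where
  "prob_Gnm n m P = real (card {G. G \<subseteq> all_edges n \<and> card G = m \<and> P G})
      / real (card (all_edges n) choose m)"

definition LambertW :: "real \<Rightarrow> real" where
  "LambertW x = (THE w. w \<ge> 0 \<and> w * exp w = x)"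

end

theory Submission
  imports Defs
begin

text \<open>
  The copies of \<open>H\<close> in \<open>K\<^sub>n\<close> form a \<open>k\<close>-uniform, \<open>\<Delta>\<close>-regular hypergraph on the edges of \<open>K\<^sub>n\<close>, and the
  \<open>H\<close>-free graphs are its independent sets. Strict 2-balancedness makes all codegrees negligible on
  the scale \<open>q = \<Delta> powr (- 1 / (k - 1))\<close>, so the hypergraph looks locally like a tree. In the hard-core model
  with activity \<open>c q\<close>, let \<open>\<rho>\<close> be the conditional probability that adding a vertex creates no
  edge. Exploring neighbourhoods to bounded depth gives, up to \<open>o(1)\<close>, alternating upper and
  lower bounds on \<open>\<rho>\<close> by the iterates of \<open>s \<mapsto> exp (- (c s)^(k-1))\<close>, which converge to the fixed
  point \<open>exp (- x^(k-1))\<close>, \<open>c = x exp (x^(k-1))\<close>, in the stated range of \<open>c\<close>. Since the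
  derivative of the normalised free energy in \<open>c\<close> is the mean of \<open>\<rho>\<close>, integration in the
  variable \<open>x\<close> yields \<open>x + (1 - 1/k) x^k\<close>. This is the \<open>G(n,p)\<close> statement; the \<open>G(n,m)\<close>
  statement follows by tilting the activity, because the probability that \<open>m\<close> random edges
  are \<open>H\<close>-free decreases in \<open>m\<close>.
\<close>

section \<open>Weights of independent sets\<close>

text \<open>The ratio has to be bounded in every partially revealed state, not only in the initial
  one: the chain rule for the probability that a link set is occupied conditions on the earlier
  vertices of that set, and this shrinks edges. Each level of the recursion decides at most
  \<open>k\<close> further vertices, so at a fixed depth only boundedly many are decided and the
  errors \<open>2 ^ T * d\<close> vanish. The two directions are not symmetric. An upper bound on
  the ratio needs a lower bound on occupation probabilities, which fails for a set blocked by other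
  constraints, so edges that could close a cycle are thrown away first; a lower bound on the ratio
  must keep all link sets, shrunken ones included, and codegrees bound their total weight. Both
  thresholds are the single condition \<open>(k-1) x^(k-1) < 1\<close>: for
  \<open>c = x exp (x^(k-1))\<close> one has \<open>(k-1) c^(k-1) = z exp z\<close> with
  \<open>z = (k-1) x^(k-1)\<close>, so the bound on \<open>c\<close> reads \<open>z < 1\<close>, and
  the bound on \<open>b\<close> is the same condition at \<open>x = b\<close>. In the uniform model
  the tilt aims slightly above \<open>m\<close>, because monotonicity controls only sizes at least
  \<open>m\<close>.\<close>

definition avoids :: "'b set set \<Rightarrow> 'b set \<Rightarrow> bool" where
  "avoids F I \<longleftrightarrow> (\<forall>f\<in>F. \<not> f \<subseteq> I)"

text \<open>The hard-core partition function at activity \<open>l\<close>, restricted to sets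
  containing \<open>g\<close>; so \<open>wt l U F g / wt l U F {}\<close> is the probability that
  the random independent set contains \<open>g\<close>. \<open>F\<close> may contain sets of
  different sizes, since constraints shrink as vertices get occupied.\<close>

definition wt :: "real \<Rightarrow> 'b set \<Rightarrow> 'b set set \<Rightarrow> 'b set \<Rightarrow> real" where
  "wt l U F g = (\<Sum>I\<in>{I. I \<subseteq> U \<and> avoids F I \<and> g \<subseteq> I}. l ^ card I)"

definition link :: "'b \<Rightarrow> 'b set set \<Rightarrow> 'b set set" where
  "link w F = (\<lambda>f. f - {w}) ` {f\<in>F. w \<in> f}"

text \<open>The hard-core probability, conditioned on \<open>w\<close> being absent, that
  \<open>w\<close> could be added. Keeping all of \<open>F\<close> in the denominator is harmless: a
  forbidden set through \<open>w\<close> never lies inside \<open>U - {w}\<close>.\<close>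

definition open_ratio :: "real \<Rightarrow> 'b set \<Rightarrow> 'b set set \<Rightarrow> 'b \<Rightarrow> real" where
  "open_ratio l U F w = wt l (U - {w}) (F \<union> link w F) {} / wt l (U - {w}) F {}"

lemma finite_wt_index [simp]: "finite U \<Longrightarrow> finite {I. I \<subseteq> U \<and> P I}"
  by (rule finite_subset[of _ "Pow U"]) auto

lemma wt_nonneg: "l \<ge> 0 \<Longrightarrow> wt l U F g \<ge> 0"
  unfolding wt_def by (intro sum_nonneg) auto

lemma wt_mono:
  assumes "finite U'" "l \<ge> 0" "U \<subseteq> U'" "F' \<subseteq> F" "g' \<subseteq> g"
  shows "wt l U F g \<le> wt l U' F' g'"
  unfolding wt_def
  by (rule sum_mono2) (use assms in \<open>auto simp: avoids_def\<close>)

lemma wt_ge_1: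
  fixes U :: "'b set"
  assumes "finite U" "l \<ge> 0" "{} \<notin> F"
  shows "wt l U F {} \<ge> 1"
proof -
  have "(\<Sum>I\<in>{{} :: 'b set}. l ^ card I) \<le> wt l U F {}"
    unfolding wt_def by (rule sum_mono2) (use assms in \<open>auto simp: avoids_def\<close>)
  then show ?thesis by simp
qed

lemma wt_empty_forbidden: "{} \<in> F \<Longrightarrow> wt l U F g = 0"
  unfolding wt_def avoids_def by (rule sum.neutral) auto

lemma wt_insert_forbidden:
  assumes "finite U"
  shows "wt l U (insert g F) {} = wt l U F {} - wt l U F g"
proof -
  have "{I. I \<subseteq> U \<and> avoids (insert g F) I \<and> {} \<subseteq> I} =
      {I. I \<subseteq> U \<and> avoids F I \<and> {} \<subseteq> I} - {I. I \<subseteq> U \<and> avoids F I \<and> g \<subseteq> I}"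
    by (auto simp: avoids_def)
  then show ?thesis
    unfolding wt_def using assms by (simp only:) (rule sum_diff; force)
qed

text \<open>Removing the occupied vertex \<open>w\<close> turns each constraint through
  \<open>w\<close> into its link and leaves the others as they are; the removed vertex pays the
  factor \<open>l\<close>.\<close>

lemma wt_insert_vertex:
  assumes "finite U" "w \<notin> U" "w \<notin> g"
  shows "wt l (insert w U) F (insert w g) = l * wt l U (F \<union> link w F) g"
proof -
  have av: "avoids (F \<union> link w F) I \<longleftrightarrow> avoids F (insert w I)" if "I \<subseteq> U" for I
  proof
    assume a: "avoids (F \<union> link w F) I"
    show "avoids F (insert w I)"
      unfolding avoids_def
    proof (intro ballI notI)
      fix f assume f: "f \<in> F" "f \<subseteq> insert w I"
      show False
      proof (cases "w \<in> f")
        case True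
        then have "f - {w} \<in> link w F" using f by (auto simp: link_def)
        moreover have "f - {w} \<subseteq> I" using f by auto
        ultimately show False using a unfolding avoids_def by blast
      next
        case False then show False using a f by (auto simp: avoids_def)
      qed
    qed
  next
    assume a: "avoids F (insert w I)"
    have "\<not> f \<subseteq> I" if "f \<in> F" for f using a that by (auto simp: avoids_def)
    moreover have "\<not> f - {w} \<subseteq> I" if "f \<in> F" for f using a that by (auto simp: avoids_def)
    ultimately show "avoids (F \<union> link w F) I"
      unfolding avoids_def link_def by blast
  qed
  have eq: "{I. I \<subseteq> insert w U \<and> avoids F I \<and> insert w g \<subseteq> I} =
        insert w ` {I. I \<subseteq> U \<and> avoids (F \<union> link w F) I \<and> g \<subseteq> I}" (is "?A = insert w ` ?B")
  proof (intro equalityI subsetI)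
    fix I assume I: "I \<in> ?A"
    then have ww: "insert w (I - {w}) = I" by auto
    moreover have "I - {w} \<in> ?B" using I assms av[of "I - {w}"] ww by auto
    ultimately show "I \<in> insert w ` ?B" by (metis (no_types, lifting) image_eqI)
  next
    fix I assume "I \<in> insert w ` ?B"
    then show "I \<in> ?A" using av by auto
  qed
  have inj: "inj_on (insert w) ?B"
  proof (rule inj_onI)
    fix I J assume "I \<in> ?B" "J \<in> ?B" and e: "insert w I = insert w J"
    then have "w \<notin> I" "w \<notin> J" using assms by auto
    then show "I = J" using e by (simp add: insert_ident)
  qed
  have "wt l (insert w U) F (insert w g) = (\<Sum>I\<in>?B. l ^ card (insert w I))"
    unfolding wt_def eq by (subst sum.reindex[OF inj]) simp
  also have "\<dots> = (\<Sum>I\<in>?B. l * l ^ card I)"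
  proof (rule sum.cong[OF refl])
    fix I assume "I \<in> ?B"
    then have "finite I" "w \<notin> I" using assms finite_subset by auto
    then show "l ^ card (insert w I) = l * l ^ card I" by simp
  qed
  finally show ?thesis unfolding wt_def by (simp add: sum_distrib_left)
qed

lemma wt_split_vertex:
  assumes "finite U" "w \<notin> U"
  shows "wt l (insert w U) F {} = wt l U F {} + wt l (insert w U) F {w}"
proof -
  have "{I. I \<subseteq> insert w U \<and> avoids F I \<and> {} \<subseteq> I} =
     {I. I \<subseteq> U \<and> avoids F I \<and> {} \<subseteq> I} \<union> {I. I \<subseteq> insert w U \<and> avoids F I \<and> {w} \<subseteq> I}"
    by auto
  then show ?thesis
    unfolding wt_def using assms by (subst sum.union_disjoint[symmetric]) auto
qed

text \<open>A set that is not inside \<open>U\<close> cannot be contained in any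
  \<open>I \<subseteq> U\<close>. This later reduces a link to its members among the undecided
  vertices.\<close>

lemma wt_restrict_forbidden:
  "wt l U (F \<union> L) g = wt l U (F \<union> {x\<in>L. x \<subseteq> U}) g"
proof -
  have "avoids (F \<union> L) I \<longleftrightarrow> avoids (F \<union> {x\<in>L. x \<subseteq> U}) I" if "I \<subseteq> U" for I
  proof -
    have "f \<subseteq> U" if "f \<subseteq> I" for f using that \<open>I \<subseteq> U\<close> by simp
    then show ?thesis unfolding avoids_def by blast
  qed
  then have "{I. I \<subseteq> U \<and> avoids (F \<union> L) I \<and> g \<subseteq> I} =
      {I. I \<subseteq> U \<and> avoids (F \<union> {x\<in>L. x \<subseteq> U}) I \<and> g \<subseteq> I}" by auto
  then show ?thesis unfolding wt_def by simp
qed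

lemma link_empty_iff: "{} \<in> link w F \<longleftrightarrow> {w} \<in> F"
proof
  assume "{} \<in> link w F"
  then obtain f where "f \<in> F" "w \<in> f" "f - {w} = {}" by (auto simp: link_def)
  then have "f = {w}" by auto
  then show "{w} \<in> F" using \<open>f \<in> F\<close> by simp
qed (auto simp: link_def)

lemma open_ratio_nonneg: "l \<ge> 0 \<Longrightarrow> open_ratio l U F w \<ge> 0"
  unfolding open_ratio_def by (intro divide_nonneg_nonneg wt_nonneg)

lemma open_ratio_le_1:
  assumes "finite U" "l \<ge> 0" "{} \<notin> F"
  shows "open_ratio l U F w \<le> 1"
proof -
  have "wt l (U - {w}) (F \<union> link w F) {} \<le> wt l (U - {w}) F {}"
    using assms by (intro wt_mono) auto
  moreover have "wt l (U - {w}) F {} \<ge> 1" using assms by (intro wt_ge_1) auto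
  ultimately show ?thesis unfolding open_ratio_def by (simp add: divide_simps)
qed

lemma open_ratio_mult:
  assumes "finite U" "l \<ge> 0" "{} \<notin> F"
  shows "wt l (U - {w}) (F \<union> link w F) {} = open_ratio l U F w * wt l (U - {w}) F {}"
proof -
  have "wt l (U - {w}) F {} \<ge> 1" using assms by (intro wt_ge_1) auto
  then show ?thesis unfolding open_ratio_def by simp
qed

text \<open>Configurations with \<open>w\<close> occupied and with \<open>w\<close> vacant have
  weights in proportion \<open>l * r\<close> to 1, where \<open>r\<close> is the open ratio; hence
  \<open>w\<close> is occupied with probability \<open>l * r / (1 + l * r)\<close>.\<close>

lemma wt_vertex:
  assumes "finite U" "l \<ge> 0" "{} \<notin> F" "w \<in> U"
  shows "wt l U F {w} = l * open_ratio l U F w * wt l (U - {w}) F {}"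
    and "wt l U F {} = (1 + l * open_ratio l U F w) * wt l (U - {w}) F {}"
proof -
  show 1: "wt l U F {w} = l * open_ratio l U F w * wt l (U - {w}) F {}"
    using wt_insert_vertex[of "U - {w}" w "{}" l F] open_ratio_mult[of U l F w] assms
    by (simp add: insert_absorb)
  show "wt l U F {} = (1 + l * open_ratio l U F w) * wt l (U - {w}) F {}"
    using wt_split_vertex[of "U - {w}" w l F] 1 assms by (simp add: insert_absorb algebra_simps)
qed

section \<open>The tree recursion on a sparse hypergraph\<close>

text \<open>The twin condition does not follow from the codegree bounds: two vertices may have
  identical links although all codegrees are small.\<close>

locale sparse_hypergraph =
  fixes V :: "'b set" and H :: "'b set set" and k :: nat and q d :: real
  assumes finite_V: "finite V"
    and k_ge_3: "3 \<le> k"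
    and edge_subset: "f \<in> H \<Longrightarrow> f \<subseteq> V"
    and edge_card: "f \<in> H \<Longrightarrow> card f = k"
    and q_pos: "0 < q" and q_le_1: "q \<le> 1"
    and d_nonneg: "0 \<le> d" and d_le_1: "d \<le> 1"
    and degree: "w \<in> V \<Longrightarrow> real (card {f\<in>H. w \<in> f}) * q ^ (k - 1) = 1"
    and codegree: "S \<subseteq> V \<Longrightarrow> 2 \<le> card S \<Longrightarrow> card S < k \<Longrightarrow>
          real (card {f\<in>H. S \<subseteq> f}) * q ^ (k - card S) \<le> d"
    and twins: "w \<in> V \<Longrightarrow> w' \<in> V \<Longrightarrow> w \<noteq> w' \<Longrightarrow>
          real (card {f\<in>H. w \<in> f \<and> w' \<notin> f \<and> insert w' (f - {w}) \<in> H}) * q ^ (k - 1) \<le> d"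
begin

text \<open>A state records a partially revealed configuration: the vertices of \<open>W\<close> have been decided,
  and an edge of \<open>H\<close> is shrunk by those of its vertices that were put into the independent set.\<close>

definition state :: "'b set \<Rightarrow> 'b set set \<Rightarrow> bool" where
  "state W F \<longleftrightarrow> W \<subseteq> V \<and> H \<subseteq> F \<and> {} \<notin> F \<and> (\<forall>g\<in>F. \<exists>f\<in>H. g \<subseteq> f \<and> f - W \<subseteq> g)"

text \<open>Uniformity over all states makes the bound reusable after further vertices are decided;
  \<open>T\<close> is the budget that each step of the recursion spends. The condition
  \<open>{w} \<notin> F\<close> excludes vertices that are already blocked: their ratio is 0, which
  would defeat the companion lower bound \<open>open_ge\<close>.\<close>

definition open_le :: "real \<Rightarrow> nat \<Rightarrow> real \<Rightarrow> bool" where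
  "open_le l T b \<longleftrightarrow> (\<forall>W F w. state W F \<longrightarrow> card W \<le> T \<longrightarrow> w \<in> V - W \<longrightarrow> {w} \<notin> F \<longrightarrow>
     open_ratio l (V - W) F w \<le> b)"

definition open_ge :: "real \<Rightarrow> nat \<Rightarrow> real \<Rightarrow> bool" where
  "open_ge l T a \<longleftrightarrow> (\<forall>W F w. state W F \<longrightarrow> card W \<le> T \<longrightarrow> w \<in> V - W \<longrightarrow> {w} \<notin> F \<longrightarrow>
     a \<le> open_ratio l (V - W) F w)"

section \<open>States and the chain rule for occupation probabilities\<close>

lemma finite_H: "finite H"
  by (rule finite_subset[of _ "Pow V"]) (use edge_subset finite_V in auto)

lemma finite_edge: "f \<in> H \<Longrightarrow> finite f"
  by (rule finite_subset[OF edge_subset finite_V])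

lemma state_initial: "state {} H"
  using edge_card[of "{}"] k_ge_3 by (auto simp: state_def)

text \<open>\<open>F'\<close> may lie anywhere between \<open>F\<close> and
  \<open>F \<union> link w F\<close> because the link sets are forbidden one at a time, and each
  intermediate family has to be a state.\<close>

lemma state_insert:
  assumes "state W F" "w \<in> V" "F \<subseteq> F'" "F' \<subseteq> F \<union> link w F" "{} \<notin> F'"
  shows "state (insert w W) F'"
  unfolding state_def
proof (intro conjI ballI)
  fix g assume "g \<in> F'"
  then consider "g \<in> F" | h where "h \<in> F" "g = h - {w}" using assms by (auto simp: link_def)
  then show "\<exists>f\<in>H. g \<subseteq> f \<and> f - insert w W \<subseteq> g"
  proof cases
    case 1
    then obtain f where "f \<in> H" "g \<subseteq> f" "f - W \<subseteq> g" using assms(1) by (auto simp: state_def)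
    then show ?thesis by (intro bexI[of _ f]) auto
  next
    case 2
    then obtain f where "f \<in> H" "h \<subseteq> f" "f - W \<subseteq> h" using assms(1) by (auto simp: state_def)
    then show ?thesis using 2 by (intro bexI[of _ f]) auto
  qed
qed (use assms in \<open>auto simp: state_def\<close>)

lemma finite_state: "state W F \<Longrightarrow> finite W"
  using finite_V finite_subset by (auto simp: state_def)

text \<open>Chain rule: the vertices of \<open>g\<close> are occupied one after another, each
  contributing \<open>l\<close> times an open ratio, and deleting a vertex from the universe only
  lowers the weight. A vertex that has become blocked gives weight 0, so no condition on
  \<open>g\<close> is needed. The last vertex is examined when \<open>card W + card g - 1\<close>
  vertices are decided, whence \<open>Suc T\<close>.\<close>

lemma wt_le:
  assumes up: "open_le l T b" and b: "0 \<le> b" and l: "0 \<le> l"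
  shows "finite g \<Longrightarrow> state W F \<Longrightarrow> card W + card g \<le> Suc T \<Longrightarrow> g \<subseteq> V - W \<Longrightarrow>
    wt l (V - W) F g \<le> (l * b) ^ card g * wt l (V - W) F {}"
proof (induction g arbitrary: W F rule: finite_induct)
  case empty
  then show ?case by simp
next
  case (insert u g)
  let ?U = "V - insert u W" and ?F = "F \<union> link u F"
  have finW: "finite W" using insert.prems finite_state by auto
  have u: "u \<in> V - W" "u \<notin> ?U" and U: "V - W = insert u ?U" and U': "?U = (V - W) - {u}"
    using insert.prems by auto
  have ne: "{} \<notin> F" using insert.prems by (auto simp: state_def)
  have split: "wt l (V - W) F (insert u g) = l * wt l ?U ?F g"
    unfolding U using wt_insert_vertex[of ?U u g l F] insert finite_V by auto
  have Z0: "0 \<le> wt l (V - W) F {}" using l by (rule wt_nonneg)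
  show ?case
  proof (cases "{u} \<in> F")
    case True
    then have "wt l ?U ?F g = 0" by (intro wt_empty_forbidden) (simp add: link_empty_iff)
    then show ?thesis using split Z0 l b by simp
  next
    case False
    have st: "state (insert u W) ?F"
      using insert.prems u False ne by (intro state_insert) (auto simp: link_empty_iff)
    have "wt l ?U ?F g \<le> (l * b) ^ card g * wt l ?U ?F {}"
      using insert st finW u by (intro insert.IH) auto
    also have "wt l ?U ?F {} = open_ratio l (V - W) F u * wt l ?U F {}"
      using open_ratio_mult[of "V - W" l F u] finite_V l ne by (simp add: U')
    also have "\<dots> \<le> b * wt l (V - W) F {}"
    proof (intro mult_mono)
      show "open_ratio l (V - W) F u \<le> b"
        using up insert.prems insert.hyps u False unfolding open_le_def by (auto simp: card_insert_if)
      show "wt l ?U F {} \<le> wt l (V - W) F {}" using finite_V l by (intro wt_mono) auto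
    qed (use b l wt_nonneg in auto)
    finally have "wt l ?U ?F g \<le> (l * b) ^ card g * (b * wt l (V - W) F {})"
      using l b by (simp add: mult_left_mono)
    then have "l * wt l ?U ?F g \<le> l * ((l * b) ^ card g * (b * wt l (V - W) F {}))"
      using l by (rule mult_left_mono)
    then show ?thesis using split insert.hyps by (simp add: mult_ac)
  qed
qed

text \<open>The same chain rule from below. Here \<open>avoids F g\<close> is essential: it passes
  on to the shrunken constraints and keeps every vertex of \<open>g\<close> unblocked. Returning
  from the universe without \<open>u\<close> to the one with \<open>u\<close> costs a factor of at
  most \<open>1 + l\<close> per vertex.\<close>

lemma wt_ge:
  assumes lo: "open_ge l T a" and a: "0 \<le> a" and l: "0 \<le> l"
  shows "finite g \<Longrightarrow> state W F \<Longrightarrow> card W + card g \<le> Suc T \<Longrightarrow> g \<subseteq> V - W \<Longrightarrow> avoids F g \<Longrightarrow>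
    (l * a / (1 + l)) ^ card g * wt l (V - W) F {} \<le> wt l (V - W) F g"
proof (induction g arbitrary: W F rule: finite_induct)
  case empty
  then show ?case by simp
next
  case (insert u g)
  let ?U = "V - insert u W" and ?F = "F \<union> link u F" and ?r = "open_ratio l (V - W) F u"
  have finW: "finite W" using insert.prems finite_state by auto
  have u: "u \<in> V - W" "u \<notin> ?U" and U: "V - W = insert u ?U" and U': "?U = (V - W) - {u}"
    using insert.prems by auto
  have ne: "{} \<notin> F" using insert.prems by (auto simp: state_def)
  have nu: "{u} \<notin> F" using insert.prems by (auto simp: avoids_def)
  have av: "avoids ?F g"
    using insert.prems by (auto simp: avoids_def link_def)
  have split: "wt l (V - W) F (insert u g) = l * wt l ?U ?F g"
    unfolding U using wt_insert_vertex[of ?U u g l F] insert finite_V by auto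
  have Z0: "0 \<le> wt l ?U F {}" using l by (rule wt_nonneg)
  have st: "state (insert u W) ?F"
    using insert.prems u nu ne by (intro state_insert) (auto simp: link_empty_iff)
  have "(l * a / (1 + l)) ^ card g * wt l ?U ?F {} \<le> wt l ?U ?F g"
    using insert st finW u av by (intro insert.IH) auto
  moreover have "wt l ?U ?F {} = ?r * wt l ?U F {}"
    using open_ratio_mult[of "V - W" l F u] finite_V l ne by (simp add: U')
  ultimately have 1: "l * ((l * a / (1 + l)) ^ card g * (?r * wt l ?U F {})) \<le> wt l (V - W) F (insert u g)"
    using split l by (simp add: mult_left_mono)
  have r: "a \<le> ?r" "?r \<le> 1"
    using lo insert.prems insert.hyps u nu open_ratio_le_1[of "V - W" l F u] finite_V ne l
    unfolding open_ge_def by (auto simp: card_insert_if)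
  have "wt l (V - W) F {} = (1 + l * ?r) * wt l ?U F {}"
    using wt_vertex(2)[of "V - W" l F u] finite_V l ne u by (simp add: U')
  also have "\<dots> \<le> (1 + l) * wt l ?U F {}"
    using r l Z0 by (intro mult_right_mono) (simp_all add: mult_left_le)
  finally have "a * wt l (V - W) F {} \<le> a * ((1 + l) * wt l ?U F {})"
    using a by (rule mult_left_mono)
  also have "\<dots> \<le> ?r * ((1 + l) * wt l ?U F {})"
    using r l Z0 by (intro mult_right_mono) auto
  finally have "a / (1 + l) * wt l (V - W) F {} \<le> ?r * wt l ?U F {}"
    using l by (simp add: field_simps)
  then have "l * (l * a / (1 + l)) ^ card g * (a / (1 + l) * wt l (V - W) F {})
      \<le> l * (l * a / (1 + l)) ^ card g * (?r * wt l ?U F {})"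
    using l a by (intro mult_left_mono) auto
  then show ?case using 1 insert.hyps by (simp add: mult_ac)
qed

text \<open>These are the edges at \<open>w\<close> along which the depth-one exploration of the neighbourhood could
  close a cycle through \<open>W\<close>.\<close>

lemma card_bad_edges:
  assumes W: "W \<subseteq> V" "card W \<le> T" and w: "w \<in> V - W"
  shows "real (card {f\<in>H. w \<in> f \<and> (f \<inter> W \<noteq> {} \<or> (\<exists>f'\<in>H. f' \<subseteq> W \<union> (f - {w}) \<and> f' \<inter> (f - {w}) \<noteq> {}))})
    * q ^ (k - 1) \<le> 3 * 2 ^ T * d" (is "real (card ?Bad) * _ \<le> _")
proof -
  have finW: "finite W" using W finite_V finite_subset by auto
  \<comment> \<open>Suppose \<open>f\<close> misses \<open>W\<close> but some edge \<open>f'\<close>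
    lies in \<open>W \<union> (f - {w})\<close>, and let \<open>S\<close> be the trace of
    \<open>f'\<close> on \<open>W\<close>. An empty trace is impossible by size; a trace
    \<open>{u}\<close> forces \<open>f' = insert u (f - {w})\<close>, a twin pair counted by
    \<open>B u\<close>; larger traces are counted by \<open>C S\<close>. The edges meeting
    \<open>W\<close> go to \<open>A u\<close>.\<close>
  define A where "A u = {f\<in>H. {u, w} \<subseteq> f}" for u
  define B where "B u = {f\<in>H. w \<in> f \<and> u \<notin> f \<and> insert u (f - {w}) \<in> H}" for u
  define I where "I = {S. S \<subseteq> W \<and> 2 \<le> card S \<and> card S < k}"
  define C where "C S = (\<Union>f'\<in>{f'\<in>H. S \<subseteq> f'}. {f\<in>H. insert w (f' - S) \<subseteq> f \<and> f' \<inter> W = S \<and> w \<notin> f'})" for S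
  have finI: "finite I" using finW by (simp add: I_def)
  have sub: "?Bad \<subseteq> (\<Union>u\<in>W. A u) \<union> (\<Union>u\<in>W. B u) \<union> (\<Union>S\<in>I. C S)"
  proof
    fix f assume f: "f \<in> ?Bad"
    show "f \<in> (\<Union>u\<in>W. A u) \<union> (\<Union>u\<in>W. B u) \<union> (\<Union>S\<in>I. C S)"
    proof (cases "f \<inter> W = {}")
      case False
      then show ?thesis using f by (auto simp: A_def)
    next
      case True
      then obtain f' where f': "f' \<in> H" "f' \<subseteq> W \<union> (f - {w})" "f' \<inter> (f - {w}) \<noteq> {}"
        using f by auto
      have fin: "finite f" "finite f'" using f f' finite_edge by auto
      define S where "S = f' \<inter> W"
      have wf': "w \<notin> f'" using f' w by auto
      have diff: "f' - S \<subseteq> f - {w}" using f' by (auto simp: S_def)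
      have cf: "card f = k" "card f' = k" using f f' edge_card by auto
      have cd: "card (f' - S) = k - card S"
        using cf fin by (simp add: card_Diff_subset S_def)
      have "card S < k" 
      proof -
        have "S \<subset> f'" using f' True by (auto simp: S_def)
        then show ?thesis using fin cf psubset_card_mono by metis
      qed
      moreover have "card S \<noteq> 0"
      proof
        assume "card S = 0"
        then have "f' \<subseteq> f - {w}" using diff fin by (auto simp: S_def)
        then have "card f' \<le> card (f - {w})" using fin by (intro card_mono) auto
        then show False using cf fin f k_ge_3 by simp
      qed
      ultimately consider "card S = 1" | "2 \<le> card S" "card S < k" by linarith
      then show ?thesis
      proof cases
        case 1
        then obtain u where u: "S = {u}" by (auto simp: card_1_singleton_iff)
        have "f' - S = f - {w}"
        proof (rule card_subset_eq)
          show "card (f' - S) = card (f - {w})" using cd 1 cf f fin by simp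
        qed (use fin diff in auto)
        then have "insert u (f - {w}) = f'" using u by (auto simp: S_def)
        moreover have "u \<in> W" "u \<notin> f" using u True by (auto simp: S_def)
        ultimately show ?thesis using f f' by (auto simp: B_def)
      next
        case 2
        have "f \<in> C S" using f f' diff wf' by (auto simp: C_def S_def)
        then show ?thesis using 2 by (auto simp: I_def S_def)
      qed
    qed
  qed
  have q1: "q ^ j > 0" "q ^ j \<le> 1" for j using q_pos q_le_1 by (auto simp: power_le_one)
  have cA: "real (card (A u)) * q ^ (k - 1) \<le> d" if "u \<in> W" for u
  proof -
    have "u \<noteq> w" using that w by auto
    then have "real (card (A u)) * q ^ (k - 2) \<le> d"
      using codegree[of "{u, w}"] that W w k_ge_3 by (auto simp: A_def numeral_2_eq_2)
    moreover have "q ^ (k - 1) \<le> q ^ (k - 2)"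
      using q_pos q_le_1 by (intro power_decreasing) auto
    ultimately show ?thesis by (meson mult_left_mono of_nat_0_le_iff order_trans)
  qed
  have cB: "real (card (B u)) * q ^ (k - 1) \<le> d" if "u \<in> W" for u
    unfolding B_def using that w W by (intro twins) auto
  have cC: "real (card (C S)) * q ^ (k - 1) \<le> d" if S: "S \<in> I" for S
  proof -
    have SV: "S \<subseteq> V" and cS: "2 \<le> card S" "card S < k" using S W by (auto simp: I_def)
    have finS: "finite S" using SV finite_V finite_subset by auto
    let ?X = "{f'\<in>H. S \<subseteq> f'}"
    let ?Y = "\<lambda>f'. {f\<in>H. insert w (f' - S) \<subseteq> f \<and> f' \<inter> W = S \<and> w \<notin> f'}"
    have Y: "real (card (?Y f')) * q ^ (card S - 1) \<le> d" if "f' \<in> ?X" for f'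
    proof (cases "f' \<inter> W = S \<and> w \<notin> f'")
      case True
      have ff: "f' \<subseteq> V" "finite f'" "card f' = k"
        using that edge_subset edge_card finite_edge by auto
      have c: "card (insert w (f' - S)) = Suc (k - card S)"
        using that True ff finS by (simp add: card_Diff_subset)
      have "real (card {f\<in>H. insert w (f' - S) \<subseteq> f}) * q ^ (k - card (insert w (f' - S))) \<le> d"
      proof (rule codegree)
        show "2 \<le> card (insert w (f' - S))" "card (insert w (f' - S)) < k"
          unfolding c using cS by linarith+
      qed (use ff w in auto)
      moreover have "k - Suc (k - card S) = card S - 1" using cS by simp
      ultimately show ?thesis using True c by simp
    next
      case False
      then have "?Y f' = {}" by auto
      then show ?thesis using d_nonneg by (simp only: card.empty)
    qed
    \<comment> \<open>First \<open>f'\<close> is chosen above \<open>S\<close>, then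
      \<open>f\<close> above \<open>insert w (f' - S)\<close>. The exponents
      \<open>k - card S\<close> and \<open>card S - 1\<close> of the two codegree bounds add up to
      \<open>k - 1\<close>.\<close>
    have "real (card (C S)) \<le> (\<Sum>f'\<in>?X. real (card (?Y f')))"
      unfolding C_def of_nat_sum[symmetric] of_nat_le_iff
      using finite_H by (intro card_UN_le) auto
    then have "real (card (C S)) * q ^ (card S - 1) \<le> (\<Sum>f'\<in>?X. real (card (?Y f'))) * q ^ (card S - 1)"
      using q1 by (intro mult_right_mono) (auto simp: less_imp_le)
    also have "\<dots> = (\<Sum>f'\<in>?X. real (card (?Y f')) * q ^ (card S - 1))"
      by (rule sum_distrib_right)
    also have "\<dots> \<le> (\<Sum>f'\<in>?X. d)" by (intro sum_mono Y)
    finally have "real (card (C S)) * q ^ (card S - 1) \<le> real (card ?X) * d" by simp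
    then have "real (card (C S)) * q ^ (card S - 1) * q ^ (k - card S) \<le> real (card ?X) * d * q ^ (k - card S)"
      using q1 by (intro mult_right_mono) (auto simp: less_imp_le)
    also have "\<dots> = real (card ?X) * q ^ (k - card S) * d" by simp
    also have "\<dots> \<le> d * d" using codegree[OF SV cS] d_nonneg by (intro mult_right_mono)
    also have "\<dots> \<le> d" using d_nonneg d_le_1 by (simp add: mult_left_le)
    finally show ?thesis using cS by (simp add: mult.assoc power_add[symmetric])
  qed
  have "card ?Bad \<le> card ((\<Union>u\<in>W. A u) \<union> (\<Union>u\<in>W. B u) \<union> (\<Union>S\<in>I. C S))"
    using finite_H by (intro card_mono sub) (auto intro!: finite_subset[OF _ finite_H] simp: A_def B_def C_def)
  also have "\<dots> \<le> card (\<Union>u\<in>W. A u) + card (\<Union>u\<in>W. B u) + card (\<Union>S\<in>I. C S)"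
    by (meson add_mono card_Un_le le_refl order_trans)
  also have "\<dots> \<le> (\<Sum>u\<in>W. card (A u)) + (\<Sum>u\<in>W. card (B u)) + (\<Sum>S\<in>I. card (C S))"
    using finW finI by (intro add_mono card_UN_le)
  finally have "real (card ?Bad) \<le> (\<Sum>u\<in>W. real (card (A u))) + (\<Sum>u\<in>W. real (card (B u))) + (\<Sum>S\<in>I. real (card (C S)))"
    unfolding of_nat_sum[symmetric] of_nat_add[symmetric] of_nat_le_iff .
  then have "real (card ?Bad) * q ^ (k - 1) \<le> ((\<Sum>u\<in>W. real (card (A u))) + (\<Sum>u\<in>W. real (card (B u))) + (\<Sum>S\<in>I. real (card (C S)))) * q ^ (k - 1)"
    using q1 by (intro mult_right_mono) (auto simp: less_imp_le)
  also have "\<dots> = (\<Sum>u\<in>W. real (card (A u)) * q ^ (k - 1)) + (\<Sum>u\<in>W. real (card (B u)) * q ^ (k - 1)) + (\<Sum>S\<in>I. real (card (C S)) * q ^ (k - 1))"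
    by (simp add: distrib_right sum_distrib_right)
  also have "\<dots> \<le> (\<Sum>u\<in>W. d) + (\<Sum>u\<in>W. d) + (\<Sum>S\<in>I. d)"
    by (intro add_mono sum_mono cA cB cC)
  also have "\<dots> = (2 * real (card W) + real (card I)) * d" by (simp add: algebra_simps)
  \<comment> \<open>Both \<open>card W\<close> and the number of possible traces \<open>S\<close>
    are at most \<open>2 ^ T\<close>.\<close>
  also have "\<dots> \<le> 3 * 2 ^ T * d"
  proof (rule mult_right_mono[OF _ d_nonneg])
    have "card I \<le> card (Pow W)" using finW by (intro card_mono) (auto simp: I_def)
    also have "\<dots> = 2 ^ card W" using finW by (simp add: card_Pow)
    also have "\<dots> \<le> 2 ^ T" using W by simp
    finally have "real (card I) \<le> 2 ^ T" by (metis of_nat_le_iff of_nat_numeral of_nat_power)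
    moreover have "card W \<le> 2 ^ T" using W less_exp[of T] by linarith
    then have "real (card W) \<le> 2 ^ T" by (metis of_nat_le_iff of_nat_numeral of_nat_power)
    ultimately show "2 * real (card W) + real (card I) \<le> 3 * 2 ^ T" by linarith
  qed
  finally show ?thesis .
qed

text \<open>Dropping the bad link sets only raises the ratio. Each remaining one, forbidden in turn,
  multiplies the weight by 1 minus its occupation probability, hence by at most
  \<open>exp (- al)\<close> by \<open>wt_ge\<close>. By regularity and \<open>card_bad_edges\<close>
  the good sets number at least \<open>(1 - 3 * 2 ^ T * d) / q ^ (k - 1)\<close>. Examining a link
  set decides \<open>w\<close> and then its \<open>k - 1\<close> vertices, which the budget
  \<open>T + k\<close> covers.\<close>

lemma open_le_step:
  assumes lo: "open_ge l (T + k) a" and a: "0 \<le> a" and c: "0 \<le> c" and l: "l = c * q"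
  shows "open_le l T (exp (- ((1 - 3 * 2 ^ T * d) * (c * a / (1 + c * q)) ^ (k - 1))))"
  unfolding open_le_def
proof (intro allI impI)
  fix W F w assume st: "state W F" and cW: "card W \<le> T" and w: "w \<in> V - W" and nw: "{w} \<notin> F"
  have finW: "finite W" and WV: "W \<subseteq> V" using st finite_state by (auto simp: state_def)
  have HF: "H \<subseteq> F" and ne: "{} \<notin> F" using st by (auto simp: state_def)
  have l0: "0 \<le> l" using l c q_pos by simp
  let ?W = "insert w W"
  let ?U = "V - ?W"
  define bad where "bad f \<longleftrightarrow> f \<inter> W \<noteq> {} \<or> (\<exists>f'\<in>H. f' \<subseteq> W \<union> (f - {w}) \<and> f' \<inter> (f - {w}) \<noteq> {})" for f
  define Good where "Good = (\<lambda>f. f - {w}) ` {f\<in>H. w \<in> f \<and> \<not> bad f}"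
  define al where "al = (l * a / (1 + l)) ^ (k - 1)"
  have U': "?U = (V - W) - {w}" by auto
  have injw: "inj_on (\<lambda>f. f - {w}) {f\<in>H. w \<in> f \<and> \<not> bad f}"
    by (rule inj_onI) (metis (no_types, lifting) insert_Diff mem_Collect_eq)
  have finG: "finite Good" using finite_H by (simp add: Good_def)
  have Gsub: "Good \<subseteq> link w F" using HF by (auto simp: Good_def link_def)
  have cG: "card g = k - 1" "g \<subseteq> ?U" if "g \<in> Good" for g
    using that edge_card edge_subset finite_edge by (auto simp: Good_def bad_def)
  have k2: "k - 1 \<ge> 2" using k_ge_3 by simp
  have neG: "{} \<notin> Good" using cG(1)[of "{}"] k2 by auto
  \<comment> \<open>The precondition of \<open>wt_ge\<close>. A set \<open>h \<in> F\<close> inside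
    \<open>g\<close> comes from an edge \<open>f'\<close> with \<open>f' - W \<subseteq> h\<close>,
    so \<open>f'\<close> lies in \<open>W \<union> g\<close> and meets \<open>g\<close>, which makes
    \<open>f\<close> bad. Another good set cannot lie inside \<open>g\<close>, since all good sets
    have size \<open>k - 1\<close>.\<close>
  have avG: "avoids (F \<union> G) g" if g: "g \<in> Good" and G: "G \<subseteq> Good" "g \<notin> G" for G g
    unfolding avoids_def
  proof (intro ballI notI)
    fix h assume h: "h \<in> F \<union> G" and hg: "h \<subseteq> g"
    obtain f where f: "f \<in> H" "w \<in> f" "\<not> bad f" "g = f - {w}" using g by (auto simp: Good_def)
    show False
    proof (cases "h \<in> G")
      case True
      then have "card h = card g" using G cG g by auto
      moreover have "finite g" using f finite_edge by auto
      ultimately have "h = g" using hg card_subset_eq by blast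
      then show False using True G by simp
    next
      case False
      then have hF: "h \<in> F" using h by auto
      then obtain f' where f': "f' \<in> H" "h \<subseteq> f'" "f' - W \<subseteq> h" using st by (auto simp: state_def)
      have "h \<noteq> {}" using hF ne by auto
      then have "f' \<inter> (f - {w}) \<noteq> {}" using hg f f' by auto
      moreover have "f' \<subseteq> W \<union> (f - {w})" using hg f f' by auto
      ultimately show False using f f' by (auto simp: bad_def)
    qed
  qed
  have al1: "0 \<le> al" using l0 a by (simp add: al_def)
  have Zpos: "wt l ?U F {} \<ge> 1" using finite_V l0 ne by (intro wt_ge_1) auto
  have prod: "wt l ?U (F \<union> G) {} \<le> exp (- al) ^ card G * wt l ?U F {}" if "finite G" "G \<subseteq> Good" for G
    using that
  proof (induction G rule: finite_induct)
    case empty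
    then show ?case by simp
  next
    case (insert g G)
    have g: "g \<in> Good" using insert by auto
    have stG: "state ?W (F \<union> G)"
      using st w insert Gsub neG ne by (intro state_insert[OF st]) auto
    have "finite g" using g finite_edge by (auto simp: Good_def)
    then have "(l * a / (1 + l)) ^ card g * wt l ?U (F \<union> G) {} \<le> wt l ?U (F \<union> G) g"
    proof (rule wt_ge[OF lo a l0 _ stG])
      show "card ?W + card g \<le> Suc (T + k)" using cG[OF g] cW finW w by simp
    qed (use cG[OF g] avG[OF g] insert in auto)
    then have "al * wt l ?U (F \<union> G) {} \<le> wt l ?U (F \<union> G) g" using cG[OF g] by (simp add: al_def)
    then have "wt l ?U (F \<union> insert g G) {} \<le> (1 - al) * wt l ?U (F \<union> G) {}"
      using wt_insert_forbidden[of ?U l g "F \<union> G"] finite_V by (simp add: algebra_simps)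
    also have "\<dots> \<le> exp (- al) * wt l ?U (F \<union> G) {}"
      using exp_ge_add_one_self[of "- al"] l0 by (intro mult_right_mono wt_nonneg) auto
    also have "\<dots> \<le> exp (- al) * (exp (- al) ^ card G * wt l ?U F {})"
      using insert by (intro mult_left_mono) auto
    finally show ?case using insert by (simp add: mult_ac)
  qed
  have "wt l ?U (F \<union> link w F) {} \<le> wt l ?U (F \<union> Good) {}"
    using finite_V l0 Gsub by (intro wt_mono) auto
  also have "\<dots> \<le> exp (- al) ^ card Good * wt l ?U F {}" using prod[OF finG] by simp
  finally have 1: "open_ratio l (V - W) F w \<le> exp (- al) ^ card Good"
    unfolding open_ratio_def U'[symmetric] using Zpos by (simp add: divide_simps)
  have "card {f\<in>H. w \<in> f} = card {f\<in>H. w \<in> f \<and> bad f} + card {f\<in>H. w \<in> f \<and> \<not> bad f}"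
    using finite_H by (subst card_Un_disjoint[symmetric]) (auto intro!: arg_cong[where f = card])
  also have "card {f\<in>H. w \<in> f \<and> \<not> bad f} = card Good"
    unfolding Good_def by (rule card_image[OF injw, symmetric])
  finally have "1 = real (card {f\<in>H. w \<in> f \<and> bad f}) * q ^ (k - 1) + real (card Good) * q ^ (k - 1)"
    using degree[of w] w by (simp add: distrib_right)
  moreover have "real (card {f\<in>H. w \<in> f \<and> bad f}) * q ^ (k - 1) \<le> 3 * 2 ^ T * d"
    using card_bad_edges[OF WV cW w] by (simp add: bad_def)
  ultimately have "1 - 3 * 2 ^ T * d \<le> real (card Good) * q ^ (k - 1)" by linarith
  then have "(1 - 3 * 2 ^ T * d) * (c * a / (1 + c * q)) ^ (k - 1)
      \<le> real (card Good) * q ^ (k - 1) * (c * a / (1 + c * q)) ^ (k - 1)"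
    using a c q_pos by (intro mult_right_mono) auto
  also have "\<dots> = real (card Good) * al"
    unfolding al_def l by (simp add: power_mult_distrib power_divide)
  finally have "exp (- (real (card Good) * al)) \<le> exp (- ((1 - 3 * 2 ^ T * d) * (c * a / (1 + c * q)) ^ (k - 1)))"
    by simp
  moreover have "exp (- al) ^ card Good = exp (- (real (card Good) * al))"
    by (simp add: exp_of_nat_mult[symmetric])
  ultimately show "open_ratio l (V - W) F w \<le> exp (- ((1 - 3 * 2 ^ T * d) * (c * a / (1 + c * q)) ^ (k - 1)))"
    using 1 by linarith
qed

text \<open>Now every link set counts, and \<open>wt_le\<close> bounds the occupation probability of
  each by \<open>be g\<close>. As \<open>be g \<le> l \<le> 1/2\<close>, the estimate
  \<open>ln (1 - t) \<ge> - t - 2 * t^2\<close> turns the factors \<open>1 - be g\<close> into an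
  exponential, with the squares absorbed in \<open>1 + 2 * l\<close>. The sum of \<open>be g\<close>
  is the degree term \<open>(c * b) ^ (k - 1)\<close> plus a codegree error from edges already
  shrunk by \<open>W\<close>.\<close>

lemma open_ge_step:
  assumes up: "open_le l (T + k) b" and b: "0 \<le> b" "b \<le> 1" and c: "0 \<le> c" and l: "l = c * q" "l \<le> 1 / 2"
  shows "open_ge l T (exp (- ((1 + 2 * (c * q)) * ((c * b) ^ (k - 1) + 2 ^ T * (1 + c) ^ k * d))))"
  unfolding open_ge_def
proof (intro allI impI)
  fix W F w assume st: "state W F" and cW: "card W \<le> T" and w: "w \<in> V - W" and nw: "{w} \<notin> F"
  have finW: "finite W" and WV: "W \<subseteq> V" using st finite_state by (auto simp: state_def)
  have HF: "H \<subseteq> F" and ne: "{} \<notin> F" using st by (auto simp: state_def)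
  have l0: "0 \<le> l" using l c q_pos by simp
  let ?W = "insert w W"
  let ?U = "V - ?W"
  have U': "?U = (V - W) - {w}" by auto
  define L where "L = {g\<in>link w F. g \<subseteq> ?U}"
  define X where "X = {f\<in>H. w \<in> f \<and> \<not> f \<subseteq> ?W}"
  have finX: "finite X" using finite_H by (simp add: X_def)
  have neL: "{} \<notin> L" using nw by (simp add: L_def link_empty_iff)
  \<comment> \<open>A link set among the undecided vertices is all that an original edge retains
    outside \<open>insert w W\<close>. It is nonempty because \<open>{w} \<notin> F\<close>, so
    edges lying inside \<open>insert w W\<close> can be left out of \<open>X\<close>.\<close>
  have Lsub: "L \<subseteq> (\<lambda>f. f - ?W) ` X"
  proof
    fix g assume g: "g \<in> L"
    then obtain h where h: "h \<in> F" "w \<in> h" "g = h - {w}" "g \<subseteq> ?U" by (auto simp: L_def link_def)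
    then obtain f where f: "f \<in> H" "h \<subseteq> f" "f - W \<subseteq> h" using st by (auto simp: state_def)
    have "g = f - ?W" using h f by auto
    moreover have "g \<noteq> {}" using g neL by auto
    ultimately show "g \<in> (\<lambda>f. f - ?W) ` X" using f h by (auto simp: X_def)
  qed
  have finL: "finite L" using finX Lsub finite_surj by auto
  have cg: "card g \<ge> 1" "card g \<le> k" "finite g" "g \<subseteq> ?U" if "g \<in> L" for g
  proof -
    show fg: "finite g" "g \<subseteq> ?U" using that finite_V finite_subset by (auto simp: L_def)
    have "g \<noteq> {}" using that neL by auto
    then show "card g \<ge> 1" using fg by (simp add: Suc_leI card_gt_0_iff)
    have "g \<in> (\<lambda>f. f - ?W) ` X" using that Lsub by auto
    then obtain f where "f \<in> H" "g \<subseteq> f" by (auto simp: X_def)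
    then show "card g \<le> k" using card_mono[OF finite_edge] edge_card by metis
  qed
  define be where "be g = (l * b) ^ card g" for g :: "'b set"
  have be: "0 \<le> be g" "be g \<le> l" "be g \<le> 1 / 2" if "g \<in> L" for g
  proof -
    show "0 \<le> be g" using l0 b by (simp add: be_def)
    have lb: "0 \<le> l * b" "l * b \<le> l" using l0 b by (auto simp: mult_left_le)
    have "be g \<le> (l * b) ^ 1"
      unfolding be_def using cg(1)[OF that] lb l by (intro power_decreasing) auto
    then show "be g \<le> l" using lb by simp
    then show "be g \<le> 1 / 2" using l by simp
  qed
  have Zpos: "wt l ?U F {} \<ge> 1" using finite_V l0 ne by (intro wt_ge_1) auto
  have prod: "exp (- ((1 + 2 * l) * sum be G)) * wt l ?U F {} \<le> wt l ?U (F \<union> G) {}" if "finite G" "G \<subseteq> L" for G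
    using that
  proof (induction G rule: finite_induct)
    case empty
    then show ?case by simp
  next
    case (insert g G)
    have g: "g \<in> L" using insert by auto
    have stG: "state ?W (F \<union> G)"
      using st w insert neL ne by (intro state_insert[OF st]) (auto simp: L_def)
    have "wt l ?U (F \<union> G) g \<le> (l * b) ^ card g * wt l ?U (F \<union> G) {}"
    proof (rule wt_le[OF up b(1) l0 _ stG])
      show "card ?W + card g \<le> Suc (T + k)" using cg[OF g] cW finW w by simp
    qed (use cg[OF g] in auto)
    then have 2: "(1 - be g) * wt l ?U (F \<union> G) {} \<le> wt l ?U (F \<union> insert g G) {}"
      using wt_insert_forbidden[of ?U l g "F \<union> G"] finite_V by (simp add: algebra_simps be_def)
    have "- be g - 2 * (be g)\<^sup>2 \<le> ln (1 - be g)"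
      using be[OF g] by (intro ln_one_minus_pos_lower_bound) auto
    moreover have "(be g)\<^sup>2 \<le> l * be g"
      using be[OF g] by (simp add: power2_eq_square mult_right_mono)
    ultimately have "- ((1 + 2 * l) * be g) \<le> ln (1 - be g)" by (simp add: algebra_simps)
    then have "exp (- ((1 + 2 * l) * be g)) \<le> exp (ln (1 - be g))" by simp
    then have "exp (- ((1 + 2 * l) * be g)) \<le> 1 - be g" using be[OF g] by simp
    then have 3: "exp (- ((1 + 2 * l) * be g)) * wt l ?U (F \<union> G) {} \<le> wt l ?U (F \<union> insert g G) {}"
      using 2 l0 wt_nonneg[of l ?U "F \<union> G" "{}"] by (meson mult_right_mono order_trans)
    have "exp (- ((1 + 2 * l) * be g)) * (exp (- ((1 + 2 * l) * sum be G)) * wt l ?U F {})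
        \<le> exp (- ((1 + 2 * l) * be g)) * wt l ?U (F \<union> G) {}"
      using insert by (intro mult_left_mono) auto
    from order_trans[OF this 3]
    have "exp (- ((1 + 2 * l) * be g)) * (exp (- ((1 + 2 * l) * sum be G)) * wt l ?U F {})
        \<le> wt l ?U (F \<union> insert g G) {}" .
    moreover have "exp (- ((1 + 2 * l) * sum be (insert g G))) = exp (- ((1 + 2 * l) * be g)) * exp (- ((1 + 2 * l) * sum be G))"
      using insert by (simp add: exp_add[symmetric] algebra_simps)
    ultimately show ?case by (simp only: mult.assoc)
  qed
  have "wt l ?U (F \<union> link w F) {} = wt l ?U (F \<union> L) {}"
    unfolding L_def by (rule wt_restrict_forbidden)
  then have 1: "exp (- ((1 + 2 * l) * sum be L)) \<le> open_ratio l (V - W) F w"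
    unfolding open_ratio_def U'[symmetric] using Zpos prod[OF finL] by (simp add: divide_simps)
  have beX: "be (f - ?W) = (l * b) ^ (k - 1 - card (f \<inter> W))" if "f \<in> X" for f
  proof -
    have f: "f \<in> H" "w \<in> f" "finite f" using that finite_edge by (auto simp: X_def)
    have "f \<inter> ?W = insert w (f \<inter> W)" using f by auto
    then have "card (f - ?W) = k - Suc (card (f \<inter> W))"
      using f w edge_card by (simp add: card_Diff_subset_Int)
    then show ?thesis by (simp add: be_def)
  qed
  have be0: "0 \<le> be g" for g using l0 b by (simp add: be_def)
  \<comment> \<open>Edges are grouped by their trace \<open>S\<close> on \<open>W\<close>. For
    \<open>S = {}\<close> the degree condition gives the main term. A nonempty trace is handled by
    the codegree of \<open>insert w S\<close>, whose exponent \<open>k - 1 - card S\<close> is the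
    number of vertices left. If \<open>insert w S\<close> has \<open>k\<close> or more elements, no
    edge of \<open>X\<close> has this trace.\<close>
  have part: "(\<Sum>f\<in>{f\<in>X. f \<inter> W = S}. be (f - ?W)) \<le> (if S = {} then (c * b) ^ (k - 1) else (1 + c) ^ k * d)"
    if S: "S \<subseteq> W" for S
  proof -
    let ?n = "real (card {f\<in>X. f \<inter> W = S})"
    have eq: "(\<Sum>f\<in>{f\<in>X. f \<inter> W = S}. be (f - ?W)) = ?n * (l * b) ^ (k - 1 - card S)"
      using beX by simp
    show ?thesis
    proof (cases "S = {}")
      case True
      have "?n \<le> real (card {f\<in>H. w \<in> f})"
        using finite_H by (intro of_nat_mono card_mono) (auto simp: X_def)
      then have "?n * (l * b) ^ (k - 1) \<le> real (card {f\<in>H. w \<in> f}) * (l * b) ^ (k - 1)"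
        using l0 b by (intro mult_right_mono) auto
      also have "\<dots> = (real (card {f\<in>H. w \<in> f}) * q ^ (k - 1)) * (c * b) ^ (k - 1)"
        by (simp add: l power_mult_distrib)
      also have "\<dots> = (c * b) ^ (k - 1)" using degree[of w] w by simp
      finally show ?thesis using eq True by simp
    next
      case False
      have finS: "finite S" using S finW finite_subset by auto
      have "w \<notin> S" using S w by auto
      then have cS: "card (insert w S) = Suc (card S)" "card S \<ge> 1"
        using finS False by (simp_all add: Suc_leI card_gt_0_iff)
      show ?thesis
      proof (cases "Suc (card S) < k")
        case True
        define j where "j = k - 1 - card S"
        have j: "k - Suc (card S) = j" by (simp add: j_def)
        have "?n \<le> real (card {f\<in>H. insert w S \<subseteq> f})"
          using finite_H by (intro of_nat_mono card_mono) (auto simp: X_def)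
        then have "?n * q ^ j \<le> real (card {f\<in>H. insert w S \<subseteq> f}) * q ^ j"
          using q_pos by (intro mult_right_mono) auto
        also have "\<dots> \<le> d" using codegree[of "insert w S"] cS True w WV S j by auto
        finally have n: "?n * q ^ j \<le> d" .
        have "?n * (l * b) ^ j = (?n * q ^ j) * (c * b) ^ j"
          by (simp add: l power_mult_distrib)
        also have "\<dots> \<le> d * (1 + c) ^ k"
        proof (intro mult_mono n)
          have "c * b \<le> 1 + c" using mult_left_le[of b c] b c by linarith
          then have "(c * b) ^ j \<le> (1 + c) ^ j" using c b by (intro power_mono) auto
          also have "\<dots> \<le> (1 + c) ^ k" using c by (intro power_increasing) (auto simp: j_def)
          finally show "(c * b) ^ j \<le> (1 + c) ^ k" .
        qed (use d_nonneg c b in auto)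
        finally show ?thesis using eq False by (simp add: j_def mult.commute)
      next
        case False
        have "{f\<in>X. f \<inter> W = S} = {}"
        proof (rule ccontr)
          assume "{f\<in>X. f \<inter> W = S} \<noteq> {}"
          then obtain f where f: "f \<in> H" "w \<in> f" "\<not> f \<subseteq> ?W" "f \<inter> W = S" by (auto simp: X_def)
          then have "insert w S \<subset> f" by auto
          then have "card (insert w S) < card f" using f finite_edge psubset_card_mono by blast
          then show False using cS False f edge_card by simp
        qed
        then have "(\<Sum>f\<in>{f\<in>X. f \<inter> W = S}. be (f - ?W)) = 0" by (simp only: sum.empty)
        then show ?thesis using \<open>S \<noteq> {}\<close> d_nonneg c by simp
      qed
    qed
  qed
  \<comment> \<open>Several edges may leave the same link set; counting edges instead of sets only
    enlarges the sum.\<close>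
  have "sum be L \<le> sum be ((\<lambda>f. f - ?W) ` X)"
    using finX Lsub be0 by (intro sum_mono2) auto
  also have "\<dots> \<le> (\<Sum>f\<in>X. be (f - ?W))"
    using sum_image_le[OF finX, of be "\<lambda>f. f - ?W"] be0 by simp
  also have "\<dots> = (\<Sum>S\<in>Pow W. \<Sum>f\<in>{f\<in>X. f \<inter> W = S}. be (f - ?W))"
    using finX finW by (intro sum.group[symmetric]) auto
  also have "\<dots> \<le> (\<Sum>S\<in>Pow W. (if S = {} then (c * b) ^ (k - 1) else (1 + c) ^ k * d))"
    by (intro sum_mono part) auto
  also have "\<dots> = (c * b) ^ (k - 1) + (\<Sum>S\<in>Pow W - {{}}. (1 + c) ^ k * d)"
    using finW by (subst sum.remove[of _ "{}"]) auto
  also have "\<dots> \<le> (c * b) ^ (k - 1) + 2 ^ T * (1 + c) ^ k * d"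
  proof -
    have "card (Pow W - {{}}) \<le> card (Pow W)" using finW by (intro card_mono) auto
    also have "\<dots> = 2 ^ card W" using finW by (simp add: card_Pow)
    also have "\<dots> \<le> 2 ^ T" using cW by simp
    finally have "real (card (Pow W - {{}})) \<le> 2 ^ T" by (metis of_nat_le_iff of_nat_numeral of_nat_power)
    then have "real (card (Pow W - {{}})) * ((1 + c) ^ k * d) \<le> 2 ^ T * ((1 + c) ^ k * d)"
      using c d_nonneg by (intro mult_right_mono) auto
    then show ?thesis by (simp add: mult.assoc)
  qed
  finally have "(1 + 2 * l) * sum be L \<le> (1 + 2 * l) * ((c * b) ^ (k - 1) + 2 ^ T * (1 + c) ^ k * d)"
    using l0 by (intro mult_left_mono) auto
  then have "exp (- ((1 + 2 * l) * ((c * b) ^ (k - 1) + 2 ^ T * (1 + c) ^ k * d))) \<le> exp (- ((1 + 2 * l) * sum be L))"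
    by simp
  then show "exp (- ((1 + 2 * (c * q)) * ((c * b) ^ (k - 1) + 2 ^ T * (1 + c) ^ k * d))) \<le> open_ratio l (V - W) F w"
    using 1 unfolding l(1) by linarith
qed

end

section \<open>Convergence of the recursion\<close>

text \<open>The start 0 is the trivial lower bound for a ratio. As the recursion is decreasing in
  its argument, even iterates are lower bounds and odd iterates upper bounds.\<close>

primrec tree_iter :: "real \<Rightarrow> nat \<Rightarrow> nat \<Rightarrow> real" where
  "tree_iter c k 0 = 0"
| "tree_iter c k (Suc j) = exp (- ((c * tree_iter c k j) ^ (k - 1)))"

lemma tree_iter_bounds: "0 \<le> tree_iter c k j"
  by (cases j) auto

text \<open>In the variable \<open>z = (k-1)(c s)^(k-1)\<close> the recursion is \<open>z \<mapsto> D exp (- z)\<close>. This map need not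
  be a contraction, but its square has derivative \<open>D u exp (- u) \<le> D / e < 1\<close>; this is where the
  threshold on \<open>c\<close> comes from.\<close>

lemma tree_iter_tendsto:
  fixes x :: real and k :: nat
  assumes x: "0 \<le> x" and k: "2 \<le> k" and small: "(real k - 1) * x ^ (k - 1) < 1"
  defines "c \<equiv> x * exp (x ^ (k - 1))"
  shows "(\<lambda>j. tree_iter c k (Suc (2 * j))) \<longlonglongrightarrow> exp (- (x ^ (k - 1)))"
    and "(\<lambda>j. tree_iter c k (2 * j)) \<longlonglongrightarrow> exp (- (x ^ (k - 1)))"
proof -
  define y where "y = x ^ (k - 1)"
  define z where "z = (real k - 1) * y"
  define D where "D = z * exp z"
  define s where "s = tree_iter c k"
  define Z where "Z j = (real k - 1) * (c * s j) ^ (k - 1)" for j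
  define phi where "phi u = D * exp (- u)" for u :: real
  have kr: "real (k - Suc 0) = real k - 1" using k by simp
  have z0: "0 \<le> z" "z < 1" using x k small by (auto simp: z_def y_def)
  have D0: "0 \<le> D" using z0 by (simp add: D_def)
  have cpow: "c ^ (k - Suc 0) = y * exp z"
    by (simp add: c_def power_mult_distrib y_def z_def exp_of_nat_mult[symmetric] kr)
  have Zs: "Z (Suc j) = phi (Z j)" for j
  proof -
    have "s (Suc j) ^ (k - 1) = exp (- Z j)"
      unfolding Z_def s_def by (simp add: exp_of_nat_mult[symmetric] kr)
    then show ?thesis
      by (simp add: Z_def phi_def power_mult_distrib cpow D_def z_def)
  qed
  have fix_z: "phi z = z" by (simp add: phi_def D_def exp_minus)
  define kap where "kap = D * exp (- 1)"
  have kap: "0 \<le> kap" "kap < 1"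
  proof -
    show "0 \<le> kap" using D0 by (simp add: kap_def)
    have "kap = z * exp (z - 1)" by (simp add: kap_def D_def exp_diff exp_minus field_simps)
    also have "\<dots> \<le> z * 1" using z0 by (intro mult_left_mono) auto
    finally show "kap < 1" using z0 by simp
  qed
  have contr: "\<bar>phi (phi u) - z\<bar> \<le> kap * \<bar>u - z\<bar>" for u
  proof -
    have "norm (phi (phi u) - phi (phi z)) \<le> kap * norm (u - z)"
    proof (rule field_differentiable_bound[of UNIV])
      fix t :: real
      show "((\<lambda>u. phi (phi u)) has_field_derivative D * (phi t * exp (- phi t))) (at t within UNIV)"
        unfolding phi_def by (auto intro!: derivative_eq_intros simp: algebra_simps)
      have p0: "0 \<le> phi t" using D0 by (simp add: phi_def)
      have "phi t \<le> exp (phi t - 1)" using exp_ge_add_one_self[of "phi t - 1"] by simp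
      then have "phi t * exp (- phi t) \<le> exp (phi t - 1) * exp (- phi t)"
        by (intro mult_right_mono) auto
      also have "\<dots> = exp (- 1)" by (simp add: exp_add[symmetric])
      finally have "D * (phi t * exp (- phi t)) \<le> kap" unfolding kap_def using D0 by (intro mult_left_mono)
      then show "norm (D * (phi t * exp (- phi t))) \<le> kap" using D0 p0 by simp
    qed auto
    then show ?thesis by (simp add: fix_z)
  qed
  have bd: "norm (Z (2 * j) - z) \<le> kap ^ j * \<bar>Z 0 - z\<bar>" for j
    unfolding real_norm_def
  proof (induction j)
    case (Suc j)
    have "\<bar>Z (2 * Suc j) - z\<bar> \<le> kap * \<bar>Z (2 * j) - z\<bar>" using contr[of "Z (2 * j)"] by (simp add: Zs)
    also have "\<dots> \<le> kap * (kap ^ j * \<bar>Z 0 - z\<bar>)" using Suc kap by (intro mult_left_mono) auto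
    finally show ?case by simp
  qed simp
  have "(\<lambda>j. kap ^ j * \<bar>Z 0 - z\<bar>) \<longlonglongrightarrow> 0"
    using kap by (intro tendsto_mult_left_zero LIMSEQ_power_zero) auto
  then have "(\<lambda>j. Z (2 * j) - z) \<longlonglongrightarrow> 0"
    by (rule Lim_null_comparison[OF always_eventually[OF allI[OF bd]]])
  then have Zlim: "(\<lambda>j. Z (2 * j)) \<longlonglongrightarrow> z" by (simp add: LIM_zero_iff)
  have k1: "real k - 1 > 0" using k by simp
  \<comment> \<open>The iterate at \<open>Suc (2 * j)\<close> is exactly
    \<open>exp (- Z (2 * j) / (k - 1))\<close>, so convergence of \<open>Z\<close> along even
    indices settles the odd iterates. One more application of the recursion then settles the even
    ones, where \<open>c * exp (- x^(k-1)) = x\<close> identifies the limit.\<close>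
  have "(\<lambda>j. exp (- (Z (2 * j) / (real k - 1)))) \<longlonglongrightarrow> exp (- (z / (real k - 1)))"
    using k1 by (intro tendsto_intros Zlim) auto
  then show odd: "(\<lambda>j. tree_iter c k (Suc (2 * j))) \<longlonglongrightarrow> exp (- (x ^ (k - 1)))"
    using k1 by (simp add: Z_def s_def z_def y_def)
  have "(\<lambda>j. exp (- ((c * tree_iter c k (Suc (2 * j))) ^ (k - 1)))) \<longlonglongrightarrow> exp (- ((c * exp (- (x ^ (k - 1)))) ^ (k - 1)))"
    by (intro tendsto_intros odd)
  moreover have "c * exp (- (x ^ (k - 1))) = x" by (simp add: c_def exp_minus)
  ultimately have "(\<lambda>j. tree_iter c k (2 * Suc j)) \<longlonglongrightarrow> exp (- (x ^ (k - 1)))" by simp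
  then show "(\<lambda>j. tree_iter c k (2 * j)) \<longlonglongrightarrow> exp (- (x ^ (k - 1)))"
    by (subst (asm) filterlim_sequentially_Suc[of "\<lambda>j. tree_iter c k (2 * j)"])
qed

context sparse_hypergraph
begin

lemma open_ge_mono: "open_ge l T a \<Longrightarrow> a' \<le> a \<Longrightarrow> open_ge l T a'"
  unfolding open_ge_def by (meson order_trans)

lemma open_le_mono: "open_le l T b \<Longrightarrow> b \<le> b' \<Longrightarrow> open_le l T b'"
  unfolding open_le_def by (meson order_trans)

lemma open_ge_0: "0 \<le> l \<Longrightarrow> open_ge l T 0"
  unfolding open_ge_def by (simp add: open_ratio_nonneg)

lemma open_le_1: "0 \<le> l \<Longrightarrow> open_le l T 1"
  unfolding open_le_def using finite_V by (auto intro!: open_ratio_le_1 simp: state_def)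

lemma open_ge_max_0: "0 \<le> l \<Longrightarrow> open_ge l T a \<Longrightarrow> open_ge l T (max 0 a)"
  using open_ge_0[of l T] by (simp add: open_ge_def)

lemma open_le_min_1: "0 \<le> l \<Longrightarrow> open_le l T b \<Longrightarrow> open_le l T (min 1 b)"
  using open_le_1[of l T] by (simp add: open_le_def)

lemma singleton_notin_H: "{w} \<notin> H"
  using edge_card[of "{w}"] k_ge_3 by auto

lemma open_geD: "open_ge l T a \<Longrightarrow> v \<in> V \<Longrightarrow> a \<le> open_ratio l V H v"
  unfolding open_ge_def using state_initial singleton_notin_H[of v]
  by (metis Diff_empty card.empty le0)

lemma open_leD: "open_le l T b \<Longrightarrow> v \<in> V \<Longrightarrow> open_ratio l V H v \<le> b"
  unfolding open_le_def using state_initial singleton_notin_H[of v]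
  by (metis Diff_empty card.empty le0)

end

text \<open>\<open>q n * card (V n)\<close> is the order of the logarithms being computed. It has to
  diverge so that bounded factors disappear after normalisation and negative exponential rates beat
  constants.\<close>

locale sparse_hypergraph_sequence =
  fixes V :: "nat \<Rightarrow> 'b set" and H :: "nat \<Rightarrow> 'b set set" and k :: nat and q d :: "nat \<Rightarrow> real"
  assumes sparse: "eventually (\<lambda>n. sparse_hypergraph (V n) (H n) k (q n) (d n)) sequentially"
    and q_tendsto: "q \<longlonglongrightarrow> 0"
    and d_tendsto: "d \<longlonglongrightarrow> 0"
    and scale_at_top: "filterlim (\<lambda>n. q n * real (card (V n))) at_top sequentially"
    and k_ge_3: "3 \<le> k"
begin

abbreviation "ge_bound n \<equiv> sparse_hypergraph.open_ge (V n) (H n)"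
abbreviation "le_bound n \<equiv> sparse_hypergraph.open_le (V n) (H n)"

text \<open>The input bound is assumed for all \<open>T\<close> and \<open>e\<close> because the
  step consumes \<open>k\<close> units of the budget and a slack \<open>t\<close>, which continuity
  of the recursion supplies. For fixed \<open>T\<close> the errors in \<open>q n\<close> and
  \<open>d n\<close> then vanish. Truncation at 0 keeps the input admissible for
  \<open>open_le_step\<close>; the companion step truncates at 1 in the same way.\<close>

lemma le_bound_step:
  assumes c: "0 \<le> c" and s: "0 \<le> s"
    and lo: "\<And>T e. 0 < e \<Longrightarrow> eventually (\<lambda>n. ge_bound n (c * q n) T (s - e)) sequentially"
    and e: "0 < e"
  shows "eventually (\<lambda>n. le_bound n (c * q n) T (exp (- ((c * s) ^ (k - 1))) + e)) sequentially"
proof -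
  have "((\<lambda>t. exp (- ((c * max 0 (s - t)) ^ (k - 1)))) \<longlongrightarrow> exp (- ((c * max 0 (s - 0)) ^ (k - 1)))) (at_right 0)"
    by (intro tendsto_intros tendsto_max)
  then have "((\<lambda>t. exp (- ((c * max 0 (s - t)) ^ (k - 1)))) \<longlongrightarrow> exp (- ((c * s) ^ (k - 1)))) (at_right 0)"
    using s by simp
  then have "eventually (\<lambda>t. exp (- ((c * max 0 (s - t)) ^ (k - 1))) < exp (- ((c * s) ^ (k - 1))) + e) (at_right 0)"
    using e by (intro order_tendstoD) auto
  then have "eventually (\<lambda>t. 0 < t \<and> exp (- ((c * max 0 (s - t)) ^ (k - 1))) < exp (- ((c * s) ^ (k - 1))) + e) (at_right 0)"
    by (intro eventually_conj eventually_at_right_less)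
  then obtain t where t: "0 < t" "exp (- ((c * max 0 (s - t)) ^ (k - 1))) < exp (- ((c * s) ^ (k - 1))) + e"
    using eventually_happens trivial_limit_at_right_real by blast
  define a where "a = max 0 (s - t)"
  have "(\<lambda>n. exp (- ((1 - 3 * 2 ^ T * d n) * (c * a / (1 + c * q n)) ^ (k - 1)))) \<longlonglongrightarrow>
      exp (- ((1 - 3 * 2 ^ T * 0) * (c * a / (1 + c * 0)) ^ (k - 1)))"
    by (intro tendsto_intros q_tendsto d_tendsto) auto
  then have lim: "eventually (\<lambda>n. exp (- ((1 - 3 * 2 ^ T * d n) * (c * a / (1 + c * q n)) ^ (k - 1))) < exp (- ((c * s) ^ (k - 1))) + e) sequentially"
    using t by (intro order_tendstoD) (auto simp: a_def)
  show ?thesis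
    using sparse lo[OF t(1), of "T + k"] lim
  proof eventually_elim
    case (elim n)
    interpret sparse_hypergraph "V n" "H n" k "q n" "d n" by (rule elim)
    have l0: "0 \<le> c * q n" using c q_pos by simp
    have "open_ge (c * q n) (T + k) a" unfolding a_def using open_ge_max_0[OF l0 elim(2)] .
    from open_le_step[OF this _ c refl]
    show ?case using elim(3) by (intro open_le_mono[OF _ less_imp_le[OF elim(3)]]) (auto simp: a_def)
  qed
qed

lemma ge_bound_step:
  assumes c: "0 \<le> c" and s: "0 \<le> s" "s \<le> 1"
    and up: "\<And>T e. 0 < e \<Longrightarrow> eventually (\<lambda>n. le_bound n (c * q n) T (s + e)) sequentially"
    and e: "0 < e"
  shows "eventually (\<lambda>n. ge_bound n (c * q n) T (exp (- ((c * s) ^ (k - 1))) - e)) sequentially"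
proof -
  have "((\<lambda>t. exp (- ((c * min 1 (s + t)) ^ (k - 1)))) \<longlongrightarrow> exp (- ((c * min 1 (s + 0)) ^ (k - 1)))) (at_right 0)"
    by (intro tendsto_intros tendsto_min)
  then have "((\<lambda>t. exp (- ((c * min 1 (s + t)) ^ (k - 1)))) \<longlongrightarrow> exp (- ((c * s) ^ (k - 1)))) (at_right 0)"
    using s by simp
  then have "eventually (\<lambda>t. exp (- ((c * s) ^ (k - 1))) - e < exp (- ((c * min 1 (s + t)) ^ (k - 1)))) (at_right 0)"
    using e by (intro order_tendstoD) auto
  then have "eventually (\<lambda>t. 0 < t \<and> exp (- ((c * s) ^ (k - 1))) - e < exp (- ((c * min 1 (s + t)) ^ (k - 1)))) (at_right 0)"
    by (intro eventually_conj eventually_at_right_less)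
  then obtain t where t: "0 < t" "exp (- ((c * s) ^ (k - 1))) - e < exp (- ((c * min 1 (s + t)) ^ (k - 1)))"
    using eventually_happens trivial_limit_at_right_real by blast
  define b where "b = min 1 (s + t)"
  have b: "0 \<le> b" "b \<le> 1" using s t by (auto simp: b_def)
  have "(\<lambda>n. exp (- ((1 + 2 * (c * q n)) * ((c * b) ^ (k - 1) + 2 ^ T * (1 + c) ^ k * d n)))) \<longlonglongrightarrow>
      exp (- ((1 + 2 * (c * 0)) * ((c * b) ^ (k - 1) + 2 ^ T * (1 + c) ^ k * 0)))"
    by (intro tendsto_intros q_tendsto d_tendsto)
  then have lim: "eventually (\<lambda>n. exp (- ((c * s) ^ (k - 1))) - e < exp (- ((1 + 2 * (c * q n)) * ((c * b) ^ (k - 1) + 2 ^ T * (1 + c) ^ k * d n)))) sequentially"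
    using t by (intro order_tendstoD) (auto simp: b_def)
  have "(\<lambda>n. c * q n) \<longlonglongrightarrow> c * 0" by (intro tendsto_intros q_tendsto)
  then have half: "eventually (\<lambda>n. c * q n < 1 / 2) sequentially" by (intro order_tendstoD) auto
  show ?thesis
    using sparse up[OF t(1), of "T + k"] lim half
  proof eventually_elim
    case (elim n)
    interpret sparse_hypergraph "V n" "H n" k "q n" "d n" by (rule elim)
    have l0: "0 \<le> c * q n" using c q_pos by simp
    have "open_le (c * q n) (T + k) b" unfolding b_def using open_le_min_1[OF l0 elim(2)] .
    from open_ge_step[OF this b c refl]
    show ?case using elim(3,4) by (intro open_ge_mono[OF _ less_imp_le[OF elim(3)]]) auto
  qed
qed

lemma tree_iter_le_1: "0 \<le> c \<Longrightarrow> tree_iter c k j \<le> 1"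
  by (cases j) (auto simp: tree_iter_bounds)

lemma tree_iter_bound:
  assumes c: "0 \<le> c"
  shows "\<forall>T. \<forall>e>0. eventually (\<lambda>n. ge_bound n (c * q n) T (tree_iter c k (2 * j) - e)) sequentially"
    and "\<forall>T. \<forall>e>0. eventually (\<lambda>n. le_bound n (c * q n) T (tree_iter c k (Suc (2 * j)) + e)) sequentially"
proof -
  let ?G = "\<lambda>i. \<forall>T. \<forall>e>0. eventually (\<lambda>n. ge_bound n (c * q n) T (tree_iter c k i - e)) sequentially"
  let ?L = "\<lambda>i. \<forall>T. \<forall>e>0. eventually (\<lambda>n. le_bound n (c * q n) T (tree_iter c k i + e)) sequentially"
  have GL: "?L (Suc i)" if "?G i" for i
    using le_bound_step[OF c tree_iter_bounds] that by simp
  have LG: "?G (Suc i)" if "?L i" for i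
    using ge_bound_step[OF c tree_iter_bounds tree_iter_le_1[OF c]] that by simp
  have G: "?G (2 * j)" for j
  proof (induction j)
    case 0
    show ?case
    proof (intro allI impI)
      fix T and e :: real assume "0 < e"
      show "eventually (\<lambda>n. ge_bound n (c * q n) T (tree_iter c k (2 * 0) - e)) sequentially"
        using sparse
      proof eventually_elim
        case (elim n)
        interpret sparse_hypergraph "V n" "H n" k "q n" "d n" by (rule elim)
        show ?case using c q_pos \<open>0 < e\<close> by (intro open_ge_mono[OF open_ge_0]) auto
      qed
    qed
  next
    case (Suc j)
    then show ?case using GL[of "2 * j"] LG[of "Suc (2 * j)"] by simp
  qed
  then show "?G (2 * j)" .
  then show "?L (Suc (2 * j))" using GL by blast
qed

text \<open>The depth \<open>j\<close> is fixed before \<open>n\<close> grows, so only a bounded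
  budget is ever consumed. In the end \<open>T = 0\<close> suffices, since only the initial state,
  with nothing decided, is evaluated.\<close>

lemma open_ratio_tendsto:
  assumes x: "0 \<le> x" and small: "(real k - 1) * x ^ (k - 1) < 1" and e: "0 < e"
  defines "c \<equiv> x * exp (x ^ (k - 1))"
  shows "eventually (\<lambda>n. \<forall>v\<in>V n. \<bar>open_ratio (c * q n) (V n) (H n) v - exp (- (x ^ (k - 1)))\<bar> < e) sequentially"
proof -
  let ?r = "exp (- (x ^ (k - 1)))"
  have c: "0 \<le> c" using x by (simp add: c_def)
  have k2: "2 \<le> k" using k_ge_3 by simp
  have "eventually (\<lambda>j. ?r - e / 2 < tree_iter c k (2 * j)) sequentially"
    using tree_iter_tendsto(2)[OF x k2 small] e unfolding c_def by (intro order_tendstoD) auto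
  moreover have "eventually (\<lambda>j. tree_iter c k (Suc (2 * j)) < ?r + e / 2) sequentially"
    using tree_iter_tendsto(1)[OF x k2 small] e unfolding c_def by (intro order_tendstoD) auto
  ultimately have "eventually (\<lambda>j. ?r - e / 2 < tree_iter c k (2 * j) \<and> tree_iter c k (Suc (2 * j)) < ?r + e / 2) sequentially"
    by (rule eventually_conj)
  then obtain j where j: "?r - e / 2 < tree_iter c k (2 * j)" "tree_iter c k (Suc (2 * j)) < ?r + e / 2"
    by (auto simp: eventually_sequentially)
  have e2: "0 < e / 2" using e by simp
  show ?thesis
    using sparse tree_iter_bound(1)[OF c, rule_format, OF e2, of 0 j] tree_iter_bound(2)[OF c, rule_format, OF e2, of 0 j]
  proof eventually_elim
    case (elim n)
    interpret sparse_hypergraph "V n" "H n" k "q n" "d n" by (rule elim)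
    show ?case
    proof
      fix v assume v: "v \<in> V n"
      show "\<bar>open_ratio (c * q n) (V n) (H n) v - ?r\<bar> < e"
        using open_geD[OF elim(2) v] open_leD[OF elim(3) v] j by (simp add: abs_less_iff)
    qed
  qed
qed

end

section \<open>The free energy\<close>

text \<open>By \<open>wt_vertex\<close> each summand is the occupation probability of
  \<open>v\<close> divided by \<open>l\<close>; so this is the expected size of the random
  independent set divided by \<open>l * card U\<close>.\<close>

definition mean_open :: "real \<Rightarrow> 'b set \<Rightarrow> 'b set set \<Rightarrow> real" where
  "mean_open l U F = (\<Sum>v\<in>U. open_ratio l U F v / (1 + l * open_ratio l U F v)) / real (card U)"

definition free_energy :: "real \<Rightarrow> 'b set \<Rightarrow> 'b set set \<Rightarrow> real \<Rightarrow> real" where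
  "free_energy q U F c = ln (wt (c * q) U F {}) / (q * real (card U))"

text \<open>Differentiating \<open>l ^ card I\<close> brings down \<open>card I\<close>, which is
  then written as a sum over the vertices of \<open>I\<close> and the order of summation
  exchanged.\<close>

lemma has_derivative_wt:
  assumes U: "finite U" and l: "l > 0"
  shows "((\<lambda>l. wt l U F {}) has_real_derivative (\<Sum>v\<in>U. wt l U F {v}) / l) (at l)"
proof -
  let ?A = "{I. I \<subseteq> U \<and> avoids F I}"
  have finA: "finite ?A" using U by simp
  have "((\<lambda>l. \<Sum>I\<in>?A. l ^ card I) has_real_derivative (\<Sum>I\<in>?A. real (card I) * l ^ (card I - 1))) (at l)"
    by (intro DERIV_sum) (auto intro!: derivative_eq_intros)
  moreover have "(\<Sum>I\<in>?A. real (card I) * l ^ (card I - 1)) = (\<Sum>v\<in>U. wt l U F {v}) / l"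
  proof -
    have "real (card I) * l ^ (card I - 1) = (\<Sum>v\<in>U. if v \<in> I then l ^ card I else 0) / l" if "I \<in> ?A" for I
    proof -
      have "(\<Sum>v\<in>U. if v \<in> I then l ^ card I else 0) = (\<Sum>v\<in>U \<inter> I. l ^ card I)"
        by (rule sum.inter_restrict[OF U, symmetric])
      also have "U \<inter> I = I" using that by auto
      finally have "(\<Sum>v\<in>U. if v \<in> I then l ^ card I else 0) = real (card I) * l ^ card I" by simp
      then show ?thesis using l by (cases "card I") auto
    qed
    then have "(\<Sum>I\<in>?A. real (card I) * l ^ (card I - 1)) = (\<Sum>I\<in>?A. \<Sum>v\<in>U. if v \<in> I then l ^ card I else 0) / l"
      by (simp add: sum_divide_distrib)
    also have "(\<Sum>I\<in>?A. \<Sum>v\<in>U. if v \<in> I then l ^ card I else 0) = (\<Sum>v\<in>U. \<Sum>I\<in>?A. if v \<in> I then l ^ card I else 0)"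
      by (rule sum.swap)
    also have "\<dots> = (\<Sum>v\<in>U. wt l U F {v})"
    proof (rule sum.cong[OF refl])
      fix v
      have "(\<Sum>I\<in>?A. if v \<in> I then l ^ card I else 0) = (\<Sum>I\<in>{I\<in>?A. v \<in> I}. l ^ card I)"
        by (rule sum.inter_filter[OF finA, symmetric])
      also have "{I\<in>?A. v \<in> I} = {I. I \<subseteq> U \<and> avoids F I \<and> {v} \<subseteq> I}" by auto
      finally show "(\<Sum>I\<in>?A. if v \<in> I then l ^ card I else 0) = wt l U F {v}" by (simp add: wt_def)
    qed
    finally show ?thesis .
  qed
  ultimately show ?thesis by (simp add: wt_def)
qed

lemma has_derivative_free_energy:
  assumes U: "finite U" "U \<noteq> {}" and q: "q > 0" and F: "{} \<notin> F" and c: "c > 0"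
  shows "(free_energy q U F has_real_derivative mean_open (c * q) U F) (at c)"
proof -
  define l where "l = c * q"
  have l: "l > 0" using q c by (simp add: l_def)
  have Z: "wt l U F {} \<ge> 1" using U l F by (intro wt_ge_1) auto
  have v: "wt l U F {v} / wt l U F {} = l * (open_ratio l U F v / (1 + l * open_ratio l U F v))" if "v \<in> U" for v
  proof -
    have "wt l (U - {v}) F {} \<ge> 1" using U l F by (intro wt_ge_1) auto
    then show ?thesis
      using wt_vertex[of U l F v] U l F that by simp
  qed
  have "((\<lambda>c. c * q) has_real_derivative q) (at c)" by (auto intro!: derivative_eq_intros)
  then have "((\<lambda>c. wt (c * q) U F {}) has_real_derivative (\<Sum>v\<in>U. wt l U F {v}) / l * q) (at c)"
    unfolding l_def using l by (intro DERIV_chain2[OF has_derivative_wt[OF U(1)]]) (auto simp: l_def)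
  then have "(free_energy q U F has_real_derivative ((\<Sum>v\<in>U. wt l U F {v}) / l * q / wt l U F {}) / (q * real (card U))) (at c)"
    unfolding free_energy_def using Z U q by (auto intro!: derivative_eq_intros simp: l_def)
  moreover have "((\<Sum>v\<in>U. wt l U F {v}) / l * q / wt l U F {}) / (q * real (card U)) = mean_open l U F"
  proof -
    have "(\<Sum>v\<in>U. wt l U F {v}) / wt l U F {} = (\<Sum>v\<in>U. wt l U F {v} / wt l U F {})"
      by (rule sum_divide_distrib)
    also have "\<dots> = l * (\<Sum>v\<in>U. open_ratio l U F v / (1 + l * open_ratio l U F v))"
      by (simp add: v sum_distrib_left)
    finally have "(\<Sum>v\<in>U. wt l U F {v}) = l * (\<Sum>v\<in>U. open_ratio l U F v / (1 + l * open_ratio l U F v)) * wt l U F {}"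
      using Z by (simp add: divide_simps split: if_splits)
    then show ?thesis using l q Z by (simp add: mean_open_def)
  qed
  ultimately show ?thesis by (simp add: l_def)
qed

lemma mean_open_bounds:
  assumes U: "finite U" "U \<noteq> {}" and F: "{} \<notin> F" and l: "l \<ge> 0"
  shows "0 \<le> mean_open l U F" "mean_open l U F \<le> 1"
proof -
  have r: "0 \<le> open_ratio l U F v" "open_ratio l U F v \<le> 1" for v
    using U F l by (auto intro: open_ratio_nonneg open_ratio_le_1)
  show "0 \<le> mean_open l U F"
    unfolding mean_open_def using r l by (intro divide_nonneg_nonneg sum_nonneg) (auto intro: add_nonneg_nonneg)
  have "(\<Sum>v\<in>U. open_ratio l U F v / (1 + l * open_ratio l U F v)) \<le> (\<Sum>v\<in>U. 1)"
  proof (rule sum_mono)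
    fix v
    have "0 \<le> l * open_ratio l U F v" using l r by simp
    then show "open_ratio l U F v / (1 + l * open_ratio l U F v) \<le> 1" using r[of v] by (simp add: divide_simps)
  qed
  then show "mean_open l U F \<le> 1" unfolding mean_open_def using U by (simp add: divide_simps card_gt_0_iff)
qed

text \<open>The derivative \<open>mean_open\<close> lies between 0 and 1. The resulting Lipschitz
  constant does not depend on the hypergraph, which lets a limit at fixed \<open>c\<close> be
  transferred to activities that only converge to \<open>c\<close>.\<close>

lemma free_energy_diff:
  assumes U: "finite U" "U \<noteq> {}" and q: "q > 0" and F: "{} \<notin> F" and c: "0 < c" "c \<le> c'"
  shows "0 \<le> free_energy q U F c' - free_energy q U F c" "free_energy q U F c' - free_energy q U F c \<le> c' - c"
proof -
  have "free_energy q U F c \<le> free_energy q U F c'"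
  proof (rule DERIV_nonneg_imp_nondecreasing[OF c(2)])
    fix t assume "c \<le> t" "t \<le> c'"
    then show "\<exists>y. (free_energy q U F has_real_derivative y) (at t) \<and> 0 \<le> y"
      using has_derivative_free_energy[OF U q F, of t] mean_open_bounds[OF U F, of "t * q"] c q by auto
  qed
  then show "0 \<le> free_energy q U F c' - free_energy q U F c" by simp
  have "c - free_energy q U F c \<le> c' - free_energy q U F c'"
  proof (rule DERIV_nonneg_imp_nondecreasing[OF c(2)])
    fix t assume t: "c \<le> t" "t \<le> c'"
    have "((\<lambda>t. t - free_energy q U F t) has_real_derivative 1 - mean_open (t * q) U F) (at t)"
      using has_derivative_free_energy[OF U q F, of t] t c by (auto intro!: derivative_eq_intros)
    then show "\<exists>y. ((\<lambda>t. t - free_energy q U F t) has_real_derivative y) (at t) \<and> 0 \<le> y"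
      using mean_open_bounds[OF U F, of "t * q"] c q t by auto
  qed
  then show "free_energy q U F c' - free_energy q U F c \<le> c' - c" by simp
qed

lemma continuous_on_free_energy:
  assumes "finite U" "{} \<notin> F" "q > 0"
  shows "continuous_on {0..} (free_energy q U F)"
proof -
  have "wt (t * q) U F {} \<noteq> 0" if "t \<ge> 0" for t
    using wt_ge_1[of U "t * q" F] assms that by simp
  moreover have "continuous_on {0..} (\<lambda>t. wt (t * q) U F {})"
    unfolding wt_def by (intro continuous_intros)
  ultimately show ?thesis
    unfolding free_energy_def using assms by (auto intro!: continuous_intros simp: divide_inverse)
qed

context sparse_hypergraph_sequence
begin

lemma sparse_facts:
  "eventually (\<lambda>n. finite (V n) \<and> V n \<noteq> {} \<and> {} \<notin> H n \<and> 0 < q n) sequentially"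
proof -
  have "eventually (\<lambda>n. q n * real (card (V n)) > 0) sequentially"
    using scale_at_top by (simp add: filterlim_at_top_dense)
  with sparse show ?thesis
  proof eventually_elim
    case (elim n)
    interpret sparse_hypergraph "V n" "H n" k "q n" "d n" by (rule elim)
    show ?case using finite_V q_pos state_initial elim(2) by (auto simp: state_def)
  qed
qed

lemma mean_open_tendsto:
  assumes x: "0 \<le> x" and small: "(real k - 1) * x ^ (k - 1) < 1"
  defines "c \<equiv> x * exp (x ^ (k - 1))"
  shows "(\<lambda>n. mean_open (c * q n) (V n) (H n)) \<longlonglongrightarrow> exp (- (x ^ (k - 1)))"
proof (rule tendstoI)
  fix e :: real assume e: "0 < e"
  let ?r = "exp (- (x ^ (k - 1)))"
  have c: "0 \<le> c" using x by (simp add: c_def)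
  have "(\<lambda>n. c * q n) \<longlonglongrightarrow> c * 0" by (intro tendsto_intros q_tendsto)
  then have l_small: "eventually (\<lambda>n. c * q n < e / 4) sequentially" using e by (intro order_tendstoD) auto
  have e4: "0 < e / 4" using e by simp
  show "eventually (\<lambda>n. dist (mean_open (c * q n) (V n) (H n)) ?r < e) sequentially"
    using sparse_facts l_small open_ratio_tendsto[OF x small e4, folded c_def]
  proof eventually_elim
    case (elim n)
    define l where "l = c * q n"
    have l: "0 \<le> l" "l < e / 4" using elim c by (auto simp: l_def)
    let ?o = "open_ratio l (V n) (H n)"
    have "\<bar>?o v / (1 + l * ?o v) - ?r\<bar> \<le> e / 2" if v: "v \<in> V n" for v
    proof -
      have r: "0 \<le> ?o v" "?o v \<le> 1"
        using elim(1) l by (auto intro: open_ratio_nonneg open_ratio_le_1)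
      then have lo: "0 \<le> l * ?o v" "l * ?o v \<le> l" using l by (auto simp: mult_left_le)
      have "?o v - ?o v / (1 + l * ?o v) = ?o v * ((l * ?o v) / (1 + l * ?o v))"
        using lo by (simp add: field_simps)
      also have "\<dots> \<le> 1 * (l / 1)"
        using r l lo by (intro mult_mono frac_le) auto
      finally have 1: "?o v - ?o v / (1 + l * ?o v) \<le> e / 4" using l by linarith
      have 2: "0 \<le> ?o v - ?o v / (1 + l * ?o v)" using r lo by (simp add: field_simps)
      have "\<bar>?o v - ?r\<bar> < e / 4" using elim v by (simp add: l_def)
      then show ?thesis using 1 2 by linarith
    qed
    then have "(\<Sum>v\<in>V n. \<bar>?o v / (1 + l * ?o v) - ?r\<bar>) \<le> (\<Sum>v\<in>V n. e / 2)" by (intro sum_mono)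
    moreover have N: "real (card (V n)) > 0" using elim by (simp add: card_gt_0_iff)
    have "mean_open l (V n) (H n) - ?r = (\<Sum>v\<in>V n. ?o v / (1 + l * ?o v) - ?r) / real (card (V n))"
      using N by (simp add: mean_open_def sum_subtractf field_simps)
    then have "\<bar>mean_open l (V n) (H n) - ?r\<bar> \<le> (\<Sum>v\<in>V n. \<bar>?o v / (1 + l * ?o v) - ?r\<bar>) / real (card (V n))"
      using N by (simp add: divide_right_mono)
    ultimately have "\<bar>mean_open l (V n) (H n) - ?r\<bar> \<le> (\<Sum>v\<in>V n. e / 2) / real (card (V n))"
      using N by (meson divide_right_mono less_imp_le order_trans)
    also have "\<dots> = e / 2" using N by simp
    finally show ?case using e by (simp add: dist_real_def l_def)
  qed
qed

text \<open>After the substitution \<open>c = t * exp (t^(k-1))\<close> the limit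
  \<open>exp (- t^(k-1))\<close> of \<open>mean_open\<close> cancels the exponential in the
  derivative \<open>?dpsi\<close> of the substitution, and a polynomial integrand remains. Since
  \<open>mean_open \<le> 1\<close>, \<open>?dpsi\<close> itself dominates. The smallness condition
  holds on all of \<open>{0..x}\<close>, so the pointwise limit is available there.\<close>

theorem free_energy_tendsto:
  assumes x: "0 \<le> x" and small: "(real k - 1) * x ^ (k - 1) < 1"
  shows "(\<lambda>n. free_energy (q n) (V n) (H n) (x * exp (x ^ (k - 1)))) \<longlonglongrightarrow> x + (1 - 1 / real k) * x ^ k"
proof -
  let ?psi = "\<lambda>t::real. t * exp (t ^ (k - 1))"
  let ?dpsi = "\<lambda>t::real. exp (t ^ (k - 1)) * (1 + (real k - 1) * t ^ (k - 1))"
  have k1: "real (k - Suc 0) = real k - 1" using k_ge_3 by simp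
  have kp: "t * t ^ (k - Suc (Suc 0)) = t ^ (k - Suc 0)" for t :: real
    using k_ge_3 by (metis Suc_diff_Suc Suc_le_lessD Suc_lessD numeral_3_eq_3 power_Suc)
  have dpsi: "(?psi has_real_derivative ?dpsi t) (at t)" for t
  proof -
    have "(?psi has_real_derivative exp (t ^ (k - 1)) + t * (exp (t ^ (k - 1)) * (real (k - 1) * t ^ (k - 1 - 1)))) (at t)"
      by (auto intro!: derivative_eq_intros)
    moreover have "exp (t ^ (k - 1)) + t * (exp (t ^ (k - 1)) * (real (k - 1) * t ^ (k - 1 - 1)))
        = exp (t ^ (k - 1)) * (1 + (real k - 1) * (t * t ^ (k - Suc (Suc 0))))"
      using k1 by (simp add: algebra_simps)
    ultimately show ?thesis by (simp only: kp One_nat_def)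
  qed
  define g where "g n t = mean_open (?psi t * q n) (V n) (H n) * ?dpsi t" for n t
  have small': "(real k - 1) * t ^ (k - 1) < 1" if "0 \<le> t" "t \<le> x" for t
  proof -
    have "(real k - 1) * t ^ (k - 1) \<le> (real k - 1) * x ^ (k - 1)"
      using that k_ge_3 by (intro mult_left_mono power_mono) auto
    then show ?thesis using small by linarith
  qed
  have int_n: "(g n has_integral free_energy (q n) (V n) (H n) (?psi x) - free_energy (q n) (V n) (H n) (?psi 0)) {0..x}"
    if "finite (V n) \<and> V n \<noteq> {} \<and> {} \<notin> H n \<and> 0 < q n" for n
  proof (rule fundamental_theorem_of_calculus_interior[OF x])
    have "continuous_on {0..x} (free_energy (q n) (V n) (H n) \<circ> ?psi)"
    proof (rule continuous_on_compose)
      show "continuous_on (?psi ` {0..x}) (free_energy (q n) (V n) (H n))"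
        by (rule continuous_on_subset[OF continuous_on_free_energy]) (use that in auto)
    qed (intro continuous_intros)
    then show "continuous_on {0..x} (\<lambda>t. free_energy (q n) (V n) (H n) (?psi t))" by (simp add: o_def)
    fix t assume t: "t \<in> {0<..<x}"
    then have "?psi t > 0" by simp
    then have "((\<lambda>t. free_energy (q n) (V n) (H n) (?psi t)) has_real_derivative g n t) (at t)"
      unfolding g_def using that by (intro DERIV_chain2[OF _ dpsi] has_derivative_free_energy) auto
    then show "((\<lambda>t. free_energy (q n) (V n) (H n) (?psi t)) has_vector_derivative g n t) (at t)"
      by (simp add: has_real_derivative_iff_has_vector_derivative)
  qed
  have fe0: "free_energy (q n) (V n) (H n) (?psi 0) = 0"
    if "finite (V n) \<and> V n \<noteq> {} \<and> {} \<notin> H n \<and> 0 < q n" for n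
  proof -
    have "wt 0 (V n) (H n) {} = (\<Sum>I\<in>{I. I \<subseteq> V n \<and> avoids (H n) I}. if I = {} then 1 else 0)"
      unfolding wt_def
    proof (rule sum.cong)
      fix I assume "I \<in> {I. I \<subseteq> V n \<and> avoids (H n) I}"
      then have "finite I" using that finite_subset by auto
      then show "0 ^ card I = (if I = {} then 1 else 0 :: real)" by (auto simp: card_gt_0_iff zero_power)
    qed simp
    also have "\<dots> = 1" using that by (subst sum.delta) (auto simp: avoids_def)
    finally show ?thesis by (simp add: free_energy_def)
  qed
  have fe: "eventually (\<lambda>n. free_energy (q n) (V n) (H n) (?psi x) = integral {0..x} (g n)) sequentially"
    using sparse_facts
  proof eventually_elim
    case (elim n)
    show ?case using integral_unique[OF int_n[OF elim]] fe0[OF elim] by simp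
  qed
  have lim: "(\<lambda>n. integral {0..x} (g n)) \<longlonglongrightarrow> integral {0..x} (\<lambda>t. 1 + (real k - 1) * t ^ (k - 1))"
  proof -
    \<comment> \<open>Dominated convergence asks for integrability and the bound at every index,
      while the hypotheses hold only eventually; hence the shift by \<open>n0\<close>.\<close>
    from sparse_facts obtain n0 where n0: "\<And>n. n \<ge> n0 \<Longrightarrow> finite (V n) \<and> V n \<noteq> {} \<and> {} \<notin> H n \<and> 0 < q n"
      by (auto simp: eventually_sequentially)
    have "(\<lambda>n. integral {0..x} (g (n + n0))) \<longlonglongrightarrow> integral {0..x} (\<lambda>t. 1 + (real k - 1) * t ^ (k - 1))"
    proof (rule dominated_convergence(2))
      show "g (n + n0) integrable_on {0..x}" for n
        using int_n[OF n0, of "n + n0"] by (auto simp: integrable_on_def)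
      show "?dpsi integrable_on {0..x}" by (intro integrable_continuous_real continuous_intros)
      show "norm (g (n + n0) t) \<le> ?dpsi t" if t: "t \<in> {0..x}" for n t
      proof -
        have "0 \<le> mean_open (?psi t * q (n + n0)) (V (n + n0)) (H (n + n0))"
             "mean_open (?psi t * q (n + n0)) (V (n + n0)) (H (n + n0)) \<le> 1"
          using n0[of "n + n0"] t by (auto intro!: mean_open_bounds)
        moreover have "0 \<le> ?dpsi t" using t k_ge_3 by (intro mult_nonneg_nonneg add_nonneg_nonneg) auto
        moreover have "norm (m * D) \<le> D" if "0 \<le> m" "m \<le> 1" "0 \<le> D" for m D :: real
          using that by (simp add: abs_mult mult_left_le_one_le)
        ultimately show ?thesis unfolding g_def by blast
      qed
      show "(\<lambda>n. g (n + n0) t) \<longlonglongrightarrow> 1 + (real k - 1) * t ^ (k - 1)" if t: "t \<in> {0..x}" for t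
      proof -
        have "(\<lambda>n. mean_open (?psi t * q n) (V n) (H n)) \<longlonglongrightarrow> exp (- (t ^ (k - 1)))"
          using mean_open_tendsto[of t] t small' by simp
        then have "(\<lambda>n. g n t) \<longlonglongrightarrow> exp (- (t ^ (k - 1))) * ?dpsi t"
          unfolding g_def by (rule tendsto_mult_right)
        moreover have "exp (- (t ^ (k - 1))) * ?dpsi t = 1 + (real k - 1) * t ^ (k - 1)"
          by (simp add: mult.assoc[symmetric] exp_add[symmetric])
        ultimately have "(\<lambda>n. g n t) \<longlonglongrightarrow> 1 + (real k - 1) * t ^ (k - 1)" by (simp only:)
        then show ?thesis by (rule LIMSEQ_ignore_initial_segment)
      qed
    qed
    then show ?thesis by (rule LIMSEQ_offset)
  qed
  have val: "integral {0..x} (\<lambda>t. 1 + (real k - 1) * t ^ (k - 1)) = x + (1 - 1 / real k) * x ^ k"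
  proof (rule integral_unique)
    have "((\<lambda>t. 1 + (real k - 1) * t ^ (k - 1)) has_integral (x + (1 - 1 / real k) * x ^ k) - (0 + (1 - 1 / real k) * 0 ^ k)) {0..x}"
    proof (rule fundamental_theorem_of_calculus[OF x])
      fix t :: real
      have "((\<lambda>t. t + (1 - 1 / real k) * t ^ k) has_real_derivative 1 + (1 - 1 / real k) * (real k * t ^ (k - 1))) (at t within {0..x})"
        by (auto intro!: derivative_eq_intros)
      moreover have "(1 - 1 / real k) * (real k * t ^ (k - 1)) = (real k - 1) * t ^ (k - 1)"
        using k_ge_3 by (simp add: field_simps)
      ultimately show "((\<lambda>t. t + (1 - 1 / real k) * t ^ k) has_vector_derivative 1 + (real k - 1) * t ^ (k - 1)) (at t within {0..x})"
        by (simp only: has_real_derivative_iff_has_vector_derivative)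
    qed
    then show "((\<lambda>t. 1 + (real k - 1) * t ^ (k - 1)) has_integral x + (1 - 1 / real k) * x ^ k) {0..x}"
      using k_ge_3 by (simp add: zero_power)
  qed
  show ?thesis unfolding tendsto_cong[OF fe] using lim unfolding val .
qed

end

section \<open>Binomial and uniform random sets\<close>

definition indep_count :: "'b set \<Rightarrow> 'b set set \<Rightarrow> nat \<Rightarrow> nat" where
  "indep_count U F j = card {I. I \<subseteq> U \<and> avoids F I \<and> card I = j}"

definition indep_ratio :: "'b set \<Rightarrow> 'b set set \<Rightarrow> nat \<Rightarrow> real" where
  "indep_ratio U F j = real (indep_count U F j) / real (card U choose j)"

lemma wt_eq_sum_indep_count:
  assumes "finite U"
  shows "wt l U F {} = (\<Sum>j\<le>card U. real (indep_count U F j) * l ^ j)"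
proof -
  let ?A = "{I. I \<subseteq> U \<and> avoids F I}"
  have "wt l U F {} = (\<Sum>I\<in>?A. l ^ card I)" by (simp add: wt_def)
  also have "\<dots> = (\<Sum>j\<le>card U. \<Sum>I\<in>{I\<in>?A. card I = j}. l ^ card I)"
    using assms by (intro sum.group[symmetric]) (auto intro: card_mono)
  also have "\<dots> = (\<Sum>j\<le>card U. real (indep_count U F j) * l ^ j)"
  proof (rule sum.cong[OF refl])
    fix j
    have "{I\<in>?A. card I = j} = {I. I \<subseteq> U \<and> avoids F I \<and> card I = j}" by auto
    then show "(\<Sum>I\<in>{I\<in>?A. card I = j}. l ^ card I) = real (indep_count U F j) * l ^ j"
      by (simp add: indep_count_def)
  qed
  finally show ?thesis .
qed

lemma bernoulli_sum_eq_wt: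
  assumes "finite U" "0 \<le> p" "p < 1"
  shows "(\<Sum>G\<in>{G. G \<subseteq> U \<and> avoids F G}. p ^ card G * (1 - p) ^ (card U - card G)) =
    (1 - p) ^ card U * wt (p / (1 - p)) U F {}"
proof -
  have "p ^ card G * (1 - p) ^ (card U - card G) = (1 - p) ^ card U * (p / (1 - p)) ^ card G"
    if "G \<subseteq> U" for G
  proof -
    have "card G \<le> card U" using that assms by (intro card_mono)
    then have "(1 - p) ^ card U = (1 - p) ^ (card U - card G) * (1 - p) ^ card G"
      by (simp add: power_add[symmetric])
    then show ?thesis using assms by (simp add: power_divide)
  qed
  then show ?thesis unfolding wt_def by (simp add: sum_distrib_left)
qed

text \<open>Double counting of pairs: deleting a vertex from an independent \<open>(j+1)\<close>-set
  leaves an independent \<open>j\<close>-set together with a vertex outside it, and both can be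
  recovered.\<close>

lemma indep_count_Suc:
  assumes U: "finite U"
  shows "indep_count U F (Suc j) * Suc j \<le> indep_count U F j * (card U - j)"
proof -
  let ?I = "\<lambda>j. {I. I \<subseteq> U \<and> avoids F I \<and> card I = j}"
  let ?A = "SIGMA I:?I (Suc j). I" and ?B = "SIGMA J:?I j. U - J"
  have fin: "finite (?I j)" for j using U by simp
  have finI: "finite I" if "I \<subseteq> U" for I using that U finite_subset by auto
  have "card ?A = (\<Sum>I\<in>?I (Suc j). card I)"
    using finI by (intro card_SigmaI fin) auto
  then have A: "card ?A = indep_count U F (Suc j) * Suc j" by (simp add: indep_count_def)
  have "card ?B = (\<Sum>J\<in>?I j. card (U - J))"
    using U by (intro card_SigmaI fin) auto
  also have "\<dots> = (\<Sum>J\<in>?I j. card U - j)"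
    using finI by (intro sum.cong refl) (auto simp: card_Diff_subset)
  finally have B: "card ?B = indep_count U F j * (card U - j)" by (simp add: indep_count_def)
  have "card ?A \<le> card ?B"
  proof (rule card_inj_on_le)
    show "inj_on (\<lambda>(I, v). (I - {v}, v)) ?A"
    proof (rule inj_onI)
      fix x y assume "x \<in> ?A" "y \<in> ?A" and e: "(\<lambda>(I, v). (I - {v}, v)) x = (\<lambda>(I, v). (I - {v}, v)) y"
      then obtain I v J where "x = (I, v)" "y = (J, v)" "v \<in> I" "v \<in> J" "I - {v} = J - {v}"
        by (auto split: prod.splits)
      then show "x = y" by auto
    qed
    show "(\<lambda>(I, v). (I - {v}, v)) ` ?A \<subseteq> ?B"
    proof
      fix y assume "y \<in> (\<lambda>(I, v). (I - {v}, v)) ` ?A"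
      then obtain I v where I: "I \<subseteq> U" "avoids F I" "card I = Suc j" "v \<in> I" "y = (I - {v}, v)" by auto
      then have "avoids F (I - {v})" by (auto simp: avoids_def)
      then show "y \<in> ?B" using I finI by auto
    qed
    show "finite ?B" using fin U by (intro finite_SigmaI) auto
  qed
  then show ?thesis using A B by simp
qed

lemma indep_ratio_antimono:
  assumes U: "finite U" and "i \<le> j" "j \<le> card U"
  shows "indep_ratio U F j \<le> indep_ratio U F i"
  using assms(2,3)
proof (induction j rule: dec_induct)
  case (step j)
  let ?N = "card U"
  have pos: "real (?N choose j) > 0" "real (?N choose Suc j) > 0" using step by auto
  have "real (indep_count U F (Suc j)) * real (Suc j) \<le> real (indep_count U F j) * real (?N - j)"
    using indep_count_Suc[OF U, of F j] by (metis of_nat_le_iff of_nat_mult)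
  moreover have "Suc j * (?N choose Suc j) = (?N - j) * (?N choose j)"
    by (simp only: binomial_absorb_comp binomial_absorption)
  then have "real (Suc j) * real (?N choose Suc j) = real (?N - j) * real (?N choose j)"
    by (metis of_nat_mult)
  ultimately have "real (indep_count U F (Suc j)) * (real (Suc j) * real (?N choose Suc j)) * real (?N choose j)
      \<le> real (indep_count U F j) * (real (Suc j) * real (?N choose Suc j)) * real (?N choose Suc j)"
  proof -
    assume a: "real (indep_count U F (Suc j)) * real (Suc j) \<le> real (indep_count U F j) * real (?N - j)"
      and e: "real (Suc j) * real (?N choose Suc j) = real (?N - j) * real (?N choose j)"
    have "real (indep_count U F (Suc j)) * real (Suc j) * (real (?N choose Suc j) * real (?N choose j))
       \<le> real (indep_count U F j) * real (?N - j) * (real (?N choose Suc j) * real (?N choose j))"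
      using a by (intro mult_right_mono) auto
    also have "\<dots> = real (indep_count U F j) * (real (?N - j) * real (?N choose j)) * real (?N choose Suc j)" by simp
    finally show ?thesis unfolding e[symmetric] by (simp only: mult_ac)
  qed
  then have "real (indep_count U F (Suc j)) * real (?N choose j) \<le> real (indep_count U F j) * real (?N choose Suc j)"
  proof -
    assume "real (indep_count U F (Suc j)) * (real (Suc j) * real (?N choose Suc j)) * real (?N choose j)
      \<le> real (indep_count U F j) * (real (Suc j) * real (?N choose Suc j)) * real (?N choose Suc j)"
    then have "(real (Suc j) * real (?N choose Suc j)) * (real (indep_count U F (Suc j)) * real (?N choose j))
      \<le> (real (Suc j) * real (?N choose Suc j)) * (real (indep_count U F j) * real (?N choose Suc j))"
      by (simp only: mult_ac)
    moreover have "real (Suc j) * real (?N choose Suc j) > 0" using pos by simp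
    ultimately show ?thesis using mult_le_cancel_left_pos by blast
  qed
  then have "indep_ratio U F (Suc j) \<le> indep_ratio U F j"
    unfolding indep_ratio_def using pos by (simp add: field_simps)
  then show ?case using step by linarith
qed simp

text \<open>A crude half of Stirling's formula; its error \<open>1 + ln m\<close> is
  \<open>o(m)\<close>, which is all that is needed. The induction rests on
  \<open>ln (m / (m+1)) \<le> - 1 / (m+1)\<close>.\<close>

lemma ln_fact_le: "1 \<le> m \<Longrightarrow> ln (fact m) \<le> real m * ln (real m) - real m + 1 + ln (real m)"
proof (induction m rule: dec_induct)
  case (step m)
  have m: "real m > 0" using step by simp
  have "ln (real m / real (Suc m)) \<le> real m / real (Suc m) - 1"
    using m by (intro ln_le_minus_one) auto
  moreover have "real m / real (Suc m) - 1 = - 1 / real (Suc m)" by (simp add: field_simps)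
  moreover have "ln (real m / real (Suc m)) = ln (real m) - ln (real (Suc m))" using m by (simp add: ln_div)
  ultimately have "ln (real m) - ln (real (Suc m)) \<le> - 1 / real (Suc m)" by simp
  then have "real (Suc m) * (ln (real m) - ln (real (Suc m))) \<le> real (Suc m) * (- 1 / real (Suc m))"
    by (intro mult_left_mono) auto
  then have "real (Suc m) * (ln (real m) - ln (real (Suc m))) \<le> - 1" by simp
  moreover have "ln (fact (Suc m) :: real) = ln (real (Suc m)) + ln (fact m)"
    by (simp add: ln_mult del: of_nat_Suc)
  ultimately show ?case using step.IH by (simp add: algebra_simps)
qed simp

lemma binomial_mult_fact_ge:
  assumes "m \<le> N"
  shows "real (N - m) ^ m \<le> real (N choose m) * fact m"
proof -
  have "real (N - m) ^ j \<le> real (N choose j) * fact j" if "j \<le> m" for j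
    using that
  proof (induction j)
    case (Suc j)
    have "Suc j * (N choose Suc j) = (N - j) * (N choose j)"
      by (simp only: binomial_absorb_comp binomial_absorption)
    then have e: "real (Suc j) * real (N choose Suc j) = real (N - j) * real (N choose j)"
      by (metis of_nat_mult)
    have "real (N - m) ^ Suc j \<le> real (N - j) * (real (N choose j) * fact j)"
      using Suc by (simp only: power_Suc) (intro mult_mono; simp)
    also have "\<dots> = (real (Suc j) * real (N choose Suc j)) * fact j" unfolding e by simp
    also have "\<dots> = real (N choose Suc j) * fact (Suc j)" by simp
    finally show ?case .
  qed simp
  then show ?thesis by simp
qed

lemma ln_binomial_ge:
  assumes "1 \<le> m" "m < N"
  shows "real m * (ln (real (N - m)) - ln (real m) + 1) - 1 - ln (real m) \<le> ln (real (N choose m))"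
proof -
  have "real (N - m) ^ m \<le> real (N choose m) * fact m" using assms by (intro binomial_mult_fact_ge) auto
  moreover have pos: "0 < real (N choose m)" "0 < real (N - m)" using assms by auto
  ultimately have "ln (real (N - m) ^ m) \<le> ln (real (N choose m) * fact m)"
    by (subst ln_le_cancel_iff) auto
  also have "\<dots> = ln (real (N choose m)) + ln (fact m)" using pos by (simp add: ln_mult)
  finally have "real m * ln (real (N - m)) \<le> ln (real (N choose m)) + ln (fact m)"
    using pos by (simp add: ln_realpow)
  then show ?thesis using ln_fact_le[OF assms(1)] by (simp add: algebra_simps)
qed

text \<open>With \<open>\<Phi>(x) = x + (1 - 1/k) x^k\<close> the limiting free energy at activity
  \<open>\<psi>(x) = x exp (x^(k-1))\<close>, this inequality says that under that activity the size of a random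
  independent set concentrates at density \<open>x\<close>. It is Bernoulli's inequality plus \<open>ln t < t - 1\<close>.\<close>

lemma tilted_energy_min:
  fixes x y :: real
  assumes "0 < x" "0 < y" "x \<noteq> y" "1 \<le> k"
  shows "y + (1 - 1 / real k) * y ^ k - y * ln (y * exp (y ^ (k - 1))) <
         x + (1 - 1 / real k) * x ^ k - y * ln (x * exp (x ^ (k - 1)))"
proof -
  have "ln (x / y) < x / y - 1"
    using assms ln_eq_minus_one[of "x / y"] ln_le_minus_one[of "x / y"] by (force simp: less_le)
  then have "y * ln (x / y) < y * (x / y - 1)" using assms by simp
  also have "y * (x / y - 1) = x - y" using assms by (simp add: right_diff_distrib)
  finally have 1: "y * (ln x - ln y) < x - y" using assms by (simp add: ln_div)
  have "1 + real k * (y / x - 1) \<le> (1 + (y / x - 1)) ^ k"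
    using assms by (intro Bernoulli_inequality) auto
  then have "x ^ k * (1 + real k * (y / x - 1)) \<le> x ^ k * (y / x) ^ k"
    using assms by (intro mult_left_mono) auto
  also have "\<dots> = y ^ k" using assms by (simp add: power_divide)
  also have "x ^ k * (1 + real k * (y / x - 1)) = x ^ k + real k * (x ^ (k - 1) * y) - real k * x ^ k"
    using assms by (simp add: power_eq_if field_simps)
  finally have "(x ^ k + real k * (x ^ (k - 1) * y) - real k * x ^ k) / real k \<le> y ^ k / real k"
    by (rule divide_right_mono) simp
  then have 2: "x ^ k / real k + x ^ (k - 1) * y - x ^ k \<le> y ^ k / real k"
    using assms by (simp add: add_divide_distrib diff_divide_distrib)
  have "y * y ^ (k - 1) = y ^ k" using assms by (simp add: power_eq_if)
  moreover have "ln (t * exp (t ^ (k - 1))) = ln t + t ^ (k - 1)" if "t > 0" for t :: real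
    using that by (simp add: ln_mult)
  ultimately show ?thesis using 1 2 assms by (simp add: algebra_simps)
qed

section \<open>Limits for the binomial and the uniform model\<close>

context sparse_hypergraph_sequence
begin

lemma free_energy_tendsto_perturbed:
  assumes x: "0 < x" and small: "(real k - 1) * x ^ (k - 1) < 1"
    and c: "c \<longlonglongrightarrow> x * exp (x ^ (k - 1))"
  shows "(\<lambda>n. free_energy (q n) (V n) (H n) (c n)) \<longlonglongrightarrow> x + (1 - 1 / real k) * x ^ k"
proof -
  let ?c = "x * exp (x ^ (k - 1))"
  have c0: "0 < ?c" using x by simp
  then have "eventually (\<lambda>n. 0 < c n) sequentially" using c by (intro order_tendstoD)
  then have bd: "eventually (\<lambda>n. norm (free_energy (q n) (V n) (H n) (c n) - free_energy (q n) (V n) (H n) ?c) \<le> \<bar>c n - ?c\<bar>) sequentially"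
    using sparse_facts
  proof eventually_elim
    case (elim n)
    show ?case
    proof (cases "c n \<le> ?c")
      case True
      then show ?thesis
        using free_energy_diff[of "V n" "q n" "H n" "c n" ?c] elim by auto
    next
      case False
      then show ?thesis
        using free_energy_diff[of "V n" "q n" "H n" ?c "c n"] elim c0 by auto
    qed
  qed
  have "(\<lambda>n. \<bar>c n - ?c\<bar>) \<longlonglongrightarrow> \<bar>?c - ?c\<bar>" by (intro tendsto_intros c)
  then have "(\<lambda>n. \<bar>c n - ?c\<bar>) \<longlonglongrightarrow> 0" by simp
  from Lim_null_comparison[OF bd this]
  have "(\<lambda>n. free_energy (q n) (V n) (H n) (c n) - free_energy (q n) (V n) (H n) ?c) \<longlonglongrightarrow> 0" .
  from tendsto_add[OF this free_energy_tendsto[OF less_imp_le[OF x] small]]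
  show ?thesis by simp
qed

text \<open>The sum is \<open>(1 - p)^N\<close> times the partition function at the odds
  \<open>p / (1 - p)\<close>. The odds differ from \<open>p\<close> by a factor tending to 1, which
  \<open>free_energy_tendsto_perturbed\<close> tolerates, and the prefactor contributes the final
  \<open>- x * exp (x^(k-1))\<close>.\<close>

theorem ln_binomial_model_tendsto:
  assumes x: "0 < x" and small: "(real k - 1) * x ^ (k - 1) < 1"
    and p: "(\<lambda>n. p n / q n) \<longlonglongrightarrow> x * exp (x ^ (k - 1))"
  shows "(\<lambda>n. ln (\<Sum>G\<in>{G. G \<subseteq> V n \<and> avoids (H n) G}. p n ^ card G * (1 - p n) ^ (card (V n) - card G))
      / (q n * real (card (V n)))) \<longlonglongrightarrow> x + (1 - 1 / real k) * x ^ k - x * exp (x ^ (k - 1))"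
proof -
  let ?c = "x * exp (x ^ (k - 1))"
  have c0: "0 < ?c" using x by simp
  have qpos: "eventually (\<lambda>n. 0 < q n) sequentially" using sparse_facts by eventually_elim auto
  have "(\<lambda>n. p n / q n * q n) \<longlonglongrightarrow> ?c * 0" by (intro tendsto_intros p q_tendsto)
  moreover have "eventually (\<lambda>n. p n / q n * q n = p n) sequentially"
    using qpos by eventually_elim auto
  ultimately have p_lim: "p \<longlonglongrightarrow> 0" by (simp add: tendsto_cong)
  have "eventually (\<lambda>n. 0 < p n / q n) sequentially" using c0 p by (intro order_tendstoD)
  then have p_pos: "eventually (\<lambda>n. 0 < p n) sequentially"
    using qpos by eventually_elim (simp add: zero_less_divide_iff)
  have p_half: "eventually (\<lambda>n. p n < 1 / 2) sequentially" using p_lim by (intro order_tendstoD) auto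
  have "(\<lambda>n. p n / q n * (1 / (1 - p n))) \<longlonglongrightarrow> ?c * (1 / (1 - 0))"
    by (intro tendsto_intros p p_lim) auto
  then have c_lim: "(\<lambda>n. p n / (1 - p n) / q n) \<longlonglongrightarrow> ?c" by (simp add: mult.commute)
  have fe: "(\<lambda>n. free_energy (q n) (V n) (H n) (p n / (1 - p n) / q n)) \<longlonglongrightarrow> x + (1 - 1 / real k) * x ^ k"
    by (rule free_energy_tendsto_perturbed[OF x small c_lim])
  have ln_lim: "(\<lambda>n. ln (1 - p n) / q n) \<longlonglongrightarrow> - ?c"
  proof (rule tendsto_sandwich)
    have "(\<lambda>n. - (p n / q n) - 2 * p n * (p n / q n)) \<longlonglongrightarrow> - ?c - 2 * 0 * ?c"
      by (intro tendsto_intros p p_lim)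
    then show "(\<lambda>n. - (p n / q n) - 2 * p n * (p n / q n)) \<longlonglongrightarrow> - ?c" by simp
    show "(\<lambda>n. - (p n / q n)) \<longlonglongrightarrow> - ?c" by (intro tendsto_intros p)
    show "eventually (\<lambda>n. - (p n / q n) - 2 * p n * (p n / q n) \<le> ln (1 - p n) / q n) sequentially"
      using qpos p_pos p_half
    proof eventually_elim
      case (elim n)
      have "- p n - 2 * (p n)\<^sup>2 \<le> ln (1 - p n)"
        using elim by (intro ln_one_minus_pos_lower_bound) auto
      then have "(- p n - 2 * (p n)\<^sup>2) / q n \<le> ln (1 - p n) / q n"
        using elim by (intro divide_right_mono) auto
      then show ?case by (simp add: diff_divide_distrib power2_eq_square)
    qed
    show "eventually (\<lambda>n. ln (1 - p n) / q n \<le> - (p n / q n)) sequentially"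
      using qpos p_pos p_half
    proof eventually_elim
      case (elim n)
      have "ln (1 - p n) \<le> - p n" using elim ln_le_minus_one[of "1 - p n"] by simp
      then have "ln (1 - p n) / q n \<le> - p n / q n" using elim by (intro divide_right_mono) auto
      then show ?case by simp
    qed
  qed
  have "(\<lambda>n. free_energy (q n) (V n) (H n) (p n / (1 - p n) / q n) + ln (1 - p n) / q n) \<longlonglongrightarrow>
      x + (1 - 1 / real k) * x ^ k + - ?c"
    by (intro tendsto_add fe ln_lim)
  moreover have "eventually (\<lambda>n. free_energy (q n) (V n) (H n) (p n / (1 - p n) / q n) + ln (1 - p n) / q n =
     ln (\<Sum>G\<in>{G. G \<subseteq> V n \<and> avoids (H n) G}. p n ^ card G * (1 - p n) ^ (card (V n) - card G))
      / (q n * real (card (V n)))) sequentially"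
    using sparse_facts p_pos p_half
  proof eventually_elim
    case (elim n)
    have N: "real (card (V n)) > 0" using elim by (simp add: card_gt_0_iff)
    have Z: "wt (p n / (1 - p n)) (V n) (H n) {} \<ge> 1" using elim by (intro wt_ge_1) auto
    have "ln (\<Sum>G\<in>{G. G \<subseteq> V n \<and> avoids (H n) G}. p n ^ card G * (1 - p n) ^ (card (V n) - card G))
      = ln ((1 - p n) ^ card (V n) * wt (p n / (1 - p n)) (V n) (H n) {})"
      using elim by (subst bernoulli_sum_eq_wt) auto
    also have "\<dots> = real (card (V n)) * ln (1 - p n) + ln (wt (p n / (1 - p n)) (V n) (H n) {})"
      using elim Z by (simp add: ln_mult ln_realpow)
    finally show ?case
      using elim N by (simp add: free_energy_def add_divide_distrib)
  qed
  ultimately show ?thesis by (simp add: tendsto_cong)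
qed

text \<open>The partition function is examined at activity \<open>?psi x\<close>, where typical
  sizes are near \<open>x * S\<close>, just above \<open>m\<close>. Sizes below \<open>m\<close> and
  above \<open>y * S\<close> each carry at most a third of it, so sizes in between carry at least a
  third. There the independence ratio is at most the one at \<open>m\<close>, and what remains is a
  binomial sum. Solving for the ratio at \<open>m\<close> gives the free energy at \<open>x\<close>
  minus \<open>y * x^(k-1) + x\<close>, which is the bound on \<open>L\<close>.\<close>

lemma indep_ratio_lower:
  assumes b: "0 < b" and bx: "b < x" and xy: "x < y" and small: "(real k - 1) * y ^ (k - 1) < 1"
    and m: "(\<lambda>n. real (m n) / (q n * real (card (V n)))) \<longlonglongrightarrow> b"
    and L: "L < (1 - 1 / real k) * x ^ k - y * x ^ (k - 1)"
  shows "eventually (\<lambda>n. 0 < indep_ratio (V n) (H n) (m n) \<and>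
      L < ln (indep_ratio (V n) (H n) (m n)) / (q n * real (card (V n)))) sequentially"
proof -
  let ?psi = "\<lambda>t::real. t * exp (t ^ (k - 1))" and ?Phi = "\<lambda>t::real. t + (1 - 1 / real k) * t ^ k"
  let ?fe = "\<lambda>n. free_energy (q n) (V n) (H n)"
  define S where "S n = q n * real (card (V n))" for n
  have k1: "1 \<le> k" using k_ge_3 by simp
  have x0: "0 < x" and y0: "0 < y" using b bx xy by auto
  have small': "(real k - 1) * t ^ (k - 1) < 1" if "0 \<le> t" "t \<le> y" for t
  proof -
    have "(real k - 1) * t ^ (k - 1) \<le> (real k - 1) * y ^ (k - 1)"
      using that k_ge_3 by (intro mult_left_mono power_mono) auto
    then show ?thesis using small by linarith
  qed
  have fe: "(\<lambda>n. ?fe n (?psi t)) \<longlonglongrightarrow> ?Phi t" if "0 \<le> t" "t \<le> y" for t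
    using free_energy_tendsto[of t] small'[OF that] that by simp
  have psi_mono: "?psi s < ?psi t" if "0 < s" "s < t" for s t
    using that k_ge_3 by (intro mult_strict_mono) (auto intro!: power_strict_mono)
  have psi0: "0 < ?psi t" if "0 < t" for t using that by simp
  have S_top: "filterlim S at_top sequentially" using scale_at_top by (simp add: S_def[abs_def])
  have decay: "eventually (\<lambda>n. exp (S n * r n) \<le> 1 / 3) sequentially" if "r \<longlonglongrightarrow> r0" "r0 < 0" for r r0
  proof -
    have "filterlim (\<lambda>n. r n * S n) at_bot sequentially"
      using filterlim_tendsto_neg_mult_at_bot[OF that S_top] .
    then have "((\<lambda>n. exp (r n * S n)) \<longlonglongrightarrow> 0)" by (rule filterlim_compose[OF exp_at_bot])
    then have "eventually (\<lambda>n. exp (r n * S n) < 1 / 3) sequentially" by (intro order_tendstoD) auto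
    then show ?thesis by eventually_elim (simp add: mult.commute)
  qed
  \<comment> \<open>\<open>r1\<close> and \<open>r3\<close> are the exponential rates, per unit of
    \<open>S n\<close>, at which sizes below \<open>m n\<close> and above \<open>y * S n\<close>
    lose against the whole sum at \<open>?psi x\<close>. They come from comparison with the
    activities \<open>?psi b\<close> and \<open>?psi y\<close>, and \<open>tilted_energy_min\<close>
    makes both limits negative.\<close>
  define r1 where "r1 n = real (m n) / S n * ln (?psi x / ?psi b) + ?fe n (?psi b) - ?fe n (?psi x)" for n
  define r3 where "r3 n = ?fe n (?psi y) - ?fe n (?psi x) - y * ln (?psi y / ?psi x)" for n
  have "r1 \<longlonglongrightarrow> b * ln (?psi x / ?psi b) + ?Phi b - ?Phi x"
    unfolding r1_def using m b bx xy by (intro tendsto_intros fe) (auto simp: S_def)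
  moreover have "b * ln (?psi x / ?psi b) + ?Phi b - ?Phi x < 0"
  proof -
    have "ln (?psi x / ?psi b) = ln (?psi x) - ln (?psi b)" using psi0[OF x0] psi0[OF b] by (rule ln_divide_pos)
    moreover have "?Phi b - b * ln (?psi b) < ?Phi x - b * ln (?psi x)"
      using tilted_energy_min[of x b k] x0 b bx k1 by simp
    ultimately show ?thesis by (simp add: right_diff_distrib)
  qed
  ultimately have ev1: "eventually (\<lambda>n. exp (S n * r1 n) \<le> 1 / 3) sequentially" by (rule decay)
  have "r3 \<longlonglongrightarrow> ?Phi y - ?Phi x - y * ln (?psi y / ?psi x)"
    unfolding r3_def using b bx xy by (intro tendsto_intros fe) auto
  moreover have "?Phi y - ?Phi x - y * ln (?psi y / ?psi x) < 0"
  proof -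
    have "ln (?psi y / ?psi x) = ln (?psi y) - ln (?psi x)" using psi0[OF y0] psi0[OF x0] by (rule ln_divide_pos)
    moreover have "?Phi y - y * ln (?psi y) < ?Phi x - y * ln (?psi x)"
      using tilted_energy_min[of x y k] x0 y0 xy k1 by simp
    ultimately show ?thesis by (simp add: right_diff_distrib)
  qed
  ultimately have ev3: "eventually (\<lambda>n. exp (S n * r3 n) \<le> 1 / 3) sequentially" by (rule decay)
  have "(\<lambda>n. ?fe n (?psi x) - y * x ^ (k - 1) - x - ln 3 / S n) \<longlonglongrightarrow> ?Phi x - y * x ^ (k - 1) - x - 0"
    using b bx xy S_top by (intro tendsto_intros fe tendsto_divide_0[OF tendsto_const] filterlim_at_top_imp_at_infinity) auto
  then have ev4: "eventually (\<lambda>n. L < ?fe n (?psi x) - y * x ^ (k - 1) - x - ln 3 / S n) sequentially"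
    using L by (intro order_tendstoD) auto
  have "eventually (\<lambda>n. real (m n) / S n < y) sequentially"
    unfolding S_def using bx xy by (intro order_tendstoD(2)[OF m]) auto
  moreover have Spos: "eventually (\<lambda>n. 0 < S n) sequentially" using S_top by (simp add: filterlim_at_top_dense)
  moreover have "(\<lambda>n. y * q n) \<longlonglongrightarrow> y * 0" by (intro tendsto_intros q_tendsto)
  then have "eventually (\<lambda>n. y * q n < 1) sequentially" by (intro order_tendstoD) auto
  ultimately show ?thesis
    using sparse_facts ev1 ev3 ev4
  proof eventually_elim
    case (elim n)
    define N where "N = card (V n)"
    have Sn: "S n = q n * real N" by (simp add: S_def N_def)
    have S0: "S n > 0" using elim by simp
    have qn: "q n > 0" using elim by simp
    define i where "i j = real (indep_count (V n) (H n) j)" for j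
    define P where "P = indep_ratio (V n) (H n)"
    define Z where "Z l = wt l (V n) (H n) {}" for l
    have Zsum: "Z l = (\<Sum>j\<le>N. i j * l ^ j)" for l
      unfolding Z_def i_def N_def using elim by (intro wt_eq_sum_indep_count) simp
    have Zexp: "Z (?psi t * q n) = exp (S n * ?fe n (?psi t))" if "0 \<le> t" for t
    proof -
      have "1 \<le> Z (?psi t * q n)" unfolding Z_def using elim that by (intro wt_ge_1) auto
      moreover have "0 < real (card (V n))" using elim by (simp add: card_gt_0_iff)
      ultimately show ?thesis using qn unfolding free_energy_def Z_def S_def by simp
    qed
    define lb where "lb = ?psi b * q n"
    define lx where "lx = ?psi x * q n"
    define ly where "ly = ?psi y * q n"
    have lpos: "0 < lb" "0 < lx" "0 < ly" using b x0 y0 qn by (auto simp: lb_def lx_def ly_def)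
    have lle: "lb \<le> lx" "lx \<le> ly"
      unfolding lb_def lx_def ly_def using psi_mono[OF b bx] psi_mono[OF x0 xy] qn by (auto intro!: mult_right_mono less_imp_le)
    have i0: "0 \<le> i j" for j by (simp add: i_def)
    have mN: "m n \<le> N"
    proof -
      have "real (m n) < y * S n" using elim S0 by (simp add: field_simps)
      also have "\<dots> = (y * q n) * real N" by (simp add: Sn)
      also have "\<dots> \<le> 1 * real N" using elim by (intro mult_right_mono) auto
      finally show ?thesis by simp
    qed
    define J1 where "J1 = {j. j \<le> N \<and> j < m n}"
    define J2 where "J2 = {j. j \<le> N \<and> m n \<le> j \<and> real j \<le> y * S n}"
    define J3 where "J3 = {j. j \<le> N \<and> y * S n < real j}"
    have finJ: "finite J1" "finite J2" "finite J3" by (auto simp: J1_def J2_def J3_def)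
    have un: "(\<Sum>j\<in>A \<union> B. i j * lx ^ j) \<le> (\<Sum>j\<in>A. i j * lx ^ j) + (\<Sum>j\<in>B. i j * lx ^ j)"
      if "finite A" "finite B" for A B
    proof -
      have "0 \<le> (\<Sum>j\<in>A \<inter> B. i j * lx ^ j)" using i0 lpos by (intro sum_nonneg) auto
      then show ?thesis using sum.union_inter[OF that, of "\<lambda>j. i j * lx ^ j"] by linarith
    qed
    have "Z lx \<le> (\<Sum>j\<in>J1 \<union> J2 \<union> J3. i j * lx ^ j)"
      unfolding Zsum using finJ i0 lpos by (intro sum_mono2) (auto simp: J1_def J2_def J3_def)
    also have "\<dots> \<le> (\<Sum>j\<in>J1 \<union> J2. i j * lx ^ j) + (\<Sum>j\<in>J3. i j * lx ^ j)"
      using finJ by (intro un) auto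
    also have "(\<Sum>j\<in>J1 \<union> J2. i j * lx ^ j) \<le> (\<Sum>j\<in>J1. i j * lx ^ j) + (\<Sum>j\<in>J2. i j * lx ^ j)"
      using finJ by (intro un) auto
    finally have Zle: "Z lx \<le> (\<Sum>j\<in>J1. i j * lx ^ j) + (\<Sum>j\<in>J2. i j * lx ^ j) + (\<Sum>j\<in>J3. i j * lx ^ j)"
      by simp
    have T1: "(\<Sum>j\<in>J1. i j * lx ^ j) \<le> 1 / 3 * Z lx"
    proof -
      have "(\<Sum>j\<in>J1. i j * lx ^ j) \<le> (\<Sum>j\<in>J1. (lx / lb) ^ m n * (i j * lb ^ j))"
      proof (rule sum_mono)
        fix j assume j: "j \<in> J1"
        \<comment> \<open>Changing the activity from \<open>lx\<close> to \<open>lb\<close> costs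
          \<open>(lx / lb) ^ j\<close>, which is largest at the cut-off \<open>m n\<close> because
          \<open>lx \<ge> lb\<close>. The other tail uses the reverse comparison with
          \<open>ly\<close>.\<close>
        have "lx ^ j = (lx / lb) ^ j * lb ^ j" using lpos by (simp add: power_divide)
        also have "\<dots> \<le> (lx / lb) ^ m n * lb ^ j"
          using lpos lle j by (intro mult_right_mono power_increasing) (auto simp: J1_def)
        finally show "i j * lx ^ j \<le> (lx / lb) ^ m n * (i j * lb ^ j)"
          using i0[of j] by (metis mult.left_commute mult_left_mono)
      qed
      also have "\<dots> = (lx / lb) ^ m n * (\<Sum>j\<in>J1. i j * lb ^ j)" by (rule sum_distrib_left[symmetric])
      also have "\<dots> \<le> (lx / lb) ^ m n * Z lb"
        unfolding Zsum using lpos i0 by (intro mult_left_mono sum_mono2) (auto simp: J1_def)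
      also have "(lx / lb) ^ m n = exp (real (m n) * ln (?psi x / ?psi b))"
      proof -
        have "lx / lb = ?psi x / ?psi b" using qn by (simp add: lx_def lb_def)
        moreover have "0 < ?psi x / ?psi b" using x0 b by simp
        ultimately show ?thesis by (simp only: exp_of_nat_mult exp_ln)
      qed
      also have "exp (real (m n) * ln (?psi x / ?psi b)) * Z lb = exp (S n * r1 n) * Z lx"
        unfolding lb_def lx_def Zexp[OF less_imp_le[OF b]] Zexp[OF less_imp_le[OF x0]] exp_add[symmetric] r1_def
        using S0 by (simp add: algebra_simps)
      also have "\<dots> \<le> 1 / 3 * Z lx"
        using elim lpos by (intro mult_right_mono) (auto simp: Z_def intro!: wt_nonneg)
      finally show ?thesis .
    qed
    have T3: "(\<Sum>j\<in>J3. i j * lx ^ j) \<le> 1 / 3 * Z lx"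
    proof -
      define a where "a = ln (?psi y / ?psi x)"
      have ea: "ly = lx * exp a"
      proof -
        have "0 < ?psi y / ?psi x" using x0 y0 by simp
        then have "exp a = ?psi y / ?psi x" unfolding a_def by (rule exp_ln)
        then show ?thesis using x0 by (simp add: ly_def lx_def)
      qed
      have a0: "0 \<le> a"
        unfolding a_def using psi_mono[OF x0 xy] x0 by (intro ln_ge_zero) (simp add: divide_simps)
      have "(\<Sum>j\<in>J3. i j * lx ^ j) \<le> (\<Sum>j\<in>J3. exp (- (y * S n * a)) * (i j * ly ^ j))"
      proof (rule sum_mono)
        fix j assume j: "j \<in> J3"
        have "lx ^ j = exp (- (real j * a)) * ly ^ j"
          by (simp add: ea power_mult_distrib exp_of_nat_mult[symmetric] exp_minus)
        also have "\<dots> \<le> exp (- (y * S n * a)) * ly ^ j"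
          using lpos j a0 by (intro mult_right_mono) (auto simp: J3_def intro!: mult_right_mono)
        finally show "i j * lx ^ j \<le> exp (- (y * S n * a)) * (i j * ly ^ j)"
          using i0[of j] by (metis mult.left_commute mult_left_mono)
      qed
      also have "\<dots> = exp (- (y * S n * a)) * (\<Sum>j\<in>J3. i j * ly ^ j)" by (rule sum_distrib_left[symmetric])
      also have "\<dots> \<le> exp (- (y * S n * a)) * Z ly"
        unfolding Zsum using lpos i0 by (intro mult_left_mono sum_mono2) (auto simp: J3_def)
      also have "\<dots> = exp (S n * r3 n) * Z lx"
        unfolding ly_def lx_def Zexp[OF less_imp_le[OF y0]] Zexp[OF less_imp_le[OF x0]] exp_add[symmetric] r3_def a_def
        by (simp add: algebra_simps)
      also have "\<dots> \<le> 1 / 3 * Z lx"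
        using elim lpos by (intro mult_right_mono) (auto simp: Z_def intro!: wt_nonneg)
      finally show ?thesis .
    qed
    have T2: "(\<Sum>j\<in>J2. i j * lx ^ j) \<le> P (m n) * exp (S n * (y * x ^ (k - 1) + x))"
    proof -
      have P0: "0 \<le> P (m n)" by (simp add: P_def indep_ratio_def)
      have "(\<Sum>j\<in>J2. i j * lx ^ j) \<le> (\<Sum>j\<in>J2. P (m n) * (exp (y * S n * x ^ (k - 1)) * (real (N choose j) * (x * q n) ^ j)))"
      proof (rule sum_mono)
        fix j assume j: "j \<in> J2"
        then have jN: "j \<le> N" by (simp add: J2_def)
        have "P j \<le> P (m n)"
          unfolding P_def using elim j by (intro indep_ratio_antimono) (auto simp: J2_def N_def)
        moreover have "i j = P j * real (N choose j)"
          using jN by (simp add: P_def indep_ratio_def i_def N_def)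
        ultimately have ij: "i j \<le> P (m n) * real (N choose j)" by (simp add: mult_right_mono)
        \<comment> \<open>Only the exponential part of the activity is frozen at the largest size
          \<open>y * S n\<close>; the part \<open>(x * q n) ^ j\<close> is left to be summed by the
          binomial theorem.\<close>
        have "lx ^ j = exp (real j * x ^ (k - 1)) * (x * q n) ^ j"
          by (simp add: lx_def power_mult_distrib exp_of_nat_mult[symmetric])
        also have "\<dots> \<le> exp (y * S n * x ^ (k - 1)) * (x * q n) ^ j"
          using j x0 qn by (intro mult_right_mono) (auto simp: J2_def intro!: mult_right_mono)
        finally have "i j * lx ^ j \<le> (P (m n) * real (N choose j)) * (exp (y * S n * x ^ (k - 1)) * (x * q n) ^ j)"
          using ij P0 lpos by (intro mult_mono) auto
        then show "i j * lx ^ j \<le> P (m n) * (exp (y * S n * x ^ (k - 1)) * (real (N choose j) * (x * q n) ^ j))"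
          by (simp only: mult_ac)
      qed
      also have "\<dots> \<le> (\<Sum>j\<le>N. P (m n) * (exp (y * S n * x ^ (k - 1)) * (real (N choose j) * (x * q n) ^ j)))"
        using P0 x0 qn by (intro sum_mono2) (auto simp: J2_def)
      also have "\<dots> = P (m n) * (exp (y * S n * x ^ (k - 1)) * (\<Sum>j\<le>N. real (N choose j) * (x * q n) ^ j))"
        by (simp only: sum_distrib_left)
      also have "(\<Sum>j\<le>N. real (N choose j) * (x * q n) ^ j) = (x * q n + 1) ^ N"
        by (subst binomial_ring) simp
      also have "P (m n) * (exp (y * S n * x ^ (k - 1)) * (x * q n + 1) ^ N) \<le> P (m n) * (exp (y * S n * x ^ (k - 1)) * exp (x * q n) ^ N)"
        using P0 x0 qn exp_ge_add_one_self[of "x * q n"] by (intro mult_left_mono power_mono) (auto simp: add.commute)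
      also have "exp (x * q n) ^ N = exp (S n * x)" by (simp add: exp_of_nat_mult[symmetric] Sn mult_ac)
      also have "exp (y * S n * x ^ (k - 1)) * exp (S n * x) = exp (S n * (y * x ^ (k - 1) + x))"
        by (simp add: exp_add[symmetric] algebra_simps)
      finally show ?thesis .
    qed
    have "Z lx \<le> 3 * (P (m n) * exp (S n * (y * x ^ (k - 1) + x)))" using Zle T1 T2 T3 by linarith
    then have main: "exp (S n * ?fe n (?psi x)) \<le> 3 * (P (m n) * exp (S n * (y * x ^ (k - 1) + x)))"
      using Zexp[OF less_imp_le[OF x0]] by (simp add: lx_def)
    then have Ppos: "0 < P (m n)"
      by (smt (verit) exp_gt_zero mult_nonneg_nonneg zero_less_mult_iff mult_le_0_iff)
    have "S n * ?fe n (?psi x) \<le> ln (3 * (P (m n) * exp (S n * (y * x ^ (k - 1) + x))))"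
      using main Ppos by (subst ln_ge_iff) auto
    also have "\<dots> = ln 3 + ln (P (m n)) + S n * (y * x ^ (k - 1) + x)"
      using Ppos by (simp add: ln_mult)
    finally have "S n * (?fe n (?psi x) - y * x ^ (k - 1) - x - ln 3 / S n) \<le> ln (P (m n))"
      using S0 by (simp add: algebra_simps)
    then have "?fe n (?psi x) - y * x ^ (k - 1) - x - ln 3 / S n \<le> ln (P (m n)) / S n"
      using S0 by (simp add: pos_le_divide_eq mult.commute)
    then have "L < ln (P (m n)) / S n" using elim by linarith
    then show ?case using Ppos by (simp add: P_def S_def)
  qed
qed

text \<open>For the upper bound a single term, \<open>j = m\<close>, is compared with the whole
  partition function at activity \<open>b * exp (b^(k-1))\<close>, whose typical size matches
  \<open>m\<close>. The lower bound is \<open>indep_ratio_lower\<close> with \<open>x\<close> and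
  \<open>y\<close> close to \<open>b\<close>.\<close>

theorem ln_indep_ratio_tendsto:
  assumes b: "0 < b" and small: "(real k - 1) * b ^ (k - 1) < 1"
    and m: "(\<lambda>n. real (m n) / (q n * real (card (V n)))) \<longlonglongrightarrow> b"
  shows "(\<lambda>n. ln (indep_ratio (V n) (H n) (m n)) / (q n * real (card (V n)))) \<longlonglongrightarrow> - (b ^ k / real k)"
proof -
  define S where "S n = q n * real (card (V n))" for n
  have S_top: "filterlim S at_top sequentially" using scale_at_top by (simp add: S_def[abs_def])
  have mS: "(\<lambda>n. real (m n) / S n) \<longlonglongrightarrow> b" using m by (simp add: S_def)
  have kk: "b * b ^ (k - 1) = b ^ k" using k_ge_3 by (simp add: power_eq_if)
  have lower: "eventually (\<lambda>n. 0 < indep_ratio (V n) (H n) (m n) \<and>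
      L < ln (indep_ratio (V n) (H n) (m n)) / S n) sequentially" if L: "L < - (b ^ k / real k)" for L
  proof -
    \<comment> \<open>The choice is \<open>x = b + t\<close>, \<open>y = b + 2 * t\<close>. As
      \<open>t\<close> tends to 0 the bound tends to
      \<open>(1 - 1/k) * b^k - b^k = - b^k / k\<close>, and the smallness condition at
      \<open>y\<close> holds for small \<open>t\<close> because it is strict at
      \<open>b\<close>.\<close>
    have "((\<lambda>t. (1 - 1 / real k) * (b + t) ^ k - (b + 2 * t) * (b + t) ^ (k - 1)) \<longlongrightarrow>
        (1 - 1 / real k) * (b + 0) ^ k - (b + 2 * 0) * (b + 0) ^ (k - 1)) (at_right 0)"
      by (intro tendsto_intros)
    moreover have "(1 - 1 / real k) * (b + 0) ^ k - (b + 2 * 0) * (b + 0) ^ (k - 1) = - (b ^ k / real k)"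
      using kk by (simp add: left_diff_distrib)
    ultimately have "eventually (\<lambda>t. L < (1 - 1 / real k) * (b + t) ^ k - (b + 2 * t) * (b + t) ^ (k - 1)) (at_right 0)"
      using L by (intro order_tendstoD) auto
    moreover have "((\<lambda>t. (real k - 1) * (b + 2 * t) ^ (k - 1)) \<longlongrightarrow> (real k - 1) * (b + 2 * 0) ^ (k - 1)) (at_right 0)"
      by (intro tendsto_intros)
    then have "eventually (\<lambda>t. (real k - 1) * (b + 2 * t) ^ (k - 1) < 1) (at_right 0)"
      using small by (intro order_tendstoD) auto
    ultimately have "eventually (\<lambda>t. 0 < t \<and> L < (1 - 1 / real k) * (b + t) ^ k - (b + 2 * t) * (b + t) ^ (k - 1) \<and>
        (real k - 1) * (b + 2 * t) ^ (k - 1) < 1) (at_right 0)"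
      by (intro eventually_conj eventually_at_right_less)
    then obtain t where "0 < t" "L < (1 - 1 / real k) * (b + t) ^ k - (b + 2 * t) * (b + t) ^ (k - 1)"
        "(real k - 1) * (b + 2 * t) ^ (k - 1) < 1"
      using eventually_happens trivial_limit_at_right_real by blast
    then show ?thesis
      unfolding S_def using b by (intro indep_ratio_lower[of b "b + t" "b + 2 * t"] m) auto
  qed
  let ?c = "b * exp (b ^ (k - 1))"
  have c0: "0 < ?c" using b by simp
  have Spos: "eventually (\<lambda>n. 0 < S n) sequentially" using S_top by (simp add: filterlim_at_top_dense)
  have "filterlim (\<lambda>n. real (m n) / S n * S n) at_top sequentially"
    by (rule filterlim_tendsto_pos_mult_at_top[OF mS b S_top])
  moreover have "eventually (\<lambda>n. real (m n) / S n * S n = real (m n)) sequentially"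
    using Spos by eventually_elim auto
  ultimately have m_top: "filterlim (\<lambda>n. real (m n)) at_top sequentially"
    by (simp add: filterlim_cong[OF refl refl])
  have mN: "(\<lambda>n. real (m n) / S n * q n) \<longlonglongrightarrow> 0"
    using tendsto_mult[OF mS q_tendsto] by simp
  \<comment> \<open>This is the single-term bound after taking logarithms, using
    \<open>ln_binomial_ge\<close> and dividing by \<open>S n\<close>; the last two summands are the
    Stirling error. In the limit the inner logarithm is
    \<open>ln (?c / b) = b^(k-1)\<close>.\<close>
  define u where "u n = free_energy (q n) (V n) (H n) ?c
      - real (m n) / S n * (ln (?c * (1 - real (m n) / S n * q n) / (real (m n) / S n)) + 1)
      + 1 / S n + ln (real (m n)) / real (m n) * (real (m n) / S n)" for n
  have "((\<lambda>x::real. ln x / x) \<longlongrightarrow> 0) at_top" by (rule ln_x_over_x_tendsto_0)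
  then have lnm: "(\<lambda>n. ln (real (m n)) / real (m n)) \<longlonglongrightarrow> 0" by (rule filterlim_compose[OF _ m_top])
  have "u \<longlonglongrightarrow> (b + (1 - 1 / real k) * b ^ k) - b * (ln (?c * (1 - 0) / b) + 1) + 0 + 0 * b"
    unfolding u_def using b S_top
    by (intro tendsto_intros free_energy_tendsto small mS mN lnm tendsto_divide_0[OF tendsto_const] filterlim_at_top_imp_at_infinity) auto
  moreover have "(b + (1 - 1 / real k) * b ^ k) - b * (ln (?c * (1 - 0) / b) + 1) + 0 + 0 * b = - (b ^ k / real k)"
    using b kk by (simp add: algebra_simps)
  ultimately have u_lim: "u \<longlonglongrightarrow> - (b ^ k / real k)" by (simp only:)
  have "eventually (\<lambda>n. real (m n) / S n * q n < 1) sequentially" using mN by (intro order_tendstoD) auto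
  moreover have "eventually (\<lambda>n. 1 < real (m n)) sequentially"
    using m_top[unfolded filterlim_at_top_dense] by blast
  \<comment> \<open>The lower bound, taken at an arbitrary level, supplies the positivity needed to
    split the logarithm of the product in the upper bound.\<close>
  moreover have "eventually (\<lambda>n. 0 < indep_ratio (V n) (H n) (m n)) sequentially"
    using lower[of "- (b ^ k / real k) - 1"] by (auto elim: eventually_mono)
  ultimately have upper: "eventually (\<lambda>n. ln (indep_ratio (V n) (H n) (m n)) / S n \<le> u n) sequentially"
    using sparse_facts Spos
  proof eventually_elim
    case (elim n)
    define N where "N = card (V n)"
    define M where "M = m n"
    define P where "P = indep_ratio (V n) (H n) M"
    define l where "l = ?c * q n"
    have P0: "0 < P" using elim by (simp add: P_def M_def)
    have S0: "0 < S n" and q0: "0 < q n" using elim by auto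
    have Sn: "S n = q n * real N" by (simp add: S_def N_def)
    have M1: "1 < real M" using elim by (simp add: M_def)
    have N0: "0 < real N" using elim by (simp add: N_def card_gt_0_iff)
    have l0: "0 < l" using c0 q0 by (simp add: l_def)
    have MN': "real M / S n * q n = real M / real N" using q0 by (simp add: Sn)
    have "real M / real N < 1" using elim(1) MN' unfolding M_def by linarith
    then have MN: "M < N" using N0 by simp
    have Z: "1 \<le> wt l (V n) (H n) {}" using elim l0 by (intro wt_ge_1) auto
    have "P * real (N choose M) * l ^ M = real (indep_count (V n) (H n) M) * l ^ M"
      using MN by (simp add: P_def indep_ratio_def N_def)
    also have "\<dots> \<le> (\<Sum>j\<le>N. real (indep_count (V n) (H n) j) * l ^ j)"
      using MN l0 by (intro member_le_sum) auto
    also have "\<dots> = wt l (V n) (H n) {}"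
      unfolding N_def using elim by (intro wt_eq_sum_indep_count[symmetric]) simp
    finally have "P * real (N choose M) * l ^ M \<le> wt l (V n) (H n) {}" .
    moreover have C0: "0 < real (N choose M)" using MN by simp
    ultimately have "ln (P * real (N choose M) * l ^ M) \<le> ln (wt l (V n) (H n) {})"
      using P0 l0 Z by (subst ln_le_cancel_iff) auto
    then have "ln P + ln (real (N choose M)) + real M * ln l \<le> ln (wt l (V n) (H n) {})"
      using P0 l0 C0 by (simp add: ln_mult ln_realpow)
    moreover have "real M * (ln (real (N - M)) - ln (real M) + 1) - 1 - ln (real M) \<le> ln (real (N choose M))"
      using M1 MN by (intro ln_binomial_ge) auto
    moreover have "ln (wt l (V n) (H n) {}) = S n * free_energy (q n) (V n) (H n) ?c"
      using q0 N0 by (simp add: free_energy_def l_def S_def N_def)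
    moreover define A where "A = ln (?c * (1 - real M / S n * q n) / (real M / S n))"
    have "ln l + ln (real (N - M)) - ln (real M) = ln (?c * (1 - real M / S n * q n) / (real M / S n))"
    proof -
      have "l * real (N - M) / real M = ?c * (1 - real M / S n * q n) / (real M / S n)"
        unfolding MN' l_def Sn using MN M1 q0 N0 by (simp add: of_nat_diff field_simps)
      moreover have "ln (l * real (N - M) / real M) = ln l + ln (real (N - M)) - ln (real M)"
        using l0 MN M1 by (simp add: ln_mult ln_div)
      ultimately show ?thesis by (simp only:)
    qed
    then have "real M * A = real M * ln l + real M * ln (real (N - M)) - real M * ln (real M)"
      unfolding A_def[symmetric] by (metis distrib_left right_diff_distrib)
    ultimately have "ln P \<le> S n * free_energy (q n) (V n) (H n) ?c - real M * (A + 1) + 1 + ln (real M)"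
      unfolding distrib_left right_diff_distrib by linarith
    then have "ln P \<le> S n * free_energy (q n) (V n) (H n) ?c
        - real M * (ln (?c * (1 - real M / S n * q n) / (real M / S n)) + 1) + 1 + ln (real M)"
      by (simp only: A_def)
    then have "ln P / S n \<le> (S n * free_energy (q n) (V n) (H n) ?c
        - real M * (ln (?c * (1 - real M / S n * q n) / (real M / S n)) + 1) + 1 + ln (real M)) / S n"
      using S0 by (intro divide_right_mono) auto
    also have "\<dots> = u n"
      unfolding u_def M_def[symmetric] using S0 M1 by (simp add: add_divide_distrib diff_divide_distrib)
    finally show ?case by (simp add: P_def M_def)
  qed
  show ?thesis
    unfolding S_def[symmetric]
  proof (rule order_tendstoI)
    fix L assume "L < - (b ^ k / real k)"
    from lower[OF this] show "eventually (\<lambda>n. L < ln (indep_ratio (V n) (H n) (m n)) / S n) sequentially"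
      by eventually_elim auto
  next
    fix U assume "- (b ^ k / real k) < U"
    then have "eventually (\<lambda>n. u n < U) sequentially" using u_lim by (intro order_tendstoD)
    then show "eventually (\<lambda>n. ln (indep_ratio (V n) (H n) (m n)) / S n < U) sequentially"
      using upper by eventually_elim linarith
  qed
qed

end

section \<open>The hypergraph of copies\<close>

locale balanced_graph =
  fixes V :: "'a set" and E :: "'a set set"
  assumes simple: "simple_graph V E" and balanced: "strictly_2_balanced V E"
begin

section \<open>Structure of strictly 2-balanced graphs\<close>

lemma finite_V: "finite V"
  using simple by (simp add: simple_graph_def)

lemma edgeD: "e \<in> E \<Longrightarrow> e \<subseteq> V" "e \<in> E \<Longrightarrow> card e = 2"
  using simple by (auto simp: simple_graph_def)

lemma finite_edge: "e \<in> E \<Longrightarrow> finite e"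
  by (rule finite_subset[OF edgeD(1) finite_V])

lemma finite_E: "finite E"
  by (rule finite_subset[of _ "Pow V"]) (use edgeD finite_V in auto)

lemma card_E_ge_3: "3 \<le> card E"
  using balanced by (simp add: strictly_2_balanced_def)

lemma card_V_ge_3: "3 \<le> card V"
proof (rule ccontr)
  assume c: "\<not> 3 \<le> card V"
  have "e = V" if "e \<in> E" for e
    using edgeD[OF that] c finite_V by (intro card_subset_eq) (auto dest: card_mono[OF finite_V])
  then have "E \<subseteq> {V}" by auto
  then have "card E \<le> card {V}" by (intro card_mono) auto
  then show False using card_E_ge_3 by simp
qed

lemma d2_less:
  assumes F: "subgraph FV FE V E" "3 \<le> card FV" "FV \<noteq> V \<or> FE \<noteq> E"
  shows "d2 FV FE < d2 V E"
proof -
  let ?A = "{d2 FV FE | FV FE. subgraph FV FE V E \<and> card FV \<ge> 3}"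
  have "?A \<subseteq> (\<lambda>(X, Y). d2 X Y) ` (Pow V \<times> Pow E)" by (auto simp: subgraph_def)
  then have "finite ?A" by (rule finite_subset) (use finite_V finite_E in auto)
  then have "d2 FV FE \<le> m2 V E" unfolding m2_def using F by (intro Max_ge) auto
  moreover have "d2 FV FE \<noteq> m2 V E" using F balanced by (auto simp: strictly_2_balanced_def)
  moreover have "d2 V E = m2 V E" using balanced by (simp add: strictly_2_balanced_def)
  ultimately show ?thesis by simp
qed

text \<open>Two edges sharing a vertex have 2-density 1, so \<open>H\<close> has density above 1,
  which is the claim. Otherwise \<open>H\<close> is a matching, possibly with isolated vertices, of
  density at most 1/2; this contradicts the density 1/2 of two disjoint edges.\<close>

lemma card_V_le_card_E: "card V \<le> card E"
proof -
  have h: "real (card V) \<ge> 3" "real (card E) \<ge> 3" using card_V_ge_3 card_E_ge_3 by auto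
  have pair: "d2 (e \<union> e') {e, e'} < d2 V E" if "e \<in> E" "e' \<in> E" "e \<noteq> e'" "3 \<le> card (e \<union> e')" for e e'
  proof (rule d2_less)
    show "subgraph (e \<union> e') {e, e'} V E" using that edgeD by (auto simp: subgraph_def)
    have "card {e, e'} = 2" using that by simp
    then show "e \<union> e' \<noteq> V \<or> {e, e'} \<noteq> E" using card_E_ge_3 by auto
  qed (use that in auto)
  show ?thesis
  proof (cases "\<exists>e\<in>E. \<exists>e'\<in>E. e \<noteq> e' \<and> e \<inter> e' \<noteq> {}")
    case True
    then obtain e e' where e: "e \<in> E" "e' \<in> E" "e \<noteq> e'" "e \<inter> e' \<noteq> {}" by auto
    have fin: "finite e" "finite e'" using e finite_edge by auto
    have "card (e \<inter> e') \<noteq> 0" using e fin by simp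
    moreover have "card (e \<inter> e') < 2"
    proof (rule ccontr)
      assume "\<not> card (e \<inter> e') < 2"
      then have "card (e \<inter> e') = 2" using card_mono[of e "e \<inter> e'"] fin edgeD[OF e(1)] by auto
      then have "e \<inter> e' = e" "e \<inter> e' = e'"
        using card_subset_eq[OF fin(1), of "e \<inter> e'"] card_subset_eq[OF fin(2), of "e \<inter> e'"]
          edgeD(2)[OF e(1)] edgeD(2)[OF e(2)] by auto
      then show False using e by auto
    qed
    ultimately have "card (e \<inter> e') = 1" by linarith
    then have c: "card (e \<union> e') = 3" using card_Un_Int[OF fin] edgeD e by simp
    then have "d2 (e \<union> e') {e, e'} = 1" using e by (simp add: d2_def)
    then have "1 < d2 V E" using pair[OF e(1-3)] c by simp
    then show ?thesis using h by (simp add: d2_def divide_simps)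
  next
    case False
    have disj: "pairwise disjnt E" using False by (auto simp: pairwise_def disjnt_def)
    have "card (\<Union>E) = (\<Sum>e\<in>E. card e)"
      using disj finite_edge by (intro card_Union_disjoint)
    also have "\<dots> = 2 * card E" using edgeD by simp
    finally have "2 * card E \<le> card V" using card_mono[OF finite_V, of "\<Union>E"] edgeD by auto
    then have h2: "2 * real (card E) \<le> real (card V)" by linarith
    have "\<exists>e e'. e \<in> E \<and> e' \<in> E \<and> e \<noteq> e'"
    proof (rule ccontr)
      assume "\<not> ?thesis"
      then have "card E \<le> 1" using finite_E by (auto simp: card_le_Suc0_iff_eq)
      then show False using card_E_ge_3 by simp
    qed
    then obtain e e' where e: "e \<in> E" "e' \<in> E" "e \<noteq> e'" by auto
    then have "e \<inter> e' = {}" using False by auto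
    moreover have "finite e" "finite e'" using e finite_edge by auto
    ultimately have c: "card (e \<union> e') = 4" using edgeD e by (simp add: card_Un_disjoint)
    then have "d2 (e \<union> e') {e, e'} = 1 / 2" using e by (simp add: d2_def)
    then have "1 / 2 < d2 V E" using pair[OF e] c by simp
    then show ?thesis using h h2 by (simp add: d2_def field_simps)
  qed
qed

text \<open>Every vertex lies on two edges at least. Otherwise deleting a vertex \<open>x\<close>
  that meets only \<open>e\<close>, or no edge at all, together with \<open>e\<close> would leave
  density at least \<open>(k-2)/(h-3)\<close>, which exceeds \<open>(k-1)/(h-2)\<close> because
  \<open>h \<le> k\<close>. The case of three vertices is separate, since the 2-density needs three
  vertices to remain.\<close>

lemma Union_remove_edge:
  assumes e: "e \<in> E"
  shows "\<Union>(E - {e}) = V"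
proof (rule ccontr)
  assume "\<Union>(E - {e}) \<noteq> V"
  moreover have "\<Union>(E - {e}) \<subseteq> V" using edgeD by auto
  ultimately have "\<Union>(E - {e}) \<subset> V" by (rule psubsetI[rotated])
  then obtain x where x: "x \<in> V" "x \<notin> \<Union>(E - {e})" by (rule psubset_imp_ex_mem[THEN exE]) blast
  have ce: "card (E - {e}) = card E - 1" using e finite_E by simp
  have cv: "card (V - {x}) = card V - 1" using x finite_V by simp
  show False
  proof (cases "card V = 3")
    case True
    have "e' = V - {x}" if "e' \<in> E - {e}" for e'
    proof (rule card_subset_eq)
      show "card e' = card (V - {x})" using True cv edgeD that by simp
    qed (use finite_V edgeD that x in auto)
    then have "E - {e} \<subseteq> {V - {x}}" by auto
    then have "card (E - {e}) \<le> card {V - {x}}" by (intro card_mono) auto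
    then show False using ce card_E_ge_3 by simp
  next
    case False
    then have h4: "4 \<le> card V" using card_V_ge_3 by simp
    have "d2 (V - {x}) (E - {e}) < d2 V E"
    proof (rule d2_less)
      show "subgraph (V - {x}) (E - {e}) V E" using x edgeD by (auto simp: subgraph_def)
    qed (use h4 cv x in auto)
    then have "(real (card E) - 2) / (real (card V) - 3) < (real (card E) - 1) / (real (card V) - 2)"
      unfolding d2_def ce cv using h4 card_E_ge_3 by (simp add: of_nat_diff)
    then have "(real (card E) - 2) * (real (card V) - 2) < (real (card E) - 1) * (real (card V) - 3)"
      using h4 by (simp add: divide_simps)
    moreover have "real (card V) \<le> real (card E)" using card_V_le_card_E by simp
    ultimately show False by (simp add: algebra_simps)
  qed
qed

lemma Union_E: "\<Union>E = V"
proof -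
  obtain e where "e \<in> E" using card_E_ge_3 by (metis card.empty ex_in_conv not_numeral_le_zero)
  then show ?thesis using Union_remove_edge[of e] edgeD by auto
qed

text \<open>Strict balance in cross-multiplied form, applied to the graph spanned by
  \<open>F\<close>; two distinct edges already span three vertices. The strictness later makes every
  codegree term vanish.\<close>

lemma sub_edge_density:
  assumes F: "F \<subseteq> E" "2 \<le> card F" "card F < card E"
  shows "(real (card F) - 1) * (real (card V) - 2) < (real (card E) - 1) * (real (card (\<Union>F)) - 2)"
    and "card (\<Union>F) \<le> card V"
proof -
  have UF: "\<Union>F \<subseteq> V" using F edgeD by auto
  then show "card (\<Union>F) \<le> card V" using finite_V by (intro card_mono)
  have finU: "finite (\<Union>F)" by (rule finite_subset[OF UF finite_V])
  have "3 \<le> card (\<Union>F)"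
  proof (rule ccontr)
    assume c: "\<not> 3 \<le> card (\<Union>F)"
    have "e = \<Union>F" if "e \<in> F" for e
    proof (rule card_subset_eq[OF finU])
      have "card e = 2" using that F edgeD by auto
      moreover have "card e \<le> card (\<Union>F)" using that finU by (intro card_mono) auto
      ultimately show "card e = card (\<Union>F)" using c by simp
    qed (use that in auto)
    then have "F \<subseteq> {\<Union>F}" by auto
    then have "card F \<le> card {\<Union>F}" by (intro card_mono) auto
    then show False using F by simp
  qed
  moreover have "d2 (\<Union>F) F < d2 V E"
    using UF F \<open>3 \<le> card (\<Union>F)\<close> by (intro d2_less) (auto simp: subgraph_def)
  ultimately show "(real (card F) - 1) * (real (card V) - 2) < (real (card E) - 1) * (real (card (\<Union>F)) - 2)"
    using card_V_ge_3 by (simp add: d2_def divide_simps)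
qed

text \<open>Extensional functions, so that embeddings are determined by their values on
  \<open>V\<close> and can be counted.\<close>

definition emb :: "nat \<Rightarrow> ('a \<Rightarrow> nat) set" where
  "emb n = {\<phi> \<in> V \<rightarrow>\<^sub>E {..<n}. inj_on \<phi> V}"

definition copy_edges :: "('a \<Rightarrow> nat) \<Rightarrow> nat set set" where
  "copy_edges \<phi> = (\<lambda>e. \<phi> ` e) ` E"

text \<open>A copy is recorded by its edge set alone. Nothing is lost: \<open>H\<close> has no
  isolated vertices, so the edges determine the vertex set
  (\<open>Union_copy_edges\<close>).\<close>

definition copy_graph :: "nat \<Rightarrow> nat set set set" where
  "copy_graph n = copy_edges ` emb n"

lemma finite_emb: "finite (emb n)"
  unfolding emb_def using finite_V by (auto intro!: finite_subset[OF _ finite_PiE[of V "\<lambda>_. {..<n}"]])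

lemma finite_copy_graph: "finite (copy_graph n)"
  unfolding copy_graph_def using finite_emb by simp

lemma X_H_eq_0_iff: "X_H V E n G = 0 \<longleftrightarrow> avoids (copy_graph n) G"
proof -
  have "copies V E n G \<subseteq> Pow {..<n} \<times> Pow (Pow {..<n})"
    using edgeD by (fastforce simp: copies_def)
  then have "finite (copies V E n G)" by (rule finite_subset) auto
  then have "X_H V E n G = 0 \<longleftrightarrow> copies V E n G = {}" by (simp add: X_H_def)
  also have "\<dots> \<longleftrightarrow> (\<forall>\<phi>\<in>emb n. \<not> copy_edges \<phi> \<subseteq> G)"
  proof
    assume "copies V E n G = {}"
    then show "\<forall>\<phi>\<in>emb n. \<not> copy_edges \<phi> \<subseteq> G"
      by (auto simp: copies_def emb_def copy_edges_def PiE_def Pi_def)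
  next
    assume a: "\<forall>\<phi>\<in>emb n. \<not> copy_edges \<phi> \<subseteq> G"
    have False if \<phi>: "inj_on \<phi> V" "\<phi> ` V \<subseteq> {..<n}" "(\<lambda>e. \<phi> ` e) ` E \<subseteq> G" for \<phi>
    proof -
      have "restrict \<phi> V \<in> emb n" using \<phi> by (auto simp: emb_def inj_on_def)
      moreover have "restrict \<phi> V ` e = \<phi> ` e" if "e \<in> E" for e
        using edgeD[OF that] by (intro image_cong) auto
      then have "copy_edges (restrict \<phi> V) \<subseteq> G" using \<phi> by (auto simp: copy_edges_def)
      ultimately show False using a by auto
    qed
    then show "copies V E n G = {}" by (auto simp: copies_def)
  qed
  finally show ?thesis by (auto simp: avoids_def copy_graph_def)
qed

section \<open>Embeddings, fibres over copies, and regularity\<close>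

lemma embD:
  assumes "\<phi> \<in> emb n"
  shows "inj_on \<phi> V" "\<phi> \<in> V \<rightarrow>\<^sub>E {..<n}" "\<phi> ` V \<subseteq> {..<n}"
  using assms by (auto simp: emb_def)

lemma inj_on_edge_image:
  assumes "\<phi> \<in> emb n"
  shows "inj_on (\<lambda>e. \<phi> ` e) E"
proof (rule inj_onI)
  fix e e' assume e: "e \<in> E" "e' \<in> E" "\<phi> ` e = \<phi> ` e'"
  show "e = e'" using inj_on_image_eq_iff[OF embD(1)[OF assms] edgeD(1)[OF e(1)] edgeD(1)[OF e(2)]] e(3) by simp
qed

lemma card_copy_edges: "\<phi> \<in> emb n \<Longrightarrow> card (copy_edges \<phi>) = card E"
  unfolding copy_edges_def by (intro card_image inj_on_edge_image)

lemma all_edges_eq: "all_edges n = {e. e \<subseteq> {..<n} \<and> card e = 2}"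
  by (auto simp: all_edges_def card_2_iff)

lemma finite_all_edges: "finite (all_edges n)"
  unfolding all_edges_eq by simp

lemma card_all_edges: "card (all_edges n) = n choose 2"
  unfolding all_edges_eq using n_subsets[of "{..<n}" 2] by simp

lemma copy_edges_subset:
  assumes "\<phi> \<in> emb n"
  shows "copy_edges \<phi> \<subseteq> all_edges n"
proof
  fix e' assume "e' \<in> copy_edges \<phi>"
  then obtain e where e: "e \<in> E" "e' = \<phi> ` e" by (auto simp: copy_edges_def)
  have "inj_on \<phi> e" using embD(1)[OF assms] edgeD(1)[OF e(1)] inj_on_subset by blast
  then have "card e' = 2" using e edgeD(2) by (simp add: card_image)
  moreover have "e' \<subseteq> {..<n}" using e edgeD(1)[OF e(1)] embD(3)[OF assms] by auto
  ultimately show "e' \<in> all_edges n" by (simp add: all_edges_eq)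
qed

lemma Union_copy_edges: "\<Union>(copy_edges \<phi>) = \<phi> ` V"
  using Union_E by (auto simp: copy_edges_def)

text \<open>Two embeddings with the same edge image also have the same vertex image, hence differ by
  a permutation of \<open>V\<close> that preserves \<open>E\<close>; the automorphism is
  \<open>inv_into V \<phi>0\<close> after \<open>\<phi>\<close>. It is extended by the identity off
  \<open>V\<close>, as \<open>Aut\<close> prescribes.\<close>

lemma card_fiber:
  assumes \<phi>0: "\<phi>0 \<in> emb n"
  shows "card {\<phi>\<in>emb n. copy_edges \<phi> = copy_edges \<phi>0} = card (Aut V E)"
proof -
  let ?F = "{\<phi>\<in>emb n. copy_edges \<phi> = copy_edges \<phi>0}"
  have inj0: "inj_on \<phi>0 V" by (rule embD[OF \<phi>0])
  have "bij_betw (\<lambda>\<sigma>. restrict (\<phi>0 \<circ> \<sigma>) V) (Aut V E) ?F"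
  proof (rule bij_betw_imageI)
    show "inj_on (\<lambda>\<sigma>. restrict (\<phi>0 \<circ> \<sigma>) V) (Aut V E)"
    proof (rule inj_onI, rule ext)
      fix \<sigma> \<tau> x
      assume s: "\<sigma> \<in> Aut V E" "\<tau> \<in> Aut V E" and e: "restrict (\<phi>0 \<circ> \<sigma>) V = restrict (\<phi>0 \<circ> \<tau>) V"
      show "\<sigma> x = \<tau> x"
      proof (cases "x \<in> V")
        case True
        then have "\<phi>0 (\<sigma> x) = \<phi>0 (\<tau> x)" using fun_cong[OF e, of x] by simp
        moreover have "\<sigma> x \<in> V" "\<tau> x \<in> V" using s True by (auto simp: Aut_def bij_betw_def)
        ultimately show ?thesis using inj0 by (auto dest: inj_onD)
      qed (use s in \<open>auto simp: Aut_def\<close>)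
    qed
    show "(\<lambda>\<sigma>. restrict (\<phi>0 \<circ> \<sigma>) V) ` Aut V E = ?F"
    proof (intro equalityI subsetI)
      fix \<phi> assume "\<phi> \<in> (\<lambda>\<sigma>. restrict (\<phi>0 \<circ> \<sigma>) V) ` Aut V E"
      then obtain \<sigma> where \<sigma>: "\<sigma> \<in> Aut V E" "\<phi> = restrict (\<phi>0 \<circ> \<sigma>) V" by auto
      have bij: "bij_betw \<sigma> V V" and pres: "\<And>e. e \<subseteq> V \<Longrightarrow> \<sigma> ` e \<in> E \<longleftrightarrow> e \<in> E"
        using \<sigma> by (auto simp: Aut_def)
      have sV: "\<sigma> ` V = V" "inj_on \<sigma> V" using bij by (auto simp: bij_betw_def)
      have "inj_on (\<phi>0 \<circ> \<sigma>) V" using inj0 sV by (intro comp_inj_on) auto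
      then have "inj_on \<phi> V" using \<sigma> by (auto simp: inj_on_def)
      moreover have "\<phi> x \<in> {..<n}" if "x \<in> V" for x
      proof -
        have "\<sigma> x \<in> V" using sV that by auto
        then show ?thesis using \<sigma> that embD(3)[OF \<phi>0] by auto
      qed
      then have "\<phi> \<in> V \<rightarrow>\<^sub>E {..<n}" using \<sigma> by auto
      moreover have img: "\<phi> ` e = \<phi>0 ` (\<sigma> ` e)" if "e \<subseteq> V" for e using that \<sigma> by (auto simp: image_image)
      have "copy_edges \<phi> = copy_edges \<phi>0"
      proof (intro equalityI subsetI)
        fix f assume "f \<in> copy_edges \<phi>"
        then obtain e where "e \<in> E" "f = \<phi> ` e" by (auto simp: copy_edges_def)
        then show "f \<in> copy_edges \<phi>0" using img pres edgeD(1)[of e] by (auto simp: copy_edges_def)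
      next
        fix f assume "f \<in> copy_edges \<phi>0"
        then obtain e where e: "e \<in> E" "f = \<phi>0 ` e" by (auto simp: copy_edges_def)
        obtain e' where e': "e' \<subseteq> V" "e = \<sigma> ` e'"
          using edgeD(1)[OF e(1)] sV(1) by (metis subset_image_iff)
        then have "e' \<in> E" using pres e by auto
        moreover have "f = \<phi> ` e'" using img[OF e'(1)] e e' by simp
        ultimately show "f \<in> copy_edges \<phi>" by (auto simp: copy_edges_def)
      qed
      ultimately show "\<phi> \<in> ?F" by (simp add: emb_def)
    next
      fix \<phi> assume "\<phi> \<in> ?F"
      then have \<phi>: "\<phi> \<in> emb n" and ce: "copy_edges \<phi> = copy_edges \<phi>0" by auto
      have inj: "inj_on \<phi> V" by (rule embD[OF \<phi>])
      have VV: "\<phi> ` V = \<phi>0 ` V" using Union_copy_edges[of \<phi>] Union_copy_edges[of \<phi>0] ce by simp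
      define \<sigma> where "\<sigma> x = (if x \<in> V then inv_into V \<phi>0 (\<phi> x) else x)" for x
      have s: "\<sigma> x \<in> V" "\<phi>0 (\<sigma> x) = \<phi> x" if "x \<in> V" for x
      proof -
        have "\<phi> x \<in> \<phi>0 ` V" using that VV by auto
        then show "\<sigma> x \<in> V" "\<phi>0 (\<sigma> x) = \<phi> x"
          using that by (auto simp: \<sigma>_def inv_into_into f_inv_into_f)
      qed
      have injs: "inj_on \<sigma> V"
      proof (rule inj_onI)
        fix x y assume "x \<in> V" "y \<in> V" "\<sigma> x = \<sigma> y"
        then have "\<phi> x = \<phi> y" using s by metis
        then show "x = y" using inj \<open>x \<in> V\<close> \<open>y \<in> V\<close> by (auto dest: inj_onD)
      qed
      have "\<sigma> ` V = V" using injs s finite_V by (intro endo_inj_surj) auto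
      then have bij: "bij_betw \<sigma> V V" using injs by (simp add: bij_betw_def)
      have img: "\<phi>0 ` (\<sigma> ` e) = \<phi> ` e" if "e \<subseteq> V" for e
        using that s by (force simp: image_image)
      have pres: "\<sigma> ` e \<in> E \<longleftrightarrow> e \<in> E" if e: "e \<subseteq> V" for e
      proof
        assume "\<sigma> ` e \<in> E"
        then have "\<phi>0 ` (\<sigma> ` e) \<in> copy_edges \<phi>0" unfolding copy_edges_def by (rule imageI)
        then have "\<phi> ` e \<in> copy_edges \<phi>" unfolding ce img[OF e] .
        then obtain e' where e': "e' \<in> E" "\<phi> ` e = \<phi> ` e'" by (auto simp: copy_edges_def)
        then have "e = e'" using inj_on_image_eq_iff[OF inj e edgeD(1)[OF e'(1)]] by simp
        then show "e \<in> E" using e' by simp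
      next
        assume "e \<in> E"
        then have "\<phi>0 ` (\<sigma> ` e) \<in> copy_edges \<phi>0" unfolding ce[symmetric] img[OF e] by (auto simp: copy_edges_def)
        then obtain e' where e': "e' \<in> E" "\<phi>0 ` (\<sigma> ` e) = \<phi>0 ` e'" by (auto simp: copy_edges_def)
        have "\<sigma> ` e \<subseteq> V" using e s by auto
        then have "\<sigma> ` e = e'" using inj_on_image_eq_iff[OF inj0 _ edgeD(1)[OF e'(1)]] e' by simp
        then show "\<sigma> ` e \<in> E" using e' by simp
      qed
      have "\<sigma> \<in> Aut V E" using bij pres by (auto simp: Aut_def \<sigma>_def)
      moreover have "\<phi> = restrict (\<phi>0 \<circ> \<sigma>) V"
        using s embD(2)[OF \<phi>] by (auto simp: fun_eq_iff restrict_def PiE_def extensional_def)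
      ultimately show "\<phi> \<in> (\<lambda>\<sigma>. restrict (\<phi>0 \<circ> \<sigma>) V) ` Aut V E" by auto
    qed
  qed
  from bij_betw_same_card[OF this] show ?thesis by simp
qed

lemma emb_nonempty: "card V \<le> n \<Longrightarrow> emb n \<noteq> {}"
proof -
  assume "card V \<le> n"
  then obtain f where "f ` V \<subseteq> {..<n}" "inj_on f V"
    using card_le_inj[of V "{..<n}"] finite_V by auto
  then have "restrict f V \<in> emb n" by (auto simp: emb_def inj_on_def)
  then show ?thesis by auto
qed

lemma card_Aut_pos: "0 < card (Aut V E)"
proof -
  obtain \<phi> where \<phi>: "\<phi> \<in> emb (card V)" using emb_nonempty[of "card V"] by auto
  have "{\<phi>'\<in>emb (card V). copy_edges \<phi>' = copy_edges \<phi>} \<noteq> {}" using \<phi> by auto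
  moreover have "finite {\<phi>'\<in>emb (card V). copy_edges \<phi>' = copy_edges \<phi>}" using finite_emb by simp
  ultimately show ?thesis using card_fiber[OF \<phi>] by (metis card_gt_0_iff)
qed

lemma card_emb_fixing_two:
  assumes x: "x \<in> V" "y \<in> V" "x \<noteq> y" and a: "a < n" "b < n" "a \<noteq> b"
  shows "card {\<phi>\<in>emb n. \<phi> x = a \<and> \<phi> y = b} = (\<Prod>i\<in>{0..<card V - 2}. (n - 2) - i)"
proof -
  let ?V = "V - {x, y}" and ?C = "{..<n} - {a, b}"
  let ?B = "{g \<in> ?V \<rightarrow>\<^sub>E ?C. inj_on g ?V}"
  have "bij_betw (\<lambda>\<phi>. restrict \<phi> ?V) {\<phi>\<in>emb n. \<phi> x = a \<and> \<phi> y = b} ?B"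
  proof (rule bij_betw_byWitness[where f' = "\<lambda>g. g(x := a, y := b)"])
    show "\<forall>\<phi>\<in>{\<phi>\<in>emb n. \<phi> x = a \<and> \<phi> y = b}. (restrict \<phi> ?V)(x := a, y := b) = \<phi>"
      by (auto simp: fun_eq_iff emb_def restrict_def PiE_def extensional_def)
    show "\<forall>g\<in>?B. restrict (g(x := a, y := b)) ?V = g"
      by (auto simp: fun_eq_iff restrict_def PiE_def extensional_def)
    show "(\<lambda>\<phi>. restrict \<phi> ?V) ` {\<phi>\<in>emb n. \<phi> x = a \<and> \<phi> y = b} \<subseteq> ?B"
    proof
      fix g assume "g \<in> (\<lambda>\<phi>. restrict \<phi> ?V) ` {\<phi>\<in>emb n. \<phi> x = a \<and> \<phi> y = b}"
      then obtain \<phi> where \<phi>: "\<phi> \<in> emb n" "\<phi> x = a" "\<phi> y = b" "g = restrict \<phi> ?V" by auto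
      have inj: "inj_on \<phi> V" by (rule embD[OF \<phi>(1)])
      have "\<phi> z \<in> ?C" if "z \<in> ?V" for z
        using that \<phi> x inj embD(3)[OF \<phi>(1)] by (auto dest: inj_onD)
      moreover have "inj_on g ?V" using inj \<phi> by (auto simp: inj_on_def)
      ultimately show "g \<in> ?B" using \<phi> by auto
    qed
    show "(\<lambda>g. g(x := a, y := b)) ` ?B \<subseteq> {\<phi>\<in>emb n. \<phi> x = a \<and> \<phi> y = b}"
    proof
      fix \<phi> assume "\<phi> \<in> (\<lambda>g. g(x := a, y := b)) ` ?B"
      then obtain g where g: "g \<in> ?V \<rightarrow>\<^sub>E ?C" "inj_on g ?V" "\<phi> = g(x := a, y := b)" by auto
      have gC: "g z < n" "g z \<noteq> a" "g z \<noteq> b" if "z \<in> ?V" for z using g that by auto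
      have "inj_on \<phi> V"
      proof (rule inj_onI)
        fix u v assume uv: "u \<in> V" "v \<in> V" "\<phi> u = \<phi> v"
        show "u = v"
        proof (cases "u \<in> ?V \<and> v \<in> ?V")
          case True
          then have "g u = g v" using uv g by auto
          then show ?thesis using True g by (auto dest: inj_onD)
        next
          case False
          then show ?thesis using uv g x a gC[of u] gC[of v] by (auto split: if_splits)
        qed
      qed
      moreover have "\<phi> \<in> V \<rightarrow>\<^sub>E {..<n}"
        using g x a gC by (auto simp: PiE_def extensional_def Pi_def)
      ultimately show "\<phi> \<in> {\<phi>\<in>emb n. \<phi> x = a \<and> \<phi> y = b}" using g x by (auto simp: emb_def)
    qed
  qed
  then have "card {\<phi>\<in>emb n. \<phi> x = a \<and> \<phi> y = b} = card ?B" by (rule bij_betw_same_card)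
  also have "\<dots> = card ?C ^ (card ?V - card ?V) * (\<Prod>i\<in>{0..<card ?V}. card ?C - i)"
    using finite_V by (intro card_inj_on_subset_funcset) auto
  also have "card ?C = n - 2" using a by (simp add: card_Diff_subset)
  also have "card ?V = card V - 2" using x finite_V by (simp add: card_Diff_subset)
  finally show ?thesis by simp
qed

lemma card_emb_edge_to:
  assumes e: "e \<in> E" and f: "f \<in> all_edges n"
  shows "card {\<phi>\<in>emb n. \<phi> ` e = f} = 2 * (\<Prod>i\<in>{0..<card V - 2}. (n - 2) - i)"
proof -
  obtain x y where xy: "e = {x, y}" "x \<noteq> y" using edgeD(2)[OF e] by (auto simp: card_2_iff)
  then have V: "x \<in> V" "y \<in> V" using edgeD(1)[OF e] by auto
  obtain a b where ab: "f = {a, b}" "a \<noteq> b" "a < n" "b < n" using f by (auto simp: all_edges_def)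
  note c1 = card_emb_fixing_two[OF V xy(2) ab(3,4,2)]
  have ba: "b \<noteq> a" using ab(2) by simp
  note c2 = card_emb_fixing_two[OF V xy(2) ab(4,3) ba]
  have eq: "{\<phi>\<in>emb n. \<phi> ` e = f} = {\<phi>\<in>emb n. \<phi> x = a \<and> \<phi> y = b} \<union> {\<phi>\<in>emb n. \<phi> x = b \<and> \<phi> y = a}"
    using xy ab by (auto simp: doubleton_eq_iff)
  have "card ({\<phi>\<in>emb n. \<phi> x = a \<and> \<phi> y = b} \<union> {\<phi>\<in>emb n. \<phi> x = b \<and> \<phi> y = a})
      = card {\<phi>\<in>emb n. \<phi> x = a \<and> \<phi> y = b} + card {\<phi>\<in>emb n. \<phi> x = b \<and> \<phi> y = a}"
    using finite_emb ab by (intro card_Un_disjoint) auto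
  then show ?thesis by (simp only: eq c1 c2 mult_2)
qed

text \<open>Embeddings whose copy contains \<open>f\<close> are counted twice: by copies, each with
  \<open>card (Aut V E)\<close> embeddings, and by the edge of \<open>H\<close> mapped onto
  \<open>f\<close>, with two orientations and an injective placement of the other vertices.\<close>

lemma copy_degree:
  assumes f: "f \<in> all_edges n" and n: "card V \<le> n"
  shows "real (card {S\<in>copy_graph n. f \<in> S}) = Delta_H V E n"
proof -
  let ?A = "{\<phi>\<in>emb n. f \<in> copy_edges \<phi>}" and ?T = "{S\<in>copy_graph n. f \<in> S}"
  define P where "P = (\<Prod>i\<in>{0..<card V - 2}. (n - 2) - i)"
  have "card ?A = (\<Sum>\<phi>\<in>?A. 1)" by simp
  also have "\<dots> = (\<Sum>S\<in>?T. \<Sum>\<phi>\<in>{\<phi>\<in>?A. copy_edges \<phi> = S}. 1)"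
    using finite_emb finite_copy_graph by (intro sum.group[symmetric]) (auto simp: copy_graph_def)
  also have "\<dots> = (\<Sum>S\<in>?T. card (Aut V E))"
  proof (rule sum.cong[OF refl])
    fix S assume S: "S \<in> ?T"
    then obtain \<phi>0 where \<phi>0: "\<phi>0 \<in> emb n" "S = copy_edges \<phi>0" by (auto simp: copy_graph_def)
    have "{\<phi>\<in>?A. copy_edges \<phi> = S} = {\<phi>\<in>emb n. copy_edges \<phi> = copy_edges \<phi>0}" using S \<phi>0 by auto
    then show "(\<Sum>\<phi>\<in>{\<phi>\<in>?A. copy_edges \<phi> = S}. 1) = card (Aut V E)" using card_fiber[OF \<phi>0(1)] by simp
  qed
  finally have 1: "card ?A = card ?T * card (Aut V E)" by simp
  have "?A = (\<Union>e\<in>E. {\<phi>\<in>emb n. \<phi> ` e = f})" by (auto simp: copy_edges_def)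
  also have "card \<dots> = (\<Sum>e\<in>E. card {\<phi>\<in>emb n. \<phi> ` e = f})"
  proof (rule card_UN_disjoint)
    show "\<forall>e\<in>E. \<forall>e'\<in>E. e \<noteq> e' \<longrightarrow> {\<phi>\<in>emb n. \<phi> ` e = f} \<inter> {\<phi>\<in>emb n. \<phi> ` e' = f} = {}"
      using inj_on_edge_image by (auto simp: inj_on_def)
  qed (use finite_E finite_emb in auto)
  also have "\<dots> = card E * (2 * P)" using card_emb_edge_to[OF _ f, folded P_def] by simp
  finally have "card ?T * card (Aut V E) = card E * (2 * P)" using 1 by simp
  then have 2: "real (card ?T) * real (card (Aut V E)) = real (card E) * (real 2 * real P)"
    unfolding of_nat_mult[symmetric] of_nat_eq_iff .
  have "real P = ffact_real (real n - 2) (card V - 2)"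
    unfolding P_def ffact_real_def of_nat_prod lessThan_atLeast0
    using n card_V_ge_3 by (intro prod.cong refl) (auto simp: of_nat_diff)
  then show ?thesis using 2 card_Aut_pos by (simp add: Delta_H_def field_simps)
qed

section \<open>Codegree and twin counts\<close>

lemma card_functions_into:
  assumes U: "U \<subseteq> V" and C: "finite C"
  shows "card {\<phi> \<in> V \<rightarrow>\<^sub>E {..<n}. \<phi> ` U \<subseteq> C} \<le> card C ^ card U * n ^ (card V - card U)"
    and "finite {\<phi> \<in> V \<rightarrow>\<^sub>E {..<n}. \<phi> ` U \<subseteq> C}"
proof -
  let ?T = "\<lambda>x. if x \<in> U then C else {..<n}"
  show "finite {\<phi> \<in> V \<rightarrow>\<^sub>E {..<n}. \<phi> ` U \<subseteq> C}"
    by (rule finite_subset[of _ "V \<rightarrow>\<^sub>E {..<n}"]) (auto intro!: finite_PiE finite_V)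
  have "card {\<phi> \<in> V \<rightarrow>\<^sub>E {..<n}. \<phi> ` U \<subseteq> C} \<le> card (PiE V ?T)"
    using finite_V C by (intro card_mono finite_PiE) (auto simp: PiE_def Pi_def)
  also have "\<dots> = (\<Prod>x\<in>V. card (?T x))" using finite_V by (rule card_PiE)
  also have "\<dots> = (\<Prod>x\<in>U. card (?T x)) * (\<Prod>x\<in>V - U. card (?T x))"
    using U finite_V by (metis mult.commute prod.subset_diff)
  also have "\<dots> = card C ^ card U * n ^ card (V - U)" by simp
  also have "card (V - U) = card V - card U" using U finite_V finite_subset by (metis card_Diff_subset)
  finally show "card {\<phi> \<in> V \<rightarrow>\<^sub>E {..<n}. \<phi> ` U \<subseteq> C} \<le> card C ^ card U * n ^ (card V - card U)" .
qed

text \<open>If a copy contains \<open>S\<close>, the edges mapped into \<open>S\<close> form some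
  \<open>F\<close> of the same size. The vertices of \<open>F\<close> then have at most
  \<open>2 * card E\<close> possible images each, the remaining vertices at most
  \<open>n\<close>.\<close>

lemma copy_codegree:
  assumes S: "S \<subseteq> all_edges n" "2 \<le> card S" "card S < card E"
  shows "card {f\<in>copy_graph n. S \<subseteq> f} \<le>
    (\<Sum>F\<in>{F. F \<subseteq> E \<and> card F = card S}. (2 * card E) ^ card V * n ^ (card V - card (\<Union>F)))"
proof -
  let ?FF = "{F. F \<subseteq> E \<and> card F = card S}"
  let ?M = "\<lambda>F. {\<phi> \<in> V \<rightarrow>\<^sub>E {..<n}. \<phi> ` \<Union>F \<subseteq> \<Union>S}"
  have finS: "finite S" using S finite_all_edges finite_subset by auto
  have cS: "\<And>s. s \<in> S \<Longrightarrow> finite s \<and> card s = 2"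
    using S by (auto simp: all_edges_def)
  have finUS: "finite (\<Union>S)" using finS cS by auto
  have "card (\<Union>S) \<le> (\<Sum>s\<in>S. card s)" by (rule card_Union_le_sum_card)
  also have "\<dots> = 2 * card S" using cS by simp
  finally have cUS: "card (\<Union>S) \<le> 2 * card E" using S by simp
  have finFF: "finite ?FF" using finite_E by simp
  have UF: "\<Union>F \<subseteq> V" if "F \<in> ?FF" for F using that edgeD by auto
  have sub: "{f\<in>copy_graph n. S \<subseteq> f} \<subseteq> (\<Union>F\<in>?FF. copy_edges ` ?M F)"
  proof
    fix f assume "f \<in> {f\<in>copy_graph n. S \<subseteq> f}"
    then obtain \<phi> where \<phi>: "\<phi> \<in> emb n" "f = copy_edges \<phi>" "S \<subseteq> copy_edges \<phi>" by (auto simp: copy_graph_def)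
    define F where "F = {e\<in>E. \<phi> ` e \<in> S}"
    have "(\<lambda>e. \<phi> ` e) ` F = S" using \<phi> by (auto simp: F_def copy_edges_def)
    moreover have "inj_on (\<lambda>e. \<phi> ` e) F" using inj_on_edge_image[OF \<phi>(1)] by (rule inj_on_subset) (auto simp: F_def)
    ultimately have "card F = card S" by (metis card_image)
    then have "F \<in> ?FF" by (auto simp: F_def)
    moreover have "\<phi> \<in> ?M F" using embD(2)[OF \<phi>(1)] by (auto simp: F_def)
    ultimately show "f \<in> (\<Union>F\<in>?FF. copy_edges ` ?M F)" using \<phi> by blast
  qed
  have "card {f\<in>copy_graph n. S \<subseteq> f} \<le> card (\<Union>F\<in>?FF. copy_edges ` ?M F)"
    using finFF card_functions_into(2)[OF UF finUS] by (intro card_mono sub) auto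
  also have "\<dots> \<le> (\<Sum>F\<in>?FF. card (copy_edges ` ?M F))" using finFF by (rule card_UN_le)
  also have "\<dots> \<le> (\<Sum>F\<in>?FF. (2 * card E) ^ card V * n ^ (card V - card (\<Union>F)))"
  proof (rule sum_mono)
    fix F assume F: "F \<in> ?FF"
    have cF: "card (\<Union>F) \<le> card V" using UF[OF F] finite_V by (intro card_mono)
    have "card (copy_edges ` ?M F) \<le> card (?M F)"
      using card_functions_into(2)[OF UF[OF F] finUS] by (rule card_image_le)
    also have "\<dots> \<le> card (\<Union>S) ^ card (\<Union>F) * n ^ (card V - card (\<Union>F))"
      by (rule card_functions_into(1)[OF UF[OF F] finUS])
    also have "card (\<Union>S) ^ card (\<Union>F) \<le> (2 * card E) ^ card (\<Union>F)" using cUS by (intro power_mono) auto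
    also have "(2 * card E) ^ card (\<Union>F) \<le> (2 * card E) ^ card V"
      using cF card_E_ge_3 by (intro power_increasing) auto
    finally show "card (copy_edges ` ?M F) \<le> (2 * card E) ^ card V * n ^ (card V - card (\<Union>F))"
      by simp
  qed
  finally show ?thesis .
qed

text \<open>Both copies share the edges \<open>f - {w}\<close>, and by
  \<open>Union_remove_edge\<close> these already cover the vertex set of either copy. So the copy
  contains all of \<open>w \<union> w'\<close>, at least three prescribed vertices, and one power of
  \<open>n\<close> is lost against the degree, which is of order
  \<open>n ^ (card V - 2)\<close>.\<close>

lemma copy_twins:
  assumes w: "w \<in> all_edges n" "w' \<in> all_edges n" "w \<noteq> w'"
  shows "card {f\<in>copy_graph n. w \<in> f \<and> w' \<notin> f \<and> insert w' (f - {w}) \<in> copy_graph n} \<le>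
    2 ^ card V * (64 * n ^ (card V - 3))"
proof -
  let ?UU = "{U. U \<subseteq> V \<and> card U = 3}"
  let ?C = "w \<union> w'"
  let ?M = "\<lambda>U. {\<phi> \<in> V \<rightarrow>\<^sub>E {..<n}. \<phi> ` U \<subseteq> ?C}"
  have cw: "card w = 2" "card w' = 2" "finite w" "finite w'" using w by (auto simp: all_edges_def)
  have finC: "finite ?C" using cw by simp
  have cC: "card ?C \<le> 4" using card_Un_le[of w w'] cw by simp
  have cC3: "3 \<le> card ?C"
  proof (rule ccontr)
    assume "\<not> 3 \<le> card ?C"
    then have "w = ?C" "w' = ?C" using cw card_mono[OF finC, of w] card_mono[OF finC, of w']
      by (auto intro!: card_subset_eq[OF finC])
    then show False using w by auto
  qed
  have finUU: "finite ?UU" using finite_V by simp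
  have cov: "\<Union>(copy_edges \<phi> - {s}) = \<phi> ` V" if \<phi>: "\<phi> \<in> emb n" and s: "s \<in> copy_edges \<phi>" for \<phi> s
  proof -
    obtain e where e: "e \<in> E" "s = \<phi> ` e" using s by (auto simp: copy_edges_def)
    have "copy_edges \<phi> - {s} = (\<lambda>e. \<phi> ` e) ` (E - {e})"
      using e inj_on_image_set_diff[OF inj_on_edge_image[OF \<phi>], of E "{e}"] by (auto simp: copy_edges_def)
    then have "\<Union>(copy_edges \<phi> - {s}) = \<phi> ` \<Union>(E - {e})" by auto
    then show ?thesis using Union_remove_edge[OF e(1)] by simp
  qed
  have sub: "{f\<in>copy_graph n. w \<in> f \<and> w' \<notin> f \<and> insert w' (f - {w}) \<in> copy_graph n} \<subseteq> (\<Union>U\<in>?UU. copy_edges ` ?M U)"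
  proof
    fix f assume "f \<in> {f\<in>copy_graph n. w \<in> f \<and> w' \<notin> f \<and> insert w' (f - {w}) \<in> copy_graph n}"
    then have f: "w \<in> f" "w' \<notin> f" and fc: "f \<in> copy_graph n" "insert w' (f - {w}) \<in> copy_graph n" by simp_all
    from fc(1) obtain \<phi> where \<phi>: "\<phi> \<in> emb n" "f = copy_edges \<phi>" unfolding copy_graph_def by (rule imageE)
    from fc(2) obtain \<psi> where \<psi>: "\<psi> \<in> emb n" "insert w' (f - {w}) = copy_edges \<psi>"
      unfolding copy_graph_def by (rule imageE)
    have "w' \<in> copy_edges \<psi>" using \<psi>(2) by auto
    have "copy_edges \<psi> - {w'} = f - {w}" using \<psi>(2) f by auto
    then have "\<Union>(f - {w}) = \<psi> ` V" using cov[OF \<psi>(1) \<open>w' \<in> copy_edges \<psi>\<close>] by simp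
    moreover have "w' \<subseteq> \<psi> ` V" using \<open>w' \<in> copy_edges \<psi>\<close> Union_copy_edges[of \<psi>] by auto
    moreover have "\<Union>(f - {w}) = \<phi> ` V" using cov[OF \<phi>(1)] \<phi>(2) f by auto
    moreover have "w \<subseteq> \<phi> ` V" using f \<phi>(2) Union_copy_edges[of \<phi>] by auto
    ultimately have C: "?C \<subseteq> \<phi> ` V" by auto
    define U where "U = {x\<in>V. \<phi> x \<in> ?C}"
    have "\<phi> ` U = ?C" using C by (auto simp: U_def)
    then have "3 \<le> card U" using cC3 card_image_le[of U \<phi>] finite_V by (auto simp: U_def)
    then obtain U' where U': "U' \<subseteq> U" "card U' = 3" by (metis obtain_subset_with_card_n)
    then have "U' \<in> ?UU" by (auto simp: U_def)
    moreover have "\<phi> \<in> ?M U'" using embD(2)[OF \<phi>(1)] U' by (auto simp: U_def)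
    ultimately show "f \<in> (\<Union>U\<in>?UU. copy_edges ` ?M U)" using \<phi> by blast
  qed
  have UV: "U \<subseteq> V" if "U \<in> ?UU" for U using that by simp
  have "card {f\<in>copy_graph n. w \<in> f \<and> w' \<notin> f \<and> insert w' (f - {w}) \<in> copy_graph n} \<le> card (\<Union>U\<in>?UU. copy_edges ` ?M U)"
    using finUU card_functions_into(2)[OF UV finC] by (intro card_mono sub) auto
  also have "\<dots> \<le> (\<Sum>U\<in>?UU. card (copy_edges ` ?M U))" using finUU by (rule card_UN_le)
  also have "\<dots> \<le> (\<Sum>U\<in>?UU. 64 * n ^ (card V - 3))"
  proof (rule sum_mono)
    fix U assume U: "U \<in> ?UU"
    have "card (copy_edges ` ?M U) \<le> card (?M U)"
      using card_functions_into(2)[OF UV[OF U] finC] by (rule card_image_le)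
    also have "\<dots> \<le> card ?C ^ card U * n ^ (card V - card U)"
      by (rule card_functions_into(1)[OF UV[OF U] finC])
    \<comment> \<open>\<open>64 = 4 ^ 3\<close>: three vertices of \<open>H\<close> are mapped into
      at most four points.\<close>
    also have "\<dots> \<le> 64 * n ^ (card V - 3)"
    proof -
      have "card ?C ^ 3 \<le> 4 ^ 3" using cC by (intro power_mono) auto
      then show ?thesis using U by simp
    qed
    finally show "card (copy_edges ` ?M U) \<le> 64 * n ^ (card V - 3)" .
  qed
  also have "\<dots> = card ?UU * (64 * n ^ (card V - 3))" by simp
  also have "\<dots> \<le> 2 ^ card V * (64 * n ^ (card V - 3))"
  proof (rule mult_right_mono)
    have "card ?UU \<le> card (Pow V)" using finite_V by (intro card_mono) auto
    then show "card ?UU \<le> 2 ^ card V" using finite_V by (simp add: card_Pow)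
  qed simp
  finally show ?thesis .
qed

end

section \<open>Asymptotics of the copy hypergraph\<close>

lemma ffact_real_asymp:
  "(\<lambda>n. ffact_real (real n - 2) j / real n ^ j) \<longlonglongrightarrow> 1"
proof -
  have "(\<lambda>n. (real n - 2 - real i) / real n) \<longlonglongrightarrow> 1" for i
  proof -
    have "(\<lambda>n. 1 - (2 + real i) * (1 / real n)) \<longlonglongrightarrow> 1 - (2 + real i) * 0"
      by (intro tendsto_intros lim_1_over_n)
    moreover have "eventually (\<lambda>n. (real n - 2 - real i) / real n = 1 - (2 + real i) * (1 / real n)) sequentially"
      using eventually_gt_at_top[of 0] by eventually_elim (simp add: field_simps)
    ultimately show ?thesis by (simp add: tendsto_cong)
  qed
  then have "(\<lambda>n. \<Prod>i<j. (real n - 2 - real i) / real n) \<longlonglongrightarrow> (\<Prod>i<j. 1)"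
    by (intro tendsto_prod)
  moreover have "(\<Prod>i<j. (real n - 2 - real i) / real n) = ffact_real (real n - 2) j / real n ^ j" for n
    by (simp add: ffact_real_def prod_dividef)
  ultimately show ?thesis by simp
qed

context balanced_graph
begin

definition copy_scale :: "nat \<Rightarrow> real" where
  "copy_scale n = Delta_H V E n powr (- 1 / (real (card E) - 1))"

text \<open>The sum runs over all relevant \<open>F\<close>, whatever their size, so that one
  quantity serves every codegree condition; the second summand serves the twin condition.\<close>

definition codegree_bound :: "nat \<Rightarrow> real" where
  "codegree_bound n =
     (\<Sum>F\<in>{F. F \<subseteq> E \<and> 2 \<le> card F \<and> card F < card E}.
        (2 * real (card E)) ^ card V * (copy_scale n ^ (card E - card F) * real n ^ (card V - card (\<Union>F))))
     + 2 ^ card V * 64 * (copy_scale n ^ (card E - 1) * real n ^ (card V - 3))"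

text \<open>This is \<open>1 / m2 V E\<close> for a strictly 2-balanced graph: the scale decays like
  \<open>n\<close> to the power \<open>- scale_exponent\<close>.\<close>

definition scale_exponent :: real where
  "scale_exponent = (real (card V) - 2) / (real (card E) - 1)"

lemma scale_exponent_bounds: "0 < scale_exponent" "scale_exponent < 1"
  using card_V_ge_3 card_V_le_card_E by (auto simp: scale_exponent_def)

lemma Delta_H_asymp:
  "(\<lambda>n. Delta_H V E n / real n ^ (card V - 2)) \<longlonglongrightarrow> 2 * real (card E) / real (card (Aut V E))"
proof -
  have "(\<lambda>n. 2 * real (card E) / real (card (Aut V E)) * (ffact_real (real n - 2) (card V - 2) / real n ^ (card V - 2)))
      \<longlonglongrightarrow> 2 * real (card E) / real (card (Aut V E)) * 1"
    by (intro tendsto_intros ffact_real_asymp)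
  then show ?thesis by (simp add: Delta_H_def)
qed

lemma Delta_H_pos: "eventually (\<lambda>n. 0 < Delta_H V E n) sequentially"
proof -
  have "0 < 2 * real (card E) / real (card (Aut V E))" using card_E_ge_3 card_Aut_pos by simp
  with Delta_H_asymp have "eventually (\<lambda>n. 0 < Delta_H V E n / real n ^ (card V - 2)) sequentially"
    by (rule order_tendstoD)
  then show ?thesis by eventually_elim (simp add: zero_less_divide_iff)
qed

lemma scale_asymp:
  "(\<lambda>n. copy_scale n * real n powr scale_exponent) \<longlonglongrightarrow>
     (2 * real (card E) / real (card (Aut V E))) powr (- 1 / (real (card E) - 1))" (is "_ \<longlonglongrightarrow> ?C powr ?a")
proof -
  have "(\<lambda>n. (Delta_H V E n / real n ^ (card V - 2)) powr ?a) \<longlonglongrightarrow> ?C powr ?a"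
    using card_E_ge_3 card_Aut_pos by (intro tendsto_powr Delta_H_asymp tendsto_const) auto
  moreover have "eventually (\<lambda>n. (Delta_H V E n / real n ^ (card V - 2)) powr ?a = copy_scale n * real n powr scale_exponent) sequentially"
    using Delta_H_pos eventually_gt_at_top[of 0]
  proof eventually_elim
    case (elim n)
    have n: "0 < real n" using elim by simp
    have "(real n ^ (card V - 2)) powr ?a = real n powr (real (card V - 2) * ?a)"
      using n by (simp add: powr_realpow[symmetric] powr_powr)
    also have "real (card V - 2) * ?a = - scale_exponent"
      using card_V_ge_3 by (simp add: scale_exponent_def of_nat_diff)
    finally have "(real n ^ (card V - 2)) powr ?a = real n powr (- scale_exponent)" .
    then show ?case
      using elim n by (simp add: copy_scale_def powr_divide powr_minus field_simps)
  qed
  ultimately show ?thesis by (simp add: tendsto_cong)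
qed

lemma scale_pos: "eventually (\<lambda>n. 0 < copy_scale n) sequentially"
  using Delta_H_pos by eventually_elim (simp add: copy_scale_def)

text \<open>With \<open>s = scale_exponent\<close>, the product is
  \<open>(copy_scale n * n powr s) ^ a\<close>, which converges, times the negative power
  \<open>n powr (b - s * a)\<close>.\<close>

lemma scale_power_tendsto_0:
  assumes "real b < scale_exponent * real a"
  shows "(\<lambda>n. copy_scale n ^ a * real n ^ b) \<longlonglongrightarrow> 0"
proof -
  let ?s = "real b - scale_exponent * real a"
  have "(\<lambda>n. real n powr ?s) \<longlonglongrightarrow> 0"
    using assms by (intro tendsto_neg_powr filterlim_real_sequentially) auto
  from tendsto_mult[OF tendsto_power[OF scale_asymp, of a] this]
  have "(\<lambda>n. (copy_scale n * real n powr scale_exponent) ^ a * real n powr ?s) \<longlonglongrightarrow> 0" by simp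
  moreover have "eventually (\<lambda>n. (copy_scale n * real n powr scale_exponent) ^ a * real n powr ?s = copy_scale n ^ a * real n ^ b) sequentially"
    using eventually_gt_at_top[of 0]
  proof eventually_elim
    case (elim n)
    have n: "0 < real n" using elim by simp
    have "(real n powr scale_exponent) ^ a = real n powr (scale_exponent * real a)"
      using n by (simp add: powr_realpow[symmetric] powr_powr)
    moreover have "real n powr (scale_exponent * real a) * real n powr ?s = real n ^ b"
      using n by (simp add: powr_add[symmetric] powr_realpow)
    ultimately show ?case by (simp add: power_mult_distrib mult.assoc)
  qed
  ultimately show ?thesis by (simp add: tendsto_cong)
qed

lemma scale_tendsto_0: "copy_scale \<longlonglongrightarrow> 0"
  using scale_power_tendsto_0[of 0 1] scale_exponent_bounds by simp

text \<open>For each \<open>F\<close> the required inequality between exponents is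
  \<open>sub_edge_density\<close> rearranged, so this is where strict 2-balance enters the
  asymptotics. For twins it reduces to \<open>h - 3 < h - 2\<close>.\<close>

lemma codegree_bound_tendsto_0: "codegree_bound \<longlonglongrightarrow> 0"
proof -
  let ?FF = "{F. F \<subseteq> E \<and> 2 \<le> card F \<and> card F < card E}"
  have k1: "real (card E) - 1 > 0" using card_E_ge_3 by simp
  have F: "(\<lambda>n. copy_scale n ^ (card E - card F) * real n ^ (card V - card (\<Union>F))) \<longlonglongrightarrow> 0" if "F \<in> ?FF" for F
  proof (rule scale_power_tendsto_0)
    have F: "F \<subseteq> E" "2 \<le> card F" "card F < card E" using that by auto
    have "(real (card V) - real (card (\<Union>F))) * (real (card E) - 1) < (real (card V) - 2) * (real (card E) - real (card F))"
      using sub_edge_density(1)[OF F] by (simp add: algebra_simps)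
    then have "real (card V) - real (card (\<Union>F)) < scale_exponent * (real (card E) - real (card F))"
      using k1 by (simp add: scale_exponent_def field_simps)
    then show "real (card V - card (\<Union>F)) < scale_exponent * real (card E - card F)"
      using F sub_edge_density(2)[OF F] by (simp add: of_nat_diff)
  qed
  have "(\<lambda>n. copy_scale n ^ (card E - 1) * real n ^ (card V - 3)) \<longlonglongrightarrow> 0"
    using card_V_ge_3 card_E_ge_3 by (intro scale_power_tendsto_0) (simp add: scale_exponent_def of_nat_diff)
  then have "codegree_bound \<longlonglongrightarrow> (\<Sum>F\<in>?FF. (2 * real (card E)) ^ card V * 0) + 2 ^ card V * 64 * 0"
    unfolding codegree_bound_def[abs_def] by (intro tendsto_intros F)
  then show ?thesis by simp
qed

lemma scale_choose_at_top:
  "filterlim (\<lambda>n. copy_scale n * real (card (all_edges n))) at_top sequentially"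
proof -
  let ?C = "(2 * real (card E) / real (card (Aut V E))) powr (- 1 / (real (card E) - 1))"
  have C: "0 < ?C" using card_E_ge_3 card_Aut_pos by simp
  have "(\<lambda>n. (1 - 1 / real n) / 2) \<longlonglongrightarrow> (1 - 0) / 2"
    by (intro tendsto_intros lim_1_over_n) auto
  from tendsto_mult[OF scale_asymp this]
  have lim: "(\<lambda>n. copy_scale n * real n powr scale_exponent * ((1 - 1 / real n) / 2)) \<longlonglongrightarrow> ?C * (1 / 2)" by simp
  have "filterlim (\<lambda>n. real n powr (2 - scale_exponent)) at_top sequentially"
    using scale_exponent_bounds
    by (intro filterlim_compose[OF real_powr_at_top filterlim_real_sequentially]) auto
  with lim have top: "filterlim (\<lambda>n. copy_scale n * real n powr scale_exponent * ((1 - 1 / real n) / 2) * real n powr (2 - scale_exponent)) at_top sequentially"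
    using C by (intro filterlim_tendsto_pos_mult_at_top) auto
  have ev: "eventually (\<lambda>n. copy_scale n * real n powr scale_exponent * ((1 - 1 / real n) / 2) * real n powr (2 - scale_exponent)
      = copy_scale n * real (card (all_edges n))) sequentially"
    using eventually_gt_at_top[of 0]
  proof eventually_elim
    case (elim n)
    have n: "0 < real n" using elim by simp
    have "real n powr scale_exponent * real n powr (2 - scale_exponent) = real n ^ 2"
      using n by (simp add: powr_add[symmetric] powr_numeral)
    moreover have "real (card (all_edges n)) = real n ^ 2 * ((1 - 1 / real n) / 2)"
    proof -
      have "real (n choose 2) = real n * (real n - 1) / 2"
        using elim by (simp add: choose_two real_of_nat_div of_nat_diff)
      moreover have "real n ^ 2 * (1 - 1 / real n) = real n * (real n - 1)"
        using n by (simp add: power2_eq_square right_diff_distrib)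
      ultimately show ?thesis by (simp add: card_all_edges)
    qed
    ultimately show ?case by (metis mult.assoc mult.commute)
  qed
  show ?thesis using top unfolding filterlim_cong[OF refl refl ev] .
qed

lemma sparse_copy_graph:
  assumes n: "card V \<le> n" and D: "0 < Delta_H V E n" and q: "copy_scale n \<le> 1" and d: "codegree_bound n \<le> 1"
  shows "sparse_hypergraph (all_edges n) (copy_graph n) (card E) (copy_scale n) (codegree_bound n)"
proof
  let ?FF = "{F. F \<subseteq> E \<and> 2 \<le> card F \<and> card F < card E}"
  let ?t = "\<lambda>F. (2 * real (card E)) ^ card V * (copy_scale n ^ (card E - card F) * real n ^ (card V - card (\<Union>F)))"
  have q0: "0 < copy_scale n" using D by (simp add: copy_scale_def)
  have t0: "0 \<le> ?t F" for F using q0 by simp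
  have finFF: "finite ?FF" using finite_E by simp
  have sum0: "0 \<le> (\<Sum>F\<in>?FF. ?t F)" using t0 by (intro sum_nonneg)
  have tw0: "0 \<le> 2 ^ card V * 64 * (copy_scale n ^ (card E - 1) * real n ^ (card V - 3))" using q0 by simp
  show "finite (all_edges n)" by (rule finite_all_edges)
  show "3 \<le> card E" by (rule card_E_ge_3)
  show "f \<subseteq> all_edges n" if "f \<in> copy_graph n" for f
    using that copy_edges_subset by (auto simp: copy_graph_def)
  show "card f = card E" if "f \<in> copy_graph n" for f
    using that card_copy_edges by (auto simp: copy_graph_def)
  show "0 < copy_scale n" "copy_scale n \<le> 1" "codegree_bound n \<le> 1" using q0 q d by auto
  show "0 \<le> codegree_bound n" unfolding codegree_bound_def using sum0 tw0 by linarith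
  show "real (card {f\<in>copy_graph n. w \<in> f}) * copy_scale n ^ (card E - 1) = 1" if "w \<in> all_edges n" for w
  proof -
    have "copy_scale n ^ (card E - 1) = Delta_H V E n powr (- 1 / (real (card E) - 1) * real (card E - 1))"
      unfolding copy_scale_def using D by (simp add: powr_realpow[symmetric] powr_powr)
    also have "- 1 / (real (card E) - 1) * real (card E - 1) = - 1"
      using card_E_ge_3 by (simp add: of_nat_diff)
    finally have "copy_scale n ^ (card E - 1) = 1 / Delta_H V E n" using D by (simp add: powr_minus field_simps)
    then show ?thesis using copy_degree[OF that n] D by simp
  qed
  show "real (card {f\<in>copy_graph n. S \<subseteq> f}) * copy_scale n ^ (card E - card S) \<le> codegree_bound n"
    if S: "S \<subseteq> all_edges n" "2 \<le> card S" "card S < card E" for S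
  proof -
    let ?GG = "{F. F \<subseteq> E \<and> card F = card S}"
    have "real (card {f\<in>copy_graph n. S \<subseteq> f}) \<le> real (\<Sum>F\<in>?GG. (2 * card E) ^ card V * n ^ (card V - card (\<Union>F)))"
      using copy_codegree[OF S] by (rule of_nat_mono)
    then have "real (card {f\<in>copy_graph n. S \<subseteq> f}) * copy_scale n ^ (card E - card S) \<le>
        real (\<Sum>F\<in>?GG. (2 * card E) ^ card V * n ^ (card V - card (\<Union>F))) * copy_scale n ^ (card E - card S)"
      using q0 by (intro mult_right_mono) auto
    also have "\<dots> = (\<Sum>F\<in>?GG. ?t F)"
      unfolding of_nat_sum sum_distrib_right by (intro sum.cong refl) (auto simp: mult_ac)
    also have "\<dots> \<le> (\<Sum>F\<in>?FF. ?t F)"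
      using S finFF t0 by (intro sum_mono2) auto
    also have "\<dots> \<le> codegree_bound n" unfolding codegree_bound_def using tw0 by linarith
    finally show ?thesis .
  qed
  show "real (card {f\<in>copy_graph n. w \<in> f \<and> w' \<notin> f \<and> insert w' (f - {w}) \<in> copy_graph n}) * copy_scale n ^ (card E - 1) \<le> codegree_bound n"
    if w: "w \<in> all_edges n" "w' \<in> all_edges n" "w \<noteq> w'" for w w'
  proof -
    have "real (card {f\<in>copy_graph n. w \<in> f \<and> w' \<notin> f \<and> insert w' (f - {w}) \<in> copy_graph n}) \<le>
        real (2 ^ card V * (64 * n ^ (card V - 3)))"
      using copy_twins[OF w] by (rule of_nat_mono)
    then have "real (card {f\<in>copy_graph n. w \<in> f \<and> w' \<notin> f \<and> insert w' (f - {w}) \<in> copy_graph n}) * copy_scale n ^ (card E - 1) \<le>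
        real (2 ^ card V * (64 * n ^ (card V - 3))) * copy_scale n ^ (card E - 1)"
      using q0 by (intro mult_right_mono) auto
    also have "\<dots> = 2 ^ card V * 64 * (copy_scale n ^ (card E - 1) * real n ^ (card V - 3))" by (simp add: mult_ac)
    also have "\<dots> \<le> codegree_bound n" unfolding codegree_bound_def using sum0 by linarith
    finally show ?thesis .
  qed
qed

sublocale sparse_hypergraph_sequence all_edges copy_graph "card E" copy_scale codegree_bound
proof
  have "eventually (\<lambda>n. copy_scale n < 1) sequentially" "eventually (\<lambda>n. codegree_bound n < 1) sequentially"
    using scale_tendsto_0 codegree_bound_tendsto_0 by (auto intro: order_tendstoD)
  with Delta_H_pos eventually_ge_at_top[of "card V"]
  show "eventually (\<lambda>n. sparse_hypergraph (all_edges n) (copy_graph n) (card E) (copy_scale n) (codegree_bound n)) sequentially"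
    by eventually_elim (rule sparse_copy_graph, auto)
qed (fact scale_tendsto_0 codegree_bound_tendsto_0 scale_choose_at_top card_E_ge_3)+

section \<open>Translation to the two random graph models\<close>

lemma prob_Gnp_eq:
  "prob_Gnp n p (\<lambda>G. X_H V E n G = 0) =
    (\<Sum>G\<in>{G. G \<subseteq> all_edges n \<and> avoids (copy_graph n) G}. p ^ card G * (1 - p) ^ (card (all_edges n) - card G))"
  by (simp add: prob_Gnp_def X_H_eq_0_iff)

lemma prob_Gnm_eq:
  "prob_Gnm n m (\<lambda>G. X_H V E n G = 0) = indep_ratio (all_edges n) (copy_graph n) m"
  unfolding prob_Gnm_def indep_ratio_def indep_count_def X_H_eq_0_iff
  by (simp add: conj_commute conj_left_commute)

lemma scale_normalisation:
  "Delta_H V E n powr (1 / (real (card E) - 1)) / real (n choose 2) * t = t / (copy_scale n * real (card (all_edges n)))"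
proof -
  have "copy_scale n = inverse (Delta_H V E n powr (1 / (real (card E) - 1)))"
    unfolding copy_scale_def minus_divide_left[symmetric] by (rule powr_minus)
  then show ?thesis by (simp add: card_all_edges divide_inverse)
qed

end

text \<open>Existence comes from the intermediate value theorem on \<open>[0, 1]\<close> and
  uniqueness from strict monotonicity, so the definite description is meaningful.
  \<open>D < exp 1\<close> places the value below 1, the strict inequality that the recursion
  needs.\<close>

lemma LambertW_props:
  assumes "0 < D" "D < exp 1"
  shows "0 < LambertW D" "LambertW D < 1" "LambertW D * exp (LambertW D) = D"
proof -
  have mono: "w * exp w < w' * exp w'" if "0 \<le> w" "w < w'" for w w' :: real
    using that by (intro mult_strict_mono) auto
  have "\<exists>w\<ge>0. w \<le> 1 \<and> w * exp w = D"
    using assms by (intro IVT') (auto intro!: continuous_intros)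
  then obtain w where w: "0 \<le> w" "w \<le> 1" "w * exp w = D" by auto
  have "LambertW D = w"
    unfolding LambertW_def
  proof (rule the_equality)
    fix w' assume "0 \<le> w' \<and> w' * exp w' = D"
    then show "w' = w" using mono[of w w'] mono[of w' w] w by (cases w w' rule: linorder_cases) auto
  qed (use w in auto)
  moreover have "w \<noteq> 0" "w \<noteq> 1" using w assms by auto
  ultimately show "0 < LambertW D" "LambertW D < 1" "LambertW D * exp (LambertW D) = D" using w by auto
qed

theorem mainTheorem1:
  fixes V :: "'a set" and E :: "'a set set" and c :: real
  assumes H: "simple_graph V E"
    and sb: "strictly_2_balanced V E"
    and c_pos: "0 < c"
    and c_lt: "c < (exp 1 / (real (card E) - 1)) powr (1 / (real (card E) - 1))"
  shows "(\<forall>p :: nat \<Rightarrow> real.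
            p \<sim>[at_top] (\<lambda>n. c * Delta_H V E n powr (- 1 / (real (card E) - 1))) \<longrightarrow>
            ((\<lambda>n. Delta_H V E n powr (1 / (real (card E) - 1)) / real (n choose 2)
                   * ln (prob_Gnp n (p n) (\<lambda>G. X_H V E n G = 0)))
             \<longlongrightarrow>
              (let k = real (card E);
                   xs = (LambertW ((k - 1) * c powr (k - 1)) / (k - 1)) powr (1 / (k - 1))
               in xs + (1 - 1 / k) * xs ^ card E - c)) at_top)
       \<and> (\<forall>(b :: real) (m :: nat \<Rightarrow> nat).
            0 < b \<and> b < (real (card E) - 1) powr (- 1 / (real (card E) - 1)) \<and>
            (\<lambda>n. real (m n)) \<sim>[at_top]
              (\<lambda>n. b * Delta_H V E n powr (- 1 / (real (card E) - 1)) * real (n choose 2)) \<longrightarrow>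
            ((\<lambda>n. Delta_H V E n powr (1 / (real (card E) - 1)) / real (n choose 2)
                   * ln (prob_Gnm n (m n) (\<lambda>G. X_H V E n G = 0)))
             \<longlongrightarrow> - (b ^ card E) / real (card E)) at_top)"
proof -
  interpret balanced_graph V E using H sb by unfold_locales
  define k where "k = card E"
  have k3: "3 \<le> k" using card_E_ge_3 by (simp add: k_def)
  have k1: "real k - 1 > 0" using k3 by simp
  have kn: "real (k - 1) = real k - 1" using k3 by simp
  have root_power: "(y powr (1 / (real k - 1))) ^ (k - 1) = y" if "0 < y" for y :: real
  proof -
    have "(y powr (1 / (real k - 1))) ^ (k - 1) = y powr (1 / (real k - 1) * real (k - 1))"
      using that by (simp add: powr_realpow[symmetric] powr_powr)
    then show ?thesis using k1 that by (simp add: kn)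
  qed
  have root_less: "a ^ (k - 1) < y" if "0 < a" "0 < y" "a < y powr (1 / (real k - 1))" for a y :: real
  proof -
    have "a ^ (k - 1) < (y powr (1 / (real k - 1))) ^ (k - 1)"
      using that k3 by (intro power_strict_mono) auto
    then show ?thesis using root_power[OF that(2)] by simp
  qed
  define D where "D = (real k - 1) * c ^ (k - 1)"
  have "c ^ (k - 1) < exp 1 / (real k - 1)"
    using c_pos c_lt k1 by (intro root_less) (auto simp: k_def)
  then have D: "0 < D" "D < exp 1" using k1 c_pos by (auto simp: D_def field_simps)
  define w where "w = LambertW D"
  have w: "0 < w" "w < 1" "w * exp w = D" using LambertW_props[OF D] by (auto simp: w_def)
  define x where "x = (w / (real k - 1)) powr (1 / (real k - 1))"
  have x0: "0 < x" using w k1 by (simp add: x_def)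
  have xp: "x ^ (k - 1) = w / (real k - 1)" unfolding x_def using w k1 by (intro root_power) simp
  have small: "(real k - 1) * x ^ (k - 1) < 1" using xp w k1 by simp
  \<comment> \<open>Raised to the power \<open>k - 1\<close>, the equation becomes
    \<open>w * exp w = D\<close> up to the factor \<open>k - 1\<close>; both sides are nonnegative,
    so the root may be taken.\<close>
  have psi: "x * exp (x ^ (k - 1)) = c"
  proof (rule power_eq_imp_eq_base[of _ "k - 1"])
    have "(x * exp (x ^ (k - 1))) ^ (k - 1) = x ^ (k - 1) * exp (real (k - 1) * x ^ (k - 1))"
      by (simp only: power_mult_distrib exp_of_nat_mult)
    also have "\<dots> = w / (real k - 1) * exp w" unfolding kn using xp k1 by simp
    also have "\<dots> = c ^ (k - 1)" using w(3) k1 by (simp add: D_def field_simps)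
    finally show "(x * exp (x ^ (k - 1))) ^ (k - 1) = c ^ (k - 1)" .
  qed (use x0 c_pos k3 in auto)
  have cpow: "c powr (real k - 1) = c ^ (k - 1)" using powr_realpow[OF c_pos, of "k - 1"] by (simp only: kn)
  show ?thesis
  proof (intro conjI allI impI)
    fix p :: "nat \<Rightarrow> real"
    assume "p \<sim>[at_top] (\<lambda>n. c * Delta_H V E n powr (- 1 / (real (card E) - 1)))"
    then have "p \<sim>[at_top] (\<lambda>n. c * copy_scale n)" by (simp add: copy_scale_def)
    \<comment> \<open>Asymptotic equivalence counts a quotient of two zeros as 1; excluding that
      case makes it a genuine limit of quotients.\<close>
    moreover have "eventually (\<lambda>n. p n \<noteq> 0 \<or> c * copy_scale n \<noteq> 0) at_top"
      using scale_pos by eventually_elim (use c_pos in auto)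
    ultimately have "(\<lambda>n. p n / (c * copy_scale n)) \<longlonglongrightarrow> 1" by (rule asymp_equivD_strong)
    then have "(\<lambda>n. c * (p n / (c * copy_scale n))) \<longlonglongrightarrow> c * 1" by (rule tendsto_mult_left)
    then have "(\<lambda>n. p n / copy_scale n) \<longlonglongrightarrow> x * exp (x ^ (card E - 1))"
      using c_pos psi by (simp add: k_def)
    from ln_binomial_model_tendsto[OF x0 small[unfolded k_def] this]
    have "(\<lambda>n. ln (prob_Gnp n (p n) (\<lambda>G. X_H V E n G = 0)) / (copy_scale n * real (card (all_edges n)))) \<longlonglongrightarrow>
        x + (1 - 1 / real k) * x ^ k - c"
      unfolding prob_Gnp_eq psi[unfolded k_def] by (simp add: k_def)
    moreover have "x = (LambertW ((real (card E) - 1) * c powr (real (card E) - 1)) / (real (card E) - 1)) powr (1 / (real (card E) - 1))"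
      unfolding x_def w_def D_def k_def cpow[unfolded k_def] by (rule refl)
    ultimately show "((\<lambda>n. Delta_H V E n powr (1 / (real (card E) - 1)) / real (n choose 2)
                   * ln (prob_Gnp n (p n) (\<lambda>G. X_H V E n G = 0)))
             \<longlongrightarrow>
              (let k = real (card E);
                   xs = (LambertW ((k - 1) * c powr (k - 1)) / (k - 1)) powr (1 / (k - 1))
               in xs + (1 - 1 / k) * xs ^ card E - c)) at_top"
      unfolding scale_normalisation Let_def k_def by (simp only:)
  next
    fix b :: real and m :: "nat \<Rightarrow> nat"
    assume a: "0 < b \<and> b < (real (card E) - 1) powr (- 1 / (real (card E) - 1)) \<and>
            (\<lambda>n. real (m n)) \<sim>[at_top]
              (\<lambda>n. b * Delta_H V E n powr (- 1 / (real (card E) - 1)) * real (n choose 2))"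
    then have b: "0 < b" and bl: "b < (real k - 1) powr (- 1 / (real k - 1))"
      and m: "(\<lambda>n. real (m n)) \<sim>[at_top] (\<lambda>n. b * (copy_scale n * real (card (all_edges n))))"
      by (auto simp: k_def copy_scale_def card_all_edges mult.assoc)
    have "(real k - 1) powr (- 1 / (real k - 1)) = (1 / (real k - 1)) powr (1 / (real k - 1))"
      unfolding minus_divide_left[symmetric] powr_minus_divide using k1 by (simp add: powr_divide)
    then have "b ^ (k - 1) < 1 / (real k - 1)" using b bl k1 by (intro root_less) auto
    then have small_b: "(real k - 1) * b ^ (k - 1) < 1" using k1 by (simp add: field_simps)
    have "eventually (\<lambda>n. 0 < copy_scale n * real (card (all_edges n))) at_top"
      using scale_choose_at_top[unfolded filterlim_at_top_dense] by blast
    then have "eventually (\<lambda>n. real (m n) \<noteq> 0 \<or> b * (copy_scale n * real (card (all_edges n))) \<noteq> 0) at_top"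
    proof eventually_elim
      case (elim n)
      have "0 < b * (copy_scale n * real (card (all_edges n)))" using b elim by (rule mult_pos_pos)
      then have "b * (copy_scale n * real (card (all_edges n))) \<noteq> 0" by (rule less_imp_neq[THEN not_sym])
      then show ?case by (rule disjI2)
    qed
    with m have "(\<lambda>n. real (m n) / (b * (copy_scale n * real (card (all_edges n))))) \<longlonglongrightarrow> 1"
      by (rule asymp_equivD_strong)
    then have "(\<lambda>n. b * (real (m n) / (b * (copy_scale n * real (card (all_edges n)))))) \<longlonglongrightarrow> b * 1"
      by (rule tendsto_mult_left)
    then have "(\<lambda>n. real (m n) / (copy_scale n * real (card (all_edges n)))) \<longlonglongrightarrow> b" using b by simp
    from ln_indep_ratio_tendsto[OF b small_b[unfolded k_def] this]
    show "((\<lambda>n. Delta_H V E n powr (1 / (real (card E) - 1)) / real (n choose 2)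
                   * ln (prob_Gnm n (m n) (\<lambda>G. X_H V E n G = 0)))
             \<longlongrightarrow> - (b ^ card E) / real (card E)) at_top"
      unfolding scale_normalisation prob_Gnm_eq by simp
  qed
qed

end
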